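(* Let $x^0\in\mathbb R^d$ and fix $i\in\{1,2\}$. Assume the existence of a reference control $u_i^\flat=u_i^\flat(x^0)\in L^\infty((t_0,T);\mathbb R^k)$ such that $\mathcal N_{\tau_i}(u_i^\flat)$ is invertible. Let $C_i:=(1+\theta)/\lambda_{\min}(\mathcal N_{\tau_i}(u_i^\flat))$ where $\theta\in(0,1]$, let $y_i\in\mathbb R^d$, and let $L_{\mathcal N_{\tau_i}}>0$ be the Lipschitz constant of $u\mapsto\mathcal N_{\tau_i}(u)$ on $\{u\in L^\infty((t_0,T);\mathbb R^k):\|u\|_\infty\le\zeta_i\}$ given in the context. Furthermore, assume that $$\|u_i^\flat\|_\infty<\frac{\theta\,\lambda_{\min}(\mathcal N_{\tau_i}(u_i^\flat))}{(1+\theta)\,L_{\mathcal N_{\tau_i}}}.$$ Then $\mathcal F(C_i)\neq\emptyset$, and $\mathcal S_i(\mathcal F(C_i))\subset\mathcal F(C_i)$ holds if $y_i$ satisfies $$|y_i|\le\vartheta(u_i^\flat):=\frac{\lambda_{\min}(\mathcal N_{\tau_i}(u_i^\flat))}{(1+\theta)\,\|B\|_\infty\,e^{\Lambda_1\Delta t_0}}\left(\frac{\theta\,\lambda_{\min}(\mathcal N_{\tau_i}(u_i^\flat))}{(1+\theta)\,L_{\mathcal N_{\tau_i}}}-\|u_i^\flat\|_\infty\right).$$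
   Context: Setting. Fix $t_0<T$, $\Delta t_0:=T-t_0$; $|\cdot|$ is the Euclidean norm and $\|\cdot\|$ the spectral norm of matrices (operator norm for multilinear maps). $N_t:[t_0,T]\times\mathbb R^d\to\mathbb R^d$ satisfies: $t\mapsto N_t(x)$ is in $L^\infty(t_0,T)$ for each $x$; $x\mapsto N_t(x)$ is $C^2$ for each $t$; there are $\Lambda_1,\Lambda_2>0$ with $\|DN_t(x)\|\le\Lambda_1$ and $\|D^2N_t(x)\|\le\Lambda_2$ for all $(t,x)$. $\Phi_{s,t}$, $(s,t)\in[t_0,T]^2$, is the flow: $\frac{d}{dt}\Phi_{s,t}(x)=N_t(\Phi_{s,t}(x))$, $\Phi_{s,s}(x)=x$; $D\Phi_{s,t}$ is its derivative in $x$. $B\in L^\infty((t_0,T)\times\mathbb R^d;\mathbb R^{d\times k})$, $x\mapsto B(t,x)$ is $C^1$ with $\|D_xB(t,x)\|\le L_B$ for all $(t,x)$, for some $L_B\ge0$ ($L_B=0$ if $B$ does not depend on $x$); $\|B\|_\infty$ is the essential supremum of the spectral norm. For $u\in L^\infty((t_0,T);\mathbb R^k)$, $x_u$ is the absolutely continuous solution of $\dot x(t)=N_t(x(t))+B(t,x(t))u(t)$, $x(t_0)=x^0$. Set $\tau_1:=t_0$, $\tau_2:=T$, and $$\mathcal N_{\tau_i}(u)=\int_{t_0}^TD\Phi_{t,\tau_i}(x_u(t))B(t,x_u(t))B(t,x_u(t))^\top D\Phi_{t,\tau_i}(x_u(t))^\top dt.$$ $\mathcal F(C_i):=\{u\in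 L^\infty((t_0,T);\mathbb R^k):\lambda_{\min}(\mathcal N_{\tau_i}(u))\ge C_i^{-1}\}$ ($\lambda_{\min}$: smallest eigenvalue). The synthesis map is $\mathcal S_i(u)(t)=B(t,x_u(t))^\top D\Phi_{t,\tau_i}(x_u(t))^\top\mathcal N_{\tau_i}(u)^\dagger y_i$ on $L^\infty((t_0,T);\mathbb R^k)$ ($\dagger$: Moore–Penrose pseudoinverse, equal to the inverse on $\mathcal F(C_i)$). Set $\zeta_i:=C_i\|B\|_\infty e^{\Lambda_1\Delta t_0}|y_i|$. The Lipschitz constants are, writing $\Delta=\Delta t_0$, $$L_{\mathcal N_{\tau_1}}=\frac{L_B\|B\|_\infty^2e^{\Lambda_1\Delta}}{\Lambda_1}\Big[\frac{e^{(2\Lambda_1+L_B\zeta_1)\Delta}-e^{\Lambda_1\Delta}}{\Lambda_1+L_B\zeta_1}+\frac{e^{(2\Lambda_1+L_B\zeta_1)\Delta}-e^{-\Lambda_1\Delta}}{L_B\zeta_1+3\Lambda_1}\Big]+\frac{2\|B\|_\infty^3\Lambda_2e^{\Lambda_1\Delta}}{\Lambda_1(\Lambda_1+L_B\zeta_1)}\Big[\frac{e^{(3\Lambda_1+L_B\zeta_1)\Delta}-e^{-\Lambda_1\Delta}}{4\Lambda_1+L_B\zeta_1}-\frac{e^{(2\Lambda_1+L_B\zeta_1)\Delta}-e^{-\Lambda_1\Delta}}{3\Lambda_1+L_B\zeta_1}+\frac{e^{\Lambda_1\Delta}-e^{-\Lambda_1\Delta}}{2\Lambda_1}-\frac{e^{2\Lambda_1\Delta}-e^{-\Lambda_1\Delta}}{3\Lambda_1}\Big],$$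 $$L_{\mathcal N_{\tau_2}}=\frac{L_B\|B\|_\infty^2e^{\Lambda_1\Delta}}{\Lambda_1}\Big[\frac{e^{\Lambda_1\Delta}-e^{L_B\zeta_2\Delta}}{\Lambda_1-L_B\zeta_2}-\frac{e^{L_B\zeta_2\Delta}-e^{-\Lambda_1\Delta}}{L_B\zeta_2+\Lambda_1}\Big]+\frac{2\|B\|_\infty^3\Lambda_2e^{\Lambda_1\Delta}}{\Lambda_1(\Lambda_1+L_B\zeta_2)}\Big[\frac{e^{2\Lambda_1\Delta}-e^{L_B\zeta_2\Delta}}{2\Lambda_1-L_B\zeta_2}+\frac{e^{\Lambda_1\Delta}-e^{L_B\zeta_2\Delta}}{\Lambda_1-L_B\zeta_2}+\frac{e^{\Lambda_1\Delta}-e^{-\Lambda_1\Delta}}{2\Lambda_1}-\frac{e^{2\Lambda_1\Delta}-e^{-\Lambda_1\Delta}}{3\Lambda_1}\Big],$$ where a quotient $(e^{a\Delta}-e^{b\Delta})/(a-b)$ is read as its limit $\Delta e^{a\Delta}$ when $a=b$. *)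

theory Defs
  imports "HOL-Analysis.Analysis" "HOL-Probability.Essential_Supremum"
begin

(* The library norm on real^'n^'m is the Frobenius norm, so the spectral norm is the
   operator norm of the associated linear map. *)
definition spectral_norm :: "real^'n^'m \<Rightarrow> real" where
  "spectral_norm A = onorm (\<lambda>v. A *v v)"

(* Operator norm of a linear map into matrices (equivalently, of the bilinear map
   (h, v) \<mapsto> D h *v v) with respect to the Euclidean norm on the domain and the spectral norm
   on the codomain; compare onorm_def. *)
definition spectral_opnorm :: "((real^'d) \<Rightarrow>\<^sub>L (real^'n^'m)) \<Rightarrow> real" where
  "spectral_opnorm D = (SUP h. spectral_norm (blinfun_apply D h) / norm h)"

definition eigenvalues :: "real^'n^'n \<Rightarrow> real set" where
  "eigenvalues A = {l. \<exists>v. v \<noteq> 0 \<and> A *v v = l *\<^sub>R v}"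

(* Used for symmetric matrices only, where the set of eigenvalues is finite and nonempty. *)
definition lambda_min :: "real^'n^'n \<Rightarrow> real" where
  "lambda_min A = Min (eigenvalues A)"

(* The four Penrose conditions; they determine X uniquely. *)
definition is_pinv :: "real^'n^'m \<Rightarrow> real^'m^'n \<Rightarrow> bool" where
  "is_pinv A X \<longleftrightarrow> A ** X ** A = A \<and> X ** A ** X = X
     \<and> transpose (A ** X) = A ** X \<and> transpose (X ** A) = X ** A"

definition pinv :: "real^'n^'m \<Rightarrow> real^'m^'n" where
  "pinv A = (THE X. is_pinv A X)"

definition Linf :: "'a measure \<Rightarrow> ('a \<Rightarrow> 'b::real_normed_vector) set" where
  "Linf M = {f. f \<in> borel_measurable M \<and> (\<exists>c. AE x in M. norm (f x) \<le> c)}"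

definition ess_sup :: "'a measure \<Rightarrow> ('a \<Rightarrow> real) \<Rightarrow> real" where
  "ess_sup M g = real_of_ereal (esssup M (\<lambda>x. ereal (g x)))"

definition controls :: "real \<Rightarrow> real \<Rightarrow> (real \<Rightarrow> real^'k) set" where
  "controls t0 T = Linf (lebesgue_on {t0<..<T})"

definition control_norm :: "real \<Rightarrow> real \<Rightarrow> (real \<Rightarrow> real^'k) \<Rightarrow> real" where
  "control_norm t0 T u = ess_sup (lebesgue_on {t0<..<T}) (\<lambda>t. norm (u t))"

definition B_norm :: "real \<Rightarrow> real \<Rightarrow> (real \<Rightarrow> real^'d \<Rightarrow> real^'k^'d) \<Rightarrow> real" where
  "B_norm t0 T B = ess_sup (lebesgue_on ({t0<..<T} \<times> UNIV)) (\<lambda>(t, x). spectral_norm (B t x))"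

(* The finite set P of pairs (a, b) represents a finite family of non-overlapping
   intervals [a, b]. *)
definition abs_continuous_on :: "real \<Rightarrow> real \<Rightarrow> (real \<Rightarrow> 'a::real_normed_vector) \<Rightarrow> bool" where
  "abs_continuous_on l r f \<longleftrightarrow>
     (\<forall>\<epsilon>>0. \<exists>\<delta>>0. \<forall>P. finite P
        \<and> (\<forall>(a, b)\<in>P. l \<le> a \<and> a \<le> b \<and> b \<le> r)
        \<and> (\<forall>p\<in>P. \<forall>q\<in>P. p \<noteq> q \<longrightarrow> {fst p<..<snd p} \<inter> {fst q<..<snd q} = {})
        \<and> (\<Sum>(a, b)\<in>P. b - a) < \<delta>
        \<longrightarrow> (\<Sum>(a, b)\<in>P. norm (f b - f a)) < \<epsilon>)"

definition solves_ae ::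
  "real \<Rightarrow> real \<Rightarrow> (real \<Rightarrow> real^'d \<Rightarrow> real^'d) \<Rightarrow> (real \<Rightarrow> real^'d) \<Rightarrow> bool" where
  "solves_ae t0 T F x \<longleftrightarrow> abs_continuous_on t0 T x
     \<and> (AE t in lebesgue_on {t0<..<T}. (x has_vector_derivative F t (x t)) (at t))"

(* The equation is imposed on all of [t0, T], i.e. both forward and backward from s. *)
definition is_flow ::
  "real \<Rightarrow> real \<Rightarrow> (real \<Rightarrow> real^'d \<Rightarrow> real^'d) \<Rightarrow> (real \<Rightarrow> real \<Rightarrow> real^'d \<Rightarrow> real^'d) \<Rightarrow> bool" where
  "is_flow t0 T N \<Phi> \<longleftrightarrow>
     (\<forall>s\<in>{t0..T}. \<forall>x. solves_ae t0 T N (\<lambda>t. \<Phi> s t x) \<and> \<Phi> s s x = x)"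

definition is_trajectory ::
  "real \<Rightarrow> real \<Rightarrow> (real \<Rightarrow> real^'d \<Rightarrow> real^'d) \<Rightarrow> (real \<Rightarrow> real^'d \<Rightarrow> real^'k^'d) \<Rightarrow> real^'d
     \<Rightarrow> (real \<Rightarrow> real^'k) \<Rightarrow> (real \<Rightarrow> real^'d) \<Rightarrow> bool" where
  "is_trajectory t0 T N B x0 u x \<longleftrightarrow>
     solves_ae t0 T (\<lambda>t z. N t z + B t z *v u t) x \<and> x t0 = x0"

definition tau :: "real \<Rightarrow> real \<Rightarrow> nat \<Rightarrow> real" where
  "tau t0 T i = (if i = 1 then t0 else T)"

(* In the following definitions X u is the trajectory of the control u, and
   jacobian (\<Phi> t \<tau>) (at x) is the matrix of the spatial derivative of the flow. *)
definition gram ::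
  "real \<Rightarrow> real \<Rightarrow> (real \<Rightarrow> real \<Rightarrow> real^'d \<Rightarrow> real^'d) \<Rightarrow> (real \<Rightarrow> real^'d \<Rightarrow> real^'k^'d)
     \<Rightarrow> ((real \<Rightarrow> real^'k) \<Rightarrow> real \<Rightarrow> real^'d) \<Rightarrow> real \<Rightarrow> (real \<Rightarrow> real^'k) \<Rightarrow> real^'d^'d" where
  "gram t0 T \<Phi> B X \<tau> u =
     (LINT t|lebesgue_on {t0<..<T}.
        jacobian (\<Phi> t \<tau>) (at (X u t)) ** B t (X u t)
          ** transpose (B t (X u t)) ** transpose (jacobian (\<Phi> t \<tau>) (at (X u t))))"

definition feasible ::
  "real \<Rightarrow> real \<Rightarrow> (real \<Rightarrow> real \<Rightarrow> real^'d \<Rightarrow> real^'d) \<Rightarrow> (real \<Rightarrow> real^'d \<Rightarrow> real^'k^'d)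
     \<Rightarrow> ((real \<Rightarrow> real^'k) \<Rightarrow> real \<Rightarrow> real^'d) \<Rightarrow> real \<Rightarrow> real \<Rightarrow> (real \<Rightarrow> real^'k) set" where
  "feasible t0 T \<Phi> B X \<tau> C =
     {u \<in> controls t0 T. lambda_min (gram t0 T \<Phi> B X \<tau> u) \<ge> inverse C}"

definition synthesis ::
  "real \<Rightarrow> real \<Rightarrow> (real \<Rightarrow> real \<Rightarrow> real^'d \<Rightarrow> real^'d) \<Rightarrow> (real \<Rightarrow> real^'d \<Rightarrow> real^'k^'d)
     \<Rightarrow> ((real \<Rightarrow> real^'k) \<Rightarrow> real \<Rightarrow> real^'d) \<Rightarrow> real \<Rightarrow> real^'d \<Rightarrow> (real \<Rightarrow> real^'k) \<Rightarrow> (real \<Rightarrow> real^'k)"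
where
  "synthesis t0 T \<Phi> B X \<tau> y u =
     (\<lambda>t. transpose (B t (X u t)) *v (transpose (jacobian (\<Phi> t \<tau>) (at (X u t)))
        *v (pinv (gram t0 T \<Phi> B X \<tau> u) *v y)))"

(* (exp (a \<Delta>) - exp (b \<Delta>)) / (a - b), continued to a = b by its limit. *)
definition exp_quot :: "real \<Rightarrow> real \<Rightarrow> real \<Rightarrow> real" where
  "exp_quot \<Delta> a b =
     (if a = b then \<Delta> * exp (a * \<Delta>) else (exp (a * \<Delta>) - exp (b * \<Delta>)) / (a - b))"

(* Arguments: \<Lambda>1, \<Lambda>2, L_B, the sup norm \<beta> of B, \<Delta> = T - t0, and \<zeta>. For \<Lambda>1 > 0 and L_B, \<zeta> \<ge> 0
   the only quotients that can degenerate are those written with exp_quot in lip2. *)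
definition lip1 :: "real \<Rightarrow> real \<Rightarrow> real \<Rightarrow> real \<Rightarrow> real \<Rightarrow> real \<Rightarrow> real" where
  "lip1 \<Lambda>1 \<Lambda>2 LB \<beta> \<Delta> \<zeta> =
     LB * \<beta>^2 * exp (\<Lambda>1 * \<Delta>) / \<Lambda>1 *
       ( (exp ((2 * \<Lambda>1 + LB * \<zeta>) * \<Delta>) - exp (\<Lambda>1 * \<Delta>)) / (\<Lambda>1 + LB * \<zeta>)
       + (exp ((2 * \<Lambda>1 + LB * \<zeta>) * \<Delta>) - exp (- \<Lambda>1 * \<Delta>)) / (LB * \<zeta> + 3 * \<Lambda>1))
   + 2 * \<beta>^3 * \<Lambda>2 * exp (\<Lambda>1 * \<Delta>) / (\<Lambda>1 * (\<Lambda>1 + LB * \<zeta>)) *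
       ( (exp ((3 * \<Lambda>1 + LB * \<zeta>) * \<Delta>) - exp (- \<Lambda>1 * \<Delta>)) / (4 * \<Lambda>1 + LB * \<zeta>)
       - (exp ((2 * \<Lambda>1 + LB * \<zeta>) * \<Delta>) - exp (- \<Lambda>1 * \<Delta>)) / (3 * \<Lambda>1 + LB * \<zeta>)
       + (exp (\<Lambda>1 * \<Delta>) - exp (- \<Lambda>1 * \<Delta>)) / (2 * \<Lambda>1)
       - (exp (2 * \<Lambda>1 * \<Delta>) - exp (- \<Lambda>1 * \<Delta>)) / (3 * \<Lambda>1))"

definition lip2 :: "real \<Rightarrow> real \<Rightarrow> real \<Rightarrow> real \<Rightarrow> real \<Rightarrow> real \<Rightarrow> real" where
  "lip2 \<Lambda>1 \<Lambda>2 LB \<beta> \<Delta> \<zeta> =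
     LB * \<beta>^2 * exp (\<Lambda>1 * \<Delta>) / \<Lambda>1 *
       ( exp_quot \<Delta> \<Lambda>1 (LB * \<zeta>)
       - (exp (LB * \<zeta> * \<Delta>) - exp (- \<Lambda>1 * \<Delta>)) / (LB * \<zeta> + \<Lambda>1))
   + 2 * \<beta>^3 * \<Lambda>2 * exp (\<Lambda>1 * \<Delta>) / (\<Lambda>1 * (\<Lambda>1 + LB * \<zeta>)) *
       ( exp_quot \<Delta> (2 * \<Lambda>1) (LB * \<zeta>)
       + exp_quot \<Delta> \<Lambda>1 (LB * \<zeta>)
       + (exp (\<Lambda>1 * \<Delta>) - exp (- \<Lambda>1 * \<Delta>)) / (2 * \<Lambda>1)
       - (exp (2 * \<Lambda>1 * \<Delta>) - exp (- \<Lambda>1 * \<Delta>)) / (3 * \<Lambda>1))"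

definition lip_const :: "nat \<Rightarrow> real \<Rightarrow> real \<Rightarrow> real \<Rightarrow> real \<Rightarrow> real \<Rightarrow> real \<Rightarrow> real" where
  "lip_const i = (if i = 1 then lip1 else lip2)"

end

theory Submission
  imports Defs
begin

text \<open>
  The set of feasible controls contains \<open>ub\<close>, because \<open>inverse C\<close> is the smallest eigenvalue of the
  Gramian of \<open>ub\<close> divided by \<open>1 + \<theta>\<close>. For invariance, let \<open>u\<close> be feasible and \<open>v\<close> the control
  synthesised from \<open>u\<close>. Feasibility of \<open>u\<close> bounds the inverse of its Gramian by \<open>C\<close>, and the flow derivative
  is bounded by \<open>exp (\<Lambda>1 (T - t0))\<close>, so \<open>v\<close> is essentially bounded by \<open>\<zeta>\<close>. The Gramian is
  Lipschitz in the control with constant \<open>L\<close>, and smallest eigenvalues of symmetric matrices move by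
  no more than the quadratic form does; hence passing from \<open>ub\<close> to \<open>v\<close> costs at most
  \<open>L (\<zeta> + control_norm ub)\<close> of smallest eigenvalue, and the smallness condition on \<open>y\<close> says exactly
  that this is affordable.

  The substance is the Lipschitz estimate with this explicit \<open>L\<close> (\<open>gramian_perturbation\<close> together with
  \<open>lip_integral1_le_lip1\<close> and \<open>lip_integral2_le_lip2\<close>). It rests on three Gronwall arguments: for
  the difference of two flow lines, for the second difference of the flow in its initial value, and
  for the difference of two controlled trajectories. In the last one only one of the two controls has
  to be bounded by \<open>\<zeta>\<close>, which is why \<open>ub\<close> may be any control.

  Solutions are absolutely continuous and satisfy their equation almost everywhere. Instead of passing to
  integral equations, \<open>abs_continuous_mean_value\<close> gives a mean value inequality for such functions
  directly from a tagged division. The spatial derivative of the flow is obtained without the variational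
  equation: a Lipschitz map whose second differences are \<open>O(|h| |k|)\<close> is differentiable with Lipschitz
  derivative (\<open>differentiable_of_second_difference_bound\<close>), and the second difference
  of the flow is controlled by Gronwall's inequality. The same difference quotients show that the flow derivative
  along a trajectory is measurable in time.
\<close>

section \<open>Absolutely continuous functions\<close>

lemma straddle_vector_derivative:
  fixes f :: "real \<Rightarrow> 'a::real_normed_vector"
  assumes f: "(f has_vector_derivative D) (at t)" and e: "e > 0"
  obtains d where "d > 0"
    "\<And>u v. t - d < u \<Longrightarrow> u \<le> t \<Longrightarrow> t \<le> v \<Longrightarrow> v < t + d \<Longrightarrow>
       norm (f v - f u) \<le> (norm D + e) * (v - u)"
proof -
  from f have "(f has_derivative (\<lambda>h. h *\<^sub>R D)) (at t)"
    by (simp add: has_vector_derivative_def)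
  then obtain d where d: "d > 0"
      "\<And>s. norm (s - t) < d \<Longrightarrow> norm (f s - f t - (s - t) *\<^sub>R D) \<le> e * norm (s - t)"
    using e unfolding has_derivative_at_alt by blast
  show ?thesis
  proof (rule that[OF d(1)])
    fix u v assume uv: "t - d < u" "u \<le> t" "t \<le> v" "v < t + d"
    have 1: "norm (f v - f t - (v - t) *\<^sub>R D) \<le> e * (v - t)"
      and 2: "norm (f u - f t - (u - t) *\<^sub>R D) \<le> e * (t - u)"
      using d(2)[of v] d(2)[of u] uv by auto
    have "f v - f u = (f v - f t - (v - t) *\<^sub>R D) - (f u - f t - (u - t) *\<^sub>R D) + (v - u) *\<^sub>R D"
      by (simp add: algebra_simps)
    also have "norm \<dots> \<le> norm ((f v - f t - (v - t) *\<^sub>R D) - (f u - f t - (u - t) *\<^sub>R D)) + norm ((v - u) *\<^sub>R D)"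
      by (rule norm_triangle_ineq)
    also have "\<dots> \<le> e * (v - t) + e * (t - u) + norm ((v - u) *\<^sub>R D)"
      by (intro add_mono order_trans[OF norm_triangle_ineq4] 1 2 order_refl)
    also have "\<dots> = (norm D + e) * (v - u)"
      using uv by (simp only: norm_scaleR) (simp add: algebra_simps)
    finally show "norm (f v - f u) \<le> (norm D + e) * (v - u)" .
  qed
qed

lemma straddle_real_derivative:
  fixes G :: "real \<Rightarrow> real"
  assumes G: "(G has_real_derivative D) (at t)" and e: "e > 0"
  obtains d where "d > 0"
    "\<And>u v. t - d < u \<Longrightarrow> u \<le> t \<Longrightarrow> t \<le> v \<Longrightarrow> v < t + d \<Longrightarrow> (D - e) * (v - u) \<le> G v - G u"
proof -
  have "((\<lambda>s. D * s - G s) has_vector_derivative 0) (at t)"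
    using G unfolding has_real_derivative_iff_has_vector_derivative[symmetric]
    by (auto intro!: derivative_eq_intros)
  from straddle_vector_derivative[OF this e] obtain d where d: "d > 0"
    "\<And>u v. t - d < u \<Longrightarrow> u \<le> t \<Longrightarrow> t \<le> v \<Longrightarrow> v < t + d \<Longrightarrow>
       norm ((D * v - G v) - (D * u - G u)) \<le> (norm (0::real) + e) * (v - u)"
    by blast
  show ?thesis
  proof (rule that[OF d(1)])
    fix u v assume "t - d < u" "u \<le> t" "t \<le> v" "v < t + d"
    from d(2)[OF this] show "(D - e) * (v - u) \<le> G v - G u"
      by (simp add: algebra_simps abs_le_iff)
  qed
qed

text \<open>
  A null set carries almost no length in a fine tagged division, because its indicator function has gauge
  integral zero; absolute continuity turns small length into small increments.
\<close>

lemma abs_continuous_tagged_sum_small: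
  fixes f :: "real \<Rightarrow> 'a::real_normed_vector"
  assumes ac: "abs_continuous_on a b f" and Z: "negligible Z" and e: "e > 0"
  obtains \<gamma> where "gauge \<gamma>"
    "\<And>p. p tagged_division_of {a..b} \<Longrightarrow> \<gamma> fine p \<Longrightarrow>
       (\<Sum>(x, K)\<in>{(x, K)\<in>p. x \<in> Z}. norm (f (Sup K) - f (Inf K))) < e"
proof -
  from ac e have "\<exists>\<delta>>0. \<forall>P. finite P
        \<and> (\<forall>(c, d)\<in>P. a \<le> c \<and> c \<le> d \<and> d \<le> b)
        \<and> (\<forall>p\<in>P. \<forall>q\<in>P. p \<noteq> q \<longrightarrow> {fst p<..<snd p} \<inter> {fst q<..<snd q} = {})
        \<and> (\<Sum>(c, d)\<in>P. d - c) < \<delta> \<longrightarrow> (\<Sum>(c, d)\<in>P. norm (f d - f c)) < e"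
    unfolding abs_continuous_on_def by (drule_tac spec[of _ e]) simp
  then obtain \<delta> where \<delta>: "\<delta> > 0" and small: "\<forall>P. finite P
        \<and> (\<forall>(c, d)\<in>P. a \<le> c \<and> c \<le> d \<and> d \<le> b)
        \<and> (\<forall>p\<in>P. \<forall>q\<in>P. p \<noteq> q \<longrightarrow> {fst p<..<snd p} \<inter> {fst q<..<snd q} = {})
        \<and> (\<Sum>(c, d)\<in>P. d - c) < \<delta> \<longrightarrow> (\<Sum>(c, d)\<in>P. norm (f d - f c)) < e"
    by (elim exE conjE) (rule that)
  have "(indicat_real Z has_integral 0) {a..b}"
    using Z unfolding negligible by (rule spec)
  from this[unfolded has_integral_real, THEN spec, THEN mp, OF \<delta>] obtain \<gamma> where \<gamma>: "gauge \<gamma>"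
    and fine: "\<forall>p. p tagged_division_of {a..b} \<and> \<gamma> fine p \<longrightarrow>
       norm ((\<Sum>(x, K)\<in>p. measure lborel K *\<^sub>R indicat_real Z x) - 0) < \<delta>"
    by (elim exE conjE) (rule that)
  show ?thesis
  proof (rule that[OF \<gamma>])
    fix p assume p: "p tagged_division_of {a..b}" "\<gamma> fine p"
    note td = tagged_division_ofD[OF p(1)[folded box_real]]
    define p1 where "p1 = {(x, K)\<in>p. x \<in> Z}"
    define p2 where "p2 = {(x, K)\<in>p1. Inf K < Sup K}"
    have fin: "finite p" "finite p1" "finite p2"
      using td(1) by (auto simp: p1_def p2_def intro: finite_subset[of _ p])
    have K: "\<exists>c d. K = {c..d} \<and> c \<le> d \<and> a \<le> c \<and> d \<le> b \<and> Inf K = c \<and> Sup K = d" if xK: "(x, K) \<in> p" for x K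
    proof -
      obtain c d where cd: "K = {c..d}" using td(4)[OF xK] by (auto simp: box_real)
      have "x \<in> K" "K \<subseteq> {a..b}" using td(2,3)[OF xK] by (auto simp: box_real)
      then show ?thesis using cd by (intro exI[of _ c] exI[of _ d]) auto
    qed
    let ?g = "\<lambda>(x::real, K). (Inf K, Sup K :: real)"
    have disj: "{Inf K<..<Sup K} \<inter> {Inf K'<..<Sup K'} = {}"
      if "(x, K) \<in> p" "(x', K') \<in> p" "(x, K) \<noteq> (x', K')" for x K x' K'
      using td(5)[OF that] K[OF that(1)] K[OF that(2)] by (metis interior_atLeastAtMost_real)
    have inj: "inj_on ?g p2"
    proof (rule inj_onI, clarify)
      fix x K x' K' assume A: "(x, K) \<in> p2" "(x', K') \<in> p2" "Inf K = Inf K'" "Sup K = Sup K'"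
      then have p': "(x, K) \<in> p" "(x', K') \<in> p" and lt: "Inf K < Sup K" by (auto simp: p2_def p1_def)
      from lt have "{Inf K<..<Sup K} \<noteq> {}" by simp
      then show "x = x' \<and> K = K'" using disj[OF p'] A(3,4) by auto
    qed
    have "(\<Sum>(x, K)\<in>p1. norm (f (Sup K) - f (Inf K))) = (\<Sum>(x, K)\<in>p2. norm (f (Sup K) - f (Inf K)))"
    proof (rule sum.mono_neutral_right[OF fin(2)])
      show "p2 \<subseteq> p1" by (auto simp: p2_def)
      show "\<forall>i\<in>p1 - p2. (case i of (x, K) \<Rightarrow> norm (f (Sup K) - f (Inf K))) = 0"
      proof clarify
        fix x K assume "(x, K) \<in> p1" "(x, K) \<notin> p2"
        then have "(x, K) \<in> p" "\<not> Inf K < Sup K" by (auto simp: p1_def p2_def)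
        with K[OF this(1)] have "Inf K = Sup K" by auto
        then show "norm (f (Sup K) - f (Inf K)) = 0" by simp
      qed
    qed
    also have "\<dots> = (\<Sum>(c, d)\<in>?g ` p2. norm (f d - f c))"
      by (subst sum.reindex[OF inj]) (auto intro!: sum.cong)
    also have "\<dots> < e"
    proof (rule small[THEN spec, THEN mp], intro conjI)
      show "finite (?g ` p2)" using fin by simp
      show "\<forall>(c, d)\<in>?g ` p2. a \<le> c \<and> c \<le> d \<and> d \<le> b"
      proof clarify
        fix x K assume "(x, K) \<in> p2"
        then have "(x, K) \<in> p" by (auto simp: p2_def p1_def)
        from K[OF this] show "a \<le> Inf K \<and> Inf K \<le> Sup K \<and> Sup K \<le> b" by auto
      qed
      show "\<forall>r\<in>?g ` p2. \<forall>q\<in>?g ` p2. r \<noteq> q \<longrightarrow> {fst r<..<snd r} \<inter> {fst q<..<snd q} = {}"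
      proof (intro ballI impI)
        fix r q assume "r \<in> ?g ` p2" "q \<in> ?g ` p2" "r \<noteq> q"
        then obtain x K x' K' where "(x, K) \<in> p" "(x', K') \<in> p" "r = (Inf K, Sup K)" "q = (Inf K', Sup K')" "(x, K) \<noteq> (x', K')"
          by (auto simp: p2_def p1_def)
        then show "{fst r<..<snd r} \<inter> {fst q<..<snd q} = {}" using disj by simp
      qed
      have "(\<Sum>(c, d)\<in>?g ` p2. d - c) = (\<Sum>(x, K)\<in>p2. measure lborel K *\<^sub>R indicat_real Z x)"
      proof (subst sum.reindex[OF inj], rule sum.cong[OF refl], clarify)
        fix x K assume xK: "(x, K) \<in> p2"
        then have "(x, K) \<in> p" "x \<in> Z" by (auto simp: p2_def p1_def)
        moreover obtain c d where "K = {c..d}" "c \<le> d" "Inf K = c" "Sup K = d"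
          using K[OF \<open>(x, K) \<in> p\<close>] by blast
        ultimately show "((\<lambda>(c, d). d - c) \<circ> ?g) (x, K) = measure lborel K *\<^sub>R indicat_real Z x"
          by simp
      qed
      also have "\<dots> \<le> (\<Sum>(x, K)\<in>p. measure lborel K *\<^sub>R indicat_real Z x)"
        by (rule sum_mono2[OF fin(1)]) (auto simp: p2_def p1_def)
      also have "\<dots> < \<delta>" using fine[THEN spec, THEN mp, OF conjI, OF p] by (simp add: abs_less_iff)
      finally show "(\<Sum>(c, d)\<in>?g ` p2. d - c) < \<delta>" .
    qed
    finally show "(\<Sum>(x, K)\<in>{(x, K)\<in>p. x \<in> Z}. norm (f (Sup K) - f (Inf K))) < e"
      by (simp add: p1_def)
  qed
qed

text \<open>
  Take a fine tagged division of the interval. At a tag where \<open>f\<close> is differentiable, the increment of \<open>f\<close>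
  over the piece is at most that of \<open>G\<close> up to a small multiple of the length; the pieces tagged in the exceptional
  null set contribute little by \<open>abs_continuous_tagged_sum_small\<close>.
\<close>

lemma abs_continuous_mean_value:
  fixes f :: "real \<Rightarrow> 'a::real_normed_vector" and G G' :: "real \<Rightarrow> real"
  assumes ab: "a \<le> b" and ac: "abs_continuous_on a b f" and E: "negligible E"
    and G: "\<And>t. t \<in> {a..b} \<Longrightarrow> (G has_real_derivative G' t) (at t within {a..b})"
    and G': "\<And>t. t \<in> {a..b} \<Longrightarrow> 0 \<le> G' t"
    and f: "\<And>t. t \<in> {a<..<b} - E \<Longrightarrow> \<exists>D. (f has_vector_derivative D) (at t) \<and> norm D \<le> G' t"
  shows "norm (f b - f a) \<le> G b - G a"
proof -
  have mono: "G u \<le> G v" if uv: "a \<le> u" "u \<le> v" "v \<le> b" for u v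
  proof (rule DERIV_nonneg_imp_increasing_open[OF uv(2)])
    fix x assume "u < x" "x < v"
    then have x: "x \<in> {a..b}" and "at x within {a..b} = at x"
      using uv at_within_Icc_at[of a x b] by auto
    then show "\<exists>y. (G has_real_derivative y) (at x) \<and> 0 \<le> y"
      using G[OF x] G'[OF x] by auto
  next
    have "continuous_on {a..b} G" using G by (rule DERIV_continuous_on)
    then show "continuous_on {u..v} G" by (rule continuous_on_subset) (use uv in auto)
  qed
  have main: "norm (f b - f a) \<le> G b - G a + e * (1 + (b - a))" if e: "e > 0" for e
  proof -
    \<comment> \<open>The end points are treated as exceptional, since the derivative is two-sided.\<close>
    define Z where "Z = E \<union> {a, b}"
    have Z: "negligible Z" using E by (simp add: Z_def)
    obtain \<gamma>1 where \<gamma>1: "gauge \<gamma>1"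
      and bad: "\<And>p. p tagged_division_of {a..b} \<Longrightarrow> \<gamma>1 fine p \<Longrightarrow>
         (\<Sum>(x, K)\<in>{(x, K)\<in>p. x \<in> Z}. norm (f (Sup K) - f (Inf K))) < e"
      by (rule abs_continuous_tagged_sum_small[OF ac Z e], rule that)
    \<comment> \<open>\<open>good t d\<close>: pieces around \<open>t\<close> of radius below \<open>d\<close> satisfy the straddle estimate.\<close>
    define good where "good t d \<longleftrightarrow> (\<forall>u v. t - d < u \<longrightarrow> u \<le> t \<longrightarrow> t \<le> v \<longrightarrow> v < t + d \<longrightarrow>
            norm (f v - f u) \<le> G v - G u + e * (v - u))" for t d
    have good_ex: "\<exists>d>0. good t d" if t': "t \<in> {a..b} - Z" for t
    proof -
      have t: "t \<in> {a<..<b} - E" using t' by (auto simp: Z_def)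
      obtain D where D: "(f has_vector_derivative D) (at t)" "norm D \<le> G' t" using f[OF t] by blast
      have "(G has_real_derivative G' t) (at t)" using G[of t] t at_within_Icc_at[of a t b] by auto
      obtain d1 where d1: "d1 > 0"
        "\<And>u v. t - d1 < u \<Longrightarrow> u \<le> t \<Longrightarrow> t \<le> v \<Longrightarrow> v < t + d1 \<Longrightarrow> (G' t - e/2) * (v - u) \<le> G v - G u"
        by (rule straddle_real_derivative[OF \<open>(G has_real_derivative G' t) (at t)\<close> half_gt_zero[OF e]]) blast
      obtain d2 where d2: "d2 > 0"
        "\<And>u v. t - d2 < u \<Longrightarrow> u \<le> t \<Longrightarrow> t \<le> v \<Longrightarrow> v < t + d2 \<Longrightarrow> norm (f v - f u) \<le> (norm D + e/2) * (v - u)"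
        by (rule straddle_vector_derivative[OF D(1) half_gt_zero[OF e]]) blast
      have "good t (min d1 d2)"
        unfolding good_def
      proof (intro allI impI)
        fix u v assume uv: "t - min d1 d2 < u" "u \<le> t" "t \<le> v" "v < t + min d1 d2"
        have "norm (f v - f u) \<le> (norm D + e/2) * (v - u)" by (rule d2) (use uv in auto)
        also have "\<dots> \<le> (G' t + e/2) * (v - u)" using D uv by (intro mult_right_mono) auto
        also have "\<dots> = (G' t - e/2) * (v - u) + e * (v - u)" by (simp add: algebra_simps)
        also have "\<dots> \<le> G v - G u + e * (v - u)" using d1(2)[of u v] uv by simp
        finally show "norm (f v - f u) \<le> G v - G u + e * (v - u)" .
      qed
      then show ?thesis using d1(1) d2(1) by (intro exI[of _ "min d1 d2"]) simp
    qed
    then have "\<forall>t. \<exists>d>0. t \<in> {a..b} - Z \<longrightarrow> good t d" by (metis zero_less_one)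
    then obtain d where dpos: "\<And>t. d t > 0" and d: "\<And>t. t \<in> {a..b} - Z \<Longrightarrow> good t (d t)"
      by metis
    have "gauge (\<lambda>t. \<gamma>1 t \<inter> ball t (d t))"
      using \<gamma>1 dpos by (intro gauge_Int gauge_ball_dependent) auto
    then obtain p where p: "p tagged_division_of {a..b}" "(\<lambda>t. \<gamma>1 t \<inter> ball t (d t)) fine p"
      using fine_division_exists_real by blast
    have fine1: "\<gamma>1 fine p" and fine2: "(\<lambda>t. ball t (d t)) fine p"
      using p(2) by (simp_all add: fine_Int)
    note td = tagged_division_ofD[OF p(1)[folded box_real]]
    note add1 = additive_tagged_division_1[OF ab p(1)]
    define bd where "bd = (\<lambda>(x, K). if x \<in> Z then norm (f (Sup K) - f (Inf K)) else 0)"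
    have "norm (f b - f a) = norm (\<Sum>(x, K)\<in>p. f (Sup K) - f (Inf K))"
      using add1[of f] by simp
    also have "\<dots> \<le> (\<Sum>z\<in>p. (case z of (x, K) \<Rightarrow> G (Sup K) - G (Inf K)) + e * (case z of (x, K) \<Rightarrow> Sup K - Inf K) + bd z)"
    proof (rule sum_norm_le, clarify)
      fix x K assume xK: "(x, K) \<in> p"
      obtain u v where uv: "K = {u..v}" using td(4)[OF xK] by (auto simp: box_real)
      have x: "x \<in> K" "K \<subseteq> {a..b}" using td(2,3)[OF xK] by (auto simp: box_real)
      with uv have uxv: "u \<le> x" "x \<le> v" "a \<le> u" "v \<le> b" "Inf K = u" "Sup K = v" by auto
      show "norm (f (Sup K) - f (Inf K)) \<le> (G (Sup K) - G (Inf K)) + e * (Sup K - Inf K) + bd (x, K)"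
      proof (cases "x \<in> Z")
        case True
        have "0 \<le> e * (v - u)" using e uxv by simp
        then show ?thesis using True mono[of u v] uxv by (simp add: bd_def)
      next
        case False
        have "K \<subseteq> ball x (d x)" using fine2 xK by (auto simp: fine_def)
        moreover have "u \<in> K" "v \<in> K" using uv uxv by auto
        ultimately have "u \<in> ball x (d x)" "v \<in> ball x (d x)" by blast+
        then have "x - d x < u" "v < x + d x"
          using uxv by (auto simp: dist_real_def)
        moreover have "good x (d x)" using d[of x] False x by auto
        ultimately show ?thesis using uxv False by (simp add: good_def bd_def)
      qed
    qed
    also have "\<dots> = (G b - G a) + e * (b - a) + sum bd p"
      using add1[of G] add1[of "\<lambda>x. x"]
      by (simp add: sum.distrib sum_distrib_left[symmetric])
    also have "sum bd p = (\<Sum>(x, K)\<in>{(x, K)\<in>p. x \<in> Z}. norm (f (Sup K) - f (Inf K)))"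
      using td(1) by (intro sum.mono_neutral_cong_right) (auto simp: bd_def split: if_splits)
    also have "\<dots> \<le> e" using bad[OF p(1) fine1] by simp
    finally show ?thesis by (simp add: algebra_simps)
  qed
  show ?thesis
  proof (rule field_le_epsilon)
    fix e :: real assume "e > 0"
    then show "norm (f b - f a) \<le> G b - G a + e"
      using main[of "e / (1 + (b - a))"] ab by (simp add: divide_simps)
  qed
qed

lemma AE_lebesgue_on_negligibleE:
  assumes "AE t in lebesgue_on S. P t" "S \<in> sets lebesgue"
  obtains E where "negligible E" "\<And>t. t \<in> S - E \<Longrightarrow> P t"
proof -
  have "AE t in lebesgue. t \<in> S \<longrightarrow> P t"
    using assms by (simp add: AE_restrict_space_iff)
  then obtain E where "E \<in> null_sets lebesgue" "{t \<in> space lebesgue. \<not> (t \<in> S \<longrightarrow> P t)} \<subseteq> E"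
    unfolding eventually_ae_filter by blast
  then show ?thesis
    by (intro that[of E]) (auto simp: negligible_iff_null_sets)
qed

lemma abs_continuous_on_subinterval:
  assumes "abs_continuous_on a b f" "a \<le> c" "d \<le> b"
  shows "abs_continuous_on c d f"
  unfolding abs_continuous_on_def
proof (intro allI impI)
  fix e :: real assume "e > 0"
  with assms(1) obtain \<delta> where \<delta>: "\<delta> > 0" and small: "\<forall>P. finite P
        \<and> (\<forall>(u, v)\<in>P. a \<le> u \<and> u \<le> v \<and> v \<le> b)
        \<and> (\<forall>p\<in>P. \<forall>q\<in>P. p \<noteq> q \<longrightarrow> {fst p<..<snd p} \<inter> {fst q<..<snd q} = {})
        \<and> (\<Sum>(u, v)\<in>P. v - u) < \<delta> \<longrightarrow> (\<Sum>(u, v)\<in>P. norm (f v - f u)) < e"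
    unfolding abs_continuous_on_def by (drule_tac spec[of _ e]) (auto simp only: elim: mp)
  show "\<exists>\<delta>>0. \<forall>P. finite P
        \<and> (\<forall>(u, v)\<in>P. c \<le> u \<and> u \<le> v \<and> v \<le> d)
        \<and> (\<forall>p\<in>P. \<forall>q\<in>P. p \<noteq> q \<longrightarrow> {fst p<..<snd p} \<inter> {fst q<..<snd q} = {})
        \<and> (\<Sum>(u, v)\<in>P. v - u) < \<delta> \<longrightarrow> (\<Sum>(u, v)\<in>P. norm (f v - f u)) < e"
  proof (intro exI[of _ \<delta>] conjI[OF \<delta>] allI impI, elim conjE)
    fix P :: "(real \<times> real) set"
    assume P: "finite P" "\<forall>(u, v)\<in>P. c \<le> u \<and> u \<le> v \<and> v \<le> d"
      "\<forall>p\<in>P. \<forall>q\<in>P. p \<noteq> q \<longrightarrow> {fst p<..<snd p} \<inter> {fst q<..<snd q} = {}"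
      "(\<Sum>(u, v)\<in>P. v - u) < \<delta>"
    have "\<forall>(u, v)\<in>P. a \<le> u \<and> u \<le> v \<and> v \<le> b"
      using P(2) assms(2,3) by fastforce
    with P show "(\<Sum>(u, v)\<in>P. norm (f v - f u)) < e"
      by (intro small[THEN spec, THEN mp] conjI)
  qed
qed

lemma abs_continuous_on_diff:
  assumes "abs_continuous_on a b f" "abs_continuous_on a b g"
  shows "abs_continuous_on a b (\<lambda>t. f t - g t)"
  unfolding abs_continuous_on_def
proof (intro allI impI)
  fix e :: real assume e: "e > 0"
  let ?A = "\<lambda>P. finite P \<and> (\<forall>(u, v)\<in>P. a \<le> u \<and> u \<le> v \<and> v \<le> b)
        \<and> (\<forall>p\<in>P. \<forall>q\<in>P. p \<noteq> q \<longrightarrow> {fst p<..<snd p} \<inter> {fst q<..<snd q} = {})"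
  have *: "\<exists>\<delta>>0. \<forall>P. ?A P \<and> (\<Sum>(u, v)\<in>P. v - u) < \<delta> \<longrightarrow> (\<Sum>(u, v)\<in>P. norm (h v - h u)) < e/2"
    if "abs_continuous_on a b h" for h :: "real \<Rightarrow> 'a"
    using that e unfolding abs_continuous_on_def by (drule_tac spec[of _ "e/2"]) simp
  from *[OF assms(1)] obtain \<delta>1 where \<delta>1: "\<delta>1 > 0"
    "\<forall>P. ?A P \<and> (\<Sum>(u, v)\<in>P. v - u) < \<delta>1 \<longrightarrow> (\<Sum>(u, v)\<in>P. norm (f v - f u)) < e/2"
    by (elim exE conjE) (rule that)
  from *[OF assms(2)] obtain \<delta>2 where \<delta>2: "\<delta>2 > 0"
    "\<forall>P. ?A P \<and> (\<Sum>(u, v)\<in>P. v - u) < \<delta>2 \<longrightarrow> (\<Sum>(u, v)\<in>P. norm (g v - g u)) < e/2"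
    by (elim exE conjE) (rule that)
  have d0: "0 < min \<delta>1 \<delta>2" using \<delta>1(1) \<delta>2(1) by simp
  show "\<exists>\<delta>>0. \<forall>P. finite P \<and> (\<forall>(u, v)\<in>P. a \<le> u \<and> u \<le> v \<and> v \<le> b)
        \<and> (\<forall>p\<in>P. \<forall>q\<in>P. p \<noteq> q \<longrightarrow> {fst p<..<snd p} \<inter> {fst q<..<snd q} = {})
        \<and> (\<Sum>(u, v)\<in>P. v - u) < \<delta> \<longrightarrow> (\<Sum>(u, v)\<in>P. norm ((f v - g v) - (f u - g u))) < e"
  proof (intro exI[of _ "min \<delta>1 \<delta>2"] conjI[OF d0] allI impI, elim conjE)
    fix P :: "(real \<times> real) set"
    assume P: "finite P" "\<forall>(u, v)\<in>P. a \<le> u \<and> u \<le> v \<and> v \<le> b"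
      "\<forall>p\<in>P. \<forall>q\<in>P. p \<noteq> q \<longrightarrow> {fst p<..<snd p} \<inter> {fst q<..<snd q} = {}"
      "(\<Sum>(u, v)\<in>P. v - u) < min \<delta>1 \<delta>2"
    have "(\<Sum>(u, v)\<in>P. norm ((f v - g v) - (f u - g u)))
        \<le> (\<Sum>z\<in>P. (case z of (u, v) \<Rightarrow> norm (f v - f u)) + (case z of (u, v) \<Rightarrow> norm (g v - g u)))"
    proof (rule sum_mono, clarify)
      fix u v
      have "(f v - g v) - (f u - g u) = (f v - f u) - (g v - g u)" by simp
      then show "norm ((f v - g v) - (f u - g u)) \<le> norm (f v - f u) + norm (g v - g u)"
        by (simp only: norm_triangle_ineq4)
    qed
    also have "\<dots> = (\<Sum>(u, v)\<in>P. norm (f v - f u)) + (\<Sum>(u, v)\<in>P. norm (g v - g u))"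
      by (rule sum.distrib)
    also have "\<dots> < e/2 + e/2"
    proof (rule add_strict_mono)
      show "(\<Sum>(u, v)\<in>P. norm (f v - f u)) < e/2"
        by (rule \<delta>1(2)[THEN spec, THEN mp]) (use P in simp)
      show "(\<Sum>(u, v)\<in>P. norm (g v - g u)) < e/2"
        by (rule \<delta>2(2)[THEN spec, THEN mp]) (use P in simp)
    qed
    finally show "(\<Sum>(u, v)\<in>P. norm ((f v - g v) - (f u - g u))) < e" by simp
  qed
qed

lemma abs_continuous_on_imp_continuous_on:
  fixes f :: "real \<Rightarrow> 'a::real_normed_vector"
  assumes "abs_continuous_on a b f"
  shows "continuous_on {a..b} f"
  unfolding continuous_on_iff
proof (intro ballI allI impI)
  fix x e :: real assume x: "x \<in> {a..b}" and e: "e > 0"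
  have "\<exists>\<delta>>0. \<forall>P. finite P
        \<and> (\<forall>(u, v)\<in>P. a \<le> u \<and> u \<le> v \<and> v \<le> b)
        \<and> (\<forall>p\<in>P. \<forall>q\<in>P. p \<noteq> q \<longrightarrow> {fst p<..<snd p} \<inter> {fst q<..<snd q} = {})
        \<and> (\<Sum>(u, v)\<in>P. v - u) < \<delta> \<longrightarrow> (\<Sum>(u, v)\<in>P. norm (f v - f u)) < e"
    using assms e unfolding abs_continuous_on_def by (drule_tac spec[of _ e]) simp
  then obtain \<delta> where \<delta>: "\<delta> > 0" and small: "\<forall>P. finite P
        \<and> (\<forall>(u, v)\<in>P. a \<le> u \<and> u \<le> v \<and> v \<le> b)
        \<and> (\<forall>p\<in>P. \<forall>q\<in>P. p \<noteq> q \<longrightarrow> {fst p<..<snd p} \<inter> {fst q<..<snd q} = {})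
        \<and> (\<Sum>(u, v)\<in>P. v - u) < \<delta> \<longrightarrow> (\<Sum>(u, v)\<in>P. norm (f v - f u)) < e"
    by (elim exE conjE) (rule that)
  have *: "norm (f v - f u) < e" if "a \<le> u" "u \<le> v" "v \<le> b" "v - u < \<delta>" for u v
    using small[THEN spec, of "{(u, v)}"] that by simp
  show "\<exists>d>0. \<forall>x'\<in>{a..b}. dist x' x < d \<longrightarrow> dist (f x') (f x) < e"
  proof (intro exI[of _ \<delta>] conjI[OF \<delta>] ballI impI)
    fix x' assume "x' \<in> {a..b}" "dist x' x < \<delta>"
    then show "dist (f x') (f x) < e"
      using *[of x x'] *[of x' x] x
      by (cases "x \<le> x'") (auto simp: dist_norm norm_minus_commute)
  qed
qed

section \<open>Gronwall inequalities for almost-everywhere derivatives\<close>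

text \<open>
  This replaces the almost-everywhere differential inequality by one for a
  continuously differentiable majorant \<open>I\<close>, to which classical calculus applies.
\<close>

lemma abs_continuous_increment_bound:
  fixes f :: "real \<Rightarrow> 'a::real_normed_vector"
  assumes ac: "abs_continuous_on a b f" and E: "negligible E" and M: "M \<ge> 0"
    and \<beta>: "continuous_on {a..b} \<beta>" "\<And>t. t \<in> {a..b} \<Longrightarrow> 0 \<le> \<beta> t"
    and f: "\<And>t. t \<in> {a<..<b} - E \<Longrightarrow>
              \<exists>D. (f has_vector_derivative D) (at t) \<and> norm D \<le> M * norm (f t) + \<beta> t"
  obtains I where
    "\<And>t. t \<in> {a..b} \<Longrightarrow> (I has_real_derivative M * norm (f t) + \<beta> t) (at t within {a..b})"
    "\<And>u v. a \<le> u \<Longrightarrow> u \<le> v \<Longrightarrow> v \<le> b \<Longrightarrow> norm (f v - f u) \<le> I v - I u"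
proof -
  have "continuous_on {a..b} (\<lambda>t. M * norm (f t) + \<beta> t)"
    by (intro continuous_intros abs_continuous_on_imp_continuous_on[OF ac] \<beta>)
  from antiderivative_continuous[OF this] obtain I where
    "\<And>t. t \<in> {a..b} \<Longrightarrow> (I has_vector_derivative M * norm (f t) + \<beta> t) (at t within {a..b})"
    by blast
  then have I: "\<And>t. t \<in> {a..b} \<Longrightarrow> (I has_real_derivative M * norm (f t) + \<beta> t) (at t within {a..b})"
    by (simp add: has_real_derivative_iff_has_vector_derivative)
  show ?thesis
  proof (rule that[OF I], assumption)
    fix u v assume uv: "a \<le> u" "u \<le> v" "v \<le> b"
    show "norm (f v - f u) \<le> I v - I u"
    proof (rule abs_continuous_mean_value[OF uv(2) abs_continuous_on_subinterval[OF ac uv(1,3)] E])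
      fix t assume "t \<in> {u..v}"
      then have t: "t \<in> {a..b}" using uv by auto
      show "(I has_real_derivative M * norm (f t) + \<beta> t) (at t within {u..v})"
        using I[OF t] by (rule DERIV_subset) (use uv in auto)
      show "0 \<le> M * norm (f t) + \<beta> t"
        using M \<beta>(2)[OF t] by simp
    next
      fix t assume "t \<in> {u<..<v} - E"
      then show "\<exists>D. (f has_vector_derivative D) (at t) \<and> norm D \<le> M * norm (f t) + \<beta> t"
        using uv by (intro f) auto
    qed
  qed
qed

text \<open>
  The function \<open>exp (- M t) * (norm (f a) + I t - I a - g t)\<close> is nonincreasing and starts at a value
  \<open>\<le> 0\<close>, so \<open>g\<close> dominates the majorant of \<open>f\<close> up to the right end point.
\<close>

lemma gronwall_forward:
  fixes f :: "real \<Rightarrow> 'a::real_normed_vector"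
  assumes ab: "a \<le> b" and ac: "abs_continuous_on a b f" and E: "negligible E" and M: "M \<ge> 0"
    and \<beta>: "continuous_on {a..b} \<beta>" "\<And>t. t \<in> {a..b} \<Longrightarrow> 0 \<le> \<beta> t"
    and f: "\<And>t. t \<in> {a<..<b} - E \<Longrightarrow>
              \<exists>D. (f has_vector_derivative D) (at t) \<and> norm D \<le> M * norm (f t) + \<beta> t"
    and g: "\<And>t. t \<in> {a..b} \<Longrightarrow> (g has_real_derivative M * g t + \<beta> t) (at t within {a..b})"
    and init: "norm (f a) \<le> g a"
  shows "norm (f b) \<le> g b"
proof -
  obtain I where I: "\<And>t. t \<in> {a..b} \<Longrightarrow> (I has_real_derivative M * norm (f t) + \<beta> t) (at t within {a..b})"
    and incr: "\<And>u v. a \<le> u \<Longrightarrow> u \<le> v \<Longrightarrow> v \<le> b \<Longrightarrow> norm (f v - f u) \<le> I v - I u"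
    by (rule abs_continuous_increment_bound[OF ac E M \<beta> f]) (assumption+, rule that)
  define k where "k t = norm (f a) + (I t - I a) - g t" for t
  define W where "W t = exp (- M * t) * k t" for t
  have dW: "(W has_real_derivative exp (- M * t) * (M * (norm (f t) - g t) - M * k t)) (at t within {a..b})"
    if t: "t \<in> {a..b}" for t
    unfolding W_def k_def
    by (rule derivative_eq_intros I[OF t] g[OF t] refl | simp)+ (simp add: algebra_simps)
  have "W b \<le> W a"
  proof (rule DERIV_nonpos_imp_decreasing_open[OF ab])
    fix t assume t: "a < t" "t < b"
    then have t': "t \<in> {a..b}" by simp
    have "norm (f t) \<le> norm (f a) + norm (f t - f a)"
      using norm_triangle_ineq[of "f a" "f t - f a"] by simp
    also have "\<dots> \<le> norm (f a) + (I t - I a)" using incr[of a t] t by simp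
    finally have "norm (f t) - g t \<le> k t" by (simp add: k_def)
    then have "exp (- M * t) * (M * (norm (f t) - g t) - M * k t) \<le> 0"
      using M by (intro mult_nonneg_nonpos) (auto intro: mult_left_mono)
    moreover have "(W has_real_derivative exp (- M * t) * (M * (norm (f t) - g t) - M * k t)) (at t)"
      using dW[OF t'] at_within_Icc_at[OF t] by simp
    ultimately show "\<exists>y. (W has_real_derivative y) (at t) \<and> y \<le> 0" by blast
  next
    show "continuous_on {a..b} W" using dW by (rule DERIV_continuous_on)
  qed
  also have "W a \<le> 0" using init by (simp add: W_def k_def mult_nonneg_nonpos)
  finally have "k b \<le> 0" by (simp add: W_def mult_le_0_iff)
  moreover have "norm (f b) \<le> norm (f a) + norm (f b - f a)"
    using norm_triangle_ineq[of "f a" "f b - f a"] by simp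
  ultimately show ?thesis using incr[of a b] ab by (simp add: k_def)
qed

text \<open>
  The mirror image: the weight becomes \<open>exp (M t)\<close> and the estimate runs from \<open>b\<close> down to \<open>a\<close>.
\<close>

lemma gronwall_backward:
  fixes f :: "real \<Rightarrow> 'a::real_normed_vector"
  assumes ab: "a \<le> b" and ac: "abs_continuous_on a b f" and E: "negligible E" and M: "M \<ge> 0"
    and \<beta>: "continuous_on {a..b} \<beta>" "\<And>t. t \<in> {a..b} \<Longrightarrow> 0 \<le> \<beta> t"
    and f: "\<And>t. t \<in> {a<..<b} - E \<Longrightarrow>
              \<exists>D. (f has_vector_derivative D) (at t) \<and> norm D \<le> M * norm (f t) + \<beta> t"
    and g: "\<And>t. t \<in> {a..b} \<Longrightarrow> (g has_real_derivative - (M * g t + \<beta> t)) (at t within {a..b})"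
    and init: "norm (f b) \<le> g b"
  shows "norm (f a) \<le> g a"
proof -
  obtain I where I: "\<And>t. t \<in> {a..b} \<Longrightarrow> (I has_real_derivative M * norm (f t) + \<beta> t) (at t within {a..b})"
    and incr: "\<And>u v. a \<le> u \<Longrightarrow> u \<le> v \<Longrightarrow> v \<le> b \<Longrightarrow> norm (f v - f u) \<le> I v - I u"
    by (rule abs_continuous_increment_bound[OF ac E M \<beta> f]) (assumption+, rule that)
  define k where "k t = norm (f b) + (I b - I t) - g t" for t
  define W where "W t = exp (M * t) * k t" for t
  have dW: "(W has_real_derivative exp (M * t) * (M * k t - M * (norm (f t) - g t))) (at t within {a..b})"
    if t: "t \<in> {a..b}" for t
    unfolding W_def k_def
    by (rule derivative_eq_intros I[OF t] g[OF t] refl | simp)+ (simp add: algebra_simps)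
  have "W a \<le> W b"
  proof (rule DERIV_nonneg_imp_increasing_open[OF ab])
    fix t assume t: "a < t" "t < b"
    then have t': "t \<in> {a..b}" by simp
    have "norm (f t) \<le> norm (f b) + norm (f b - f t)"
      using norm_triangle_ineq4[of "f b" "f b - f t"] by simp
    also have "\<dots> \<le> norm (f b) + (I b - I t)" using incr[of t b] t by simp
    finally have "norm (f t) - g t \<le> k t" by (simp add: k_def)
    then have "0 \<le> exp (M * t) * (M * k t - M * (norm (f t) - g t))"
      using M by (intro mult_nonneg_nonneg) (auto intro: mult_left_mono)
    moreover have "(W has_real_derivative exp (M * t) * (M * k t - M * (norm (f t) - g t))) (at t)"
      using dW[OF t'] at_within_Icc_at[OF t] by simp
    ultimately show "\<exists>y. (W has_real_derivative y) (at t) \<and> 0 \<le> y" by blast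
  next
    show "continuous_on {a..b} W" using dW by (rule DERIV_continuous_on)
  qed
  also have "W b \<le> 0" using init by (simp add: W_def k_def mult_nonneg_nonpos)
  finally have "k a \<le> 0" by (simp add: W_def mult_le_0_iff)
  moreover have "norm (f a) \<le> norm (f b) + norm (f b - f a)"
    using norm_triangle_ineq4[of "f b" "f b - f a"] by simp
  ultimately show ?thesis using incr[of a b] ab by (simp add: k_def)
qed

text \<open>
  Majorant and forcing depend on the distance to the base point \<open>s\<close> only, so that one solution \<open>g\<close> of the
  comparison equation bounds \<open>f\<close> both after and before \<open>s\<close>. Flows to \<open>t0\<close> run backwards in time, flows to \<open>T\<close>
  forwards.
\<close>

lemma gronwall_two_sided:
  fixes f :: "real \<Rightarrow> 'a::real_normed_vector"
  assumes ac: "abs_continuous_on a b f" and E: "negligible E" and M: "M \<ge> 0"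
    and s: "s \<in> {a..b}" and t: "t \<in> {a..b}"
    and \<beta>: "continuous_on {0..} \<beta>" "\<And>r. 0 \<le> r \<Longrightarrow> 0 \<le> \<beta> r"
    and f: "\<And>r. r \<in> {a<..<b} - E \<Longrightarrow>
              \<exists>D. (f has_vector_derivative D) (at r) \<and> norm D \<le> M * norm (f r) + \<beta> \<bar>r - s\<bar>"
    and g: "\<And>r. 0 \<le> r \<Longrightarrow> (g has_real_derivative M * g r + \<beta> r) (at r)"
    and init: "norm (f s) \<le> g 0"
  shows "norm (f t) \<le> g \<bar>t - s\<bar>"
proof (cases "s \<le> t")
  case True
  have "norm (f t) \<le> (\<lambda>r. g (r - s)) t"
  proof (rule gronwall_forward[OF True _ E M, where \<beta> = "\<lambda>r. \<beta> (r - s)"])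
    show "abs_continuous_on s t f"
      using s t by (intro abs_continuous_on_subinterval[OF ac]) auto
    show "continuous_on {s..t} (\<lambda>r. \<beta> (r - s))"
      by (rule continuous_on_compose2[OF \<beta>(1)]) (auto intro!: continuous_intros)
    fix r
    {
      assume "r \<in> {s..t}"
      then show "0 \<le> \<beta> (r - s)" by (intro \<beta>(2)) auto
      have g': "(g has_real_derivative M * g (r - s) + \<beta> (r - s)) (at (r - s))"
        using \<open>r \<in> {s..t}\<close> by (intro g) auto
      have "((\<lambda>r. g (r - s)) has_real_derivative (M * g (r - s) + \<beta> (r - s)) * 1) (at r within {s..t})"
        by (rule DERIV_chain2[where g = "\<lambda>r. r - s", OF g']) (auto intro!: derivative_eq_intros)
      then show "((\<lambda>r. g (r - s)) has_real_derivative M * g (r - s) + \<beta> (r - s)) (at r within {s..t})"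
        by simp
    }
    assume r: "r \<in> {s<..<t} - E"
    then have "r \<in> {a<..<b} - E" "\<bar>r - s\<bar> = r - s" using s t by auto
    with f[of r] show "\<exists>D. (f has_vector_derivative D) (at r) \<and> norm D \<le> M * norm (f r) + \<beta> (r - s)"
      by simp
  qed (use init in simp)
  then show ?thesis using True by simp
next
  case False
  then have ts: "t \<le> s" by simp
  have "norm (f t) \<le> (\<lambda>r. g (s - r)) t"
  proof (rule gronwall_backward[OF ts _ E M, where \<beta> = "\<lambda>r. \<beta> (s - r)"])
    show "abs_continuous_on t s f"
      using s t by (intro abs_continuous_on_subinterval[OF ac]) auto
    show "continuous_on {t..s} (\<lambda>r. \<beta> (s - r))"
      by (rule continuous_on_compose2[OF \<beta>(1)]) (auto intro!: continuous_intros)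
    fix r
    {
      assume "r \<in> {t..s}"
      then show "0 \<le> \<beta> (s - r)" by (intro \<beta>(2)) auto
      have g': "(g has_real_derivative M * g (s - r) + \<beta> (s - r)) (at (s - r))"
        using \<open>r \<in> {t..s}\<close> by (intro g) auto
      have "((\<lambda>r. g (s - r)) has_real_derivative (M * g (s - r) + \<beta> (s - r)) * (- 1)) (at r within {t..s})"
        by (rule DERIV_chain2[where g = "\<lambda>r. s - r", OF g']) (auto intro!: derivative_eq_intros)
      then show "((\<lambda>r. g (s - r)) has_real_derivative - (M * g (s - r) + \<beta> (s - r))) (at r within {t..s})"
        by simp
    }
    assume r: "r \<in> {t<..<s} - E"
    then have "r \<in> {a<..<b} - E" "\<bar>r - s\<bar> = s - r" using s t by auto
    with f[of r] show "\<exists>D. (f has_vector_derivative D) (at r) \<and> norm D \<le> M * norm (f r) + \<beta> (s - r)"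
      by simp
  qed (use init in simp)
  then show ?thesis using ts by simp
qed

section \<open>Differentiability from second differences\<close>

text \<open>
  Additivity gives homogeneity for integers. For a real factor \<open>c\<close>, rounding \<open>n c\<close> to an integer changes
  \<open>n (A (c x) - c A x)\<close> by a bounded amount, and \<open>n\<close> is arbitrary.
\<close>

lemma additive_bounded_imp_bounded_linear:
  fixes A :: "'a::real_normed_vector \<Rightarrow> 'b::real_normed_vector"
  assumes add: "\<And>x y. A (x + y) = A x + A y" and bd: "\<And>x. norm (A x) \<le> M * norm x"
  shows "bounded_linear A"
proof (rule bounded_linear_intro[where K = M])
  interpret additive A by standard (rule add)
  have nat: "A (real n *\<^sub>R x) = real n *\<^sub>R A x" for n x
    by (induction n) (simp_all add: zero add algebra_simps)
  have int: "A (of_int k *\<^sub>R x) = of_int k *\<^sub>R A x" for k :: int and x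
  proof (cases "k \<ge> 0")
    case True
    then show ?thesis using nat[of "nat k" x] by simp
  next
    case False
    then show ?thesis using nat[of "nat (- k)" x] by (simp add: minus)
  qed
  fix c :: real and x :: 'a
  have bound: "real n * norm (A (c *\<^sub>R x) - c *\<^sub>R A x) \<le> 2 * (M * norm x)" for n
  proof -
    define k where "k = \<lfloor>real n * c\<rfloor>"
    define r where "r = real n * c - of_int k"
    have r: "0 \<le> r" "r \<le> 1" unfolding r_def k_def by linarith+
    have "A ((real n * c) *\<^sub>R x) = A (r *\<^sub>R x) + of_int k *\<^sub>R A x"
      by (simp add: r_def int[symmetric] add[symmetric] scaleR_left_distrib[symmetric])
    moreover have "real n *\<^sub>R A (c *\<^sub>R x) = A ((real n * c) *\<^sub>R x)"
      using nat[of n "c *\<^sub>R x"] by simp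
    ultimately have "real n *\<^sub>R (A (c *\<^sub>R x) - c *\<^sub>R A x) = A (r *\<^sub>R x) - r *\<^sub>R A x"
      by (simp add: r_def algebra_simps)
    then have "real n * norm (A (c *\<^sub>R x) - c *\<^sub>R A x) = norm (A (r *\<^sub>R x) - r *\<^sub>R A x)"
      by (metis norm_scaleR abs_of_nat)
    also have "\<dots> \<le> norm (A (r *\<^sub>R x)) + norm (r *\<^sub>R A x)" by (rule norm_triangle_ineq4)
    also have "\<dots> \<le> M * norm (r *\<^sub>R x) + r * (M * norm x)"
      using bd[of "r *\<^sub>R x"] mult_left_mono[OF bd[of x] r(1)] r(1) by (intro add_mono) simp_all
    also have "\<dots> = 2 * (r * (M * norm x))" using r(1) by simp
    also have "\<dots> \<le> 2 * (M * norm x)"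
      using mult_right_mono[OF r(2) order_trans[OF norm_ge_zero bd[of x]]] by simp
    finally show ?thesis .
  qed
  show "A (c *\<^sub>R x) = c *\<^sub>R A x"
  proof (rule ccontr)
    assume "A (c *\<^sub>R x) \<noteq> c *\<^sub>R A x"
    then obtain n where "2 * (M * norm x) < real n * norm (A (c *\<^sub>R x) - c *\<^sub>R A x)"
      using reals_Archimedean3[of "norm (A (c *\<^sub>R x) - c *\<^sub>R A x)"] by auto
    with bound[of n] show False by simp
  qed
qed (use add bd in \<open>simp_all add: mult.commute\<close>)

text \<open>
  Consecutive dyadic difference quotients \<open>2^n (f (x + h / 2^n) - f x)\<close> differ by a second difference, so by
  \<open>O(2^-n |h|^2)\<close>. Hence they converge to some \<open>A h\<close> with error \<open>O(|h|^2)\<close>, and the second difference bound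
  also makes \<open>A\<close> additive.
\<close>

lemma differentiable_of_second_difference_bound:
  fixes f :: "'a::real_normed_vector \<Rightarrow> 'b::banach"
  assumes lip: "\<And>x y. norm (f x - f y) \<le> M * norm (x - y)"
    and sd: "\<And>x h k. norm (f (x + h + k) - f (x + h) - f (x + k) + f x) \<le> K * norm h * norm k"
  shows "f differentiable (at x)"
proof -
  define a where "a n h = (2::real) ^ n *\<^sub>R (f (x + (1 / 2 ^ n) *\<^sub>R h) - f x)" for n :: nat and h
  have step: "norm (a (Suc n) h - a n h) \<le> (1/2) ^ n * (K * norm h ^ 2 / 4)" for n h
  proof -
    define k where "k = (1 / 2 ^ Suc n) *\<^sub>R h"
    have k2: "(1 / 2 ^ n) *\<^sub>R h = k + k" by (simp add: k_def scaleR_left_distrib[symmetric])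
    have two: "(2 * 2 ^ n) *\<^sub>R v = (2::real) ^ n *\<^sub>R v + (2::real) ^ n *\<^sub>R v" for v :: 'b
      by (metis mult_2 scaleR_add_left)
    have eqs: "a (Suc n) h = (2 * 2 ^ n) *\<^sub>R (f (x + k) - f x)" "a n h = (2::real) ^ n *\<^sub>R (f (x + k + k) - f x)"
      unfolding a_def k2 by (simp_all add: k_def add.assoc)
    have "a (Suc n) h - a n h = - ((2::real) ^ n *\<^sub>R (f (x + k + k) - f (x + k) - f (x + k) + f x))"
      unfolding eqs two by (simp add: algebra_simps)
    then have "norm (a (Suc n) h - a n h) = 2 ^ n * norm (f (x + k + k) - f (x + k) - f (x + k) + f x)"
      by simp
    also have "\<dots> \<le> 2 ^ n * (K * norm k * norm k)" by (intro mult_left_mono sd) simp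
    also have "\<dots> = (1/2) ^ n * (K * norm h ^ 2 / 4)"
      by (simp add: k_def power2_eq_square field_simps)
    finally show ?thesis .
  qed
  have sumb: "summable (\<lambda>n. (1/2 :: real) ^ n * c)" for c
    by (intro summable_mult2 summable_geometric) simp
  have sumd: "summable (\<lambda>n. a (Suc n) h - a n h)" for h
    by (rule summable_comparison_test'[OF sumb, of 0]) (rule step)
  define A where "A h = a 0 h + (\<Sum>n. a (Suc n) h - a n h)" for h
  have lim: "(\<lambda>n. a n h) \<longlonglongrightarrow> A h" for h
  proof -
    have "(\<lambda>n. a 0 h + (\<Sum>i<n. a (Suc i) h - a i h)) \<longlonglongrightarrow> A h"
      unfolding A_def by (intro tendsto_intros summable_LIMSEQ[OF sumd])
    then show ?thesis unfolding sum_lessThan_telescope[of "\<lambda>n. a n h"] by simp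
  qed
  have approx: "norm (f (x + h) - f x - A h) \<le> K * norm h ^ 2 / 2" for h
  proof -
    have "f (x + h) - f x - A h = - (\<Sum>n. a (Suc n) h - a n h)" by (simp add: A_def a_def)
    also have "norm \<dots> \<le> (\<Sum>n. (1/2) ^ n * (K * norm h ^ 2 / 4))"
      unfolding norm_minus_cancel by (rule norm_suminf_le[OF step sumb])
    also have "\<dots> = K * norm h ^ 2 / 2"
      using suminf_mult2[of "\<lambda>n. (1/2 :: real) ^ n" "K * norm h ^ 2 / 4"]
      by (simp add: summable_geometric suminf_geometric)
    finally show ?thesis .
  qed
  have "bounded_linear A"
  proof (rule additive_bounded_imp_bounded_linear[where M = M])
    fix h k
    have bnd: "norm (a n (h + k) - (a n h + a n k)) \<le> (1/2) ^ n * (K * norm h * norm k)" for n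
    proof -
      let ?h = "(1 / 2 ^ n) *\<^sub>R h" and ?k = "(1 / 2 ^ n) *\<^sub>R k"
      have "a n (h + k) - (a n h + a n k) = (2::real) ^ n *\<^sub>R (f (x + ?h + ?k) - f (x + ?h) - f (x + ?k) + f x)"
        by (simp add: a_def scaleR_right_distrib add.assoc) (simp add: algebra_simps)
      then have "norm (a n (h + k) - (a n h + a n k)) = 2 ^ n * norm (f (x + ?h + ?k) - f (x + ?h) - f (x + ?k) + f x)"
        by simp
      also have "\<dots> \<le> 2 ^ n * (K * norm ?h * norm ?k)" by (intro mult_left_mono sd) simp
      also have "\<dots> = (1/2) ^ n * (K * norm h * norm k)" by (simp add: field_simps)
      finally show ?thesis .
    qed
    have "(\<lambda>n. (1/2 :: real) ^ n * (K * norm h * norm k)) \<longlonglongrightarrow> 0"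
      by (intro tendsto_mult_left_zero LIMSEQ_realpow_zero) simp_all
    from Lim_null_comparison[OF always_eventually[OF allI[OF bnd]] this]
    have lim1: "(\<lambda>n. a n (h + k) - (a n h + a n k)) \<longlonglongrightarrow> 0" .
    have lim2: "(\<lambda>n. a n (h + k) - (a n h + a n k)) \<longlonglongrightarrow> A (h + k) - (A h + A k)"
      by (intro tendsto_intros lim)
    have "A (h + k) - (A h + A k) = 0" by (rule LIMSEQ_unique[OF lim2 lim1])
    then show "A (h + k) = A h + A k" by simp
  next
    fix h
    have "norm (a n h) \<le> M * norm h" for n
    proof -
      have "norm (a n h) = 2 ^ n * norm (f (x + (1 / 2 ^ n) *\<^sub>R h) - f x)" by (simp add: a_def)
      also have "\<dots> \<le> 2 ^ n * (M * norm (x + (1 / 2 ^ n) *\<^sub>R h - x))" by (intro mult_left_mono lip) simp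
      also have "\<dots> = M * norm h" by simp
      finally show ?thesis .
    qed
    then show "norm (A h) \<le> M * norm h"
      by (intro Lim_bounded[OF tendsto_norm[OF lim]]) auto
  qed
  moreover have "\<exists>d>0. \<forall>y. norm (y - x) < d \<longrightarrow> norm (f y - f x - A (y - x)) \<le> e * norm (y - x)"
    if e: "e > 0" for e
  proof (intro exI[of _ "2 * e / (\<bar>K\<bar> + 1)"] conjI allI impI)
    show "0 < 2 * e / (\<bar>K\<bar> + 1)" using e by simp
    fix y assume y: "norm (y - x) < 2 * e / (\<bar>K\<bar> + 1)"
    then have "(\<bar>K\<bar> + 1) * norm (y - x) \<le> 2 * e" by (simp add: field_simps)
    moreover have "K * norm (y - x) \<le> (\<bar>K\<bar> + 1) * norm (y - x)" by (intro mult_right_mono) auto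
    ultimately have "K * norm (y - x) \<le> 2 * e" by linarith
    then have "(K * norm (y - x)) * norm (y - x) \<le> (2 * e) * norm (y - x)" by (rule mult_right_mono) simp
    then show "norm (f y - f x - A (y - x)) \<le> e * norm (y - x)"
      using approx[of "y - x"] by (simp add: power2_eq_square)
  qed
  ultimately have "(f has_derivative A) (at x)" unfolding has_derivative_at_alt by blast
  then show ?thesis by (rule differentiableI)
qed

lemma difference_quotient_tendsto:
  fixes f :: "'a::real_normed_vector \<Rightarrow> 'b::real_normed_vector"
  assumes f: "(f has_derivative f') (at x)"
  shows "(\<lambda>n. real (Suc n) *\<^sub>R (f (x + (1 / real (Suc n)) *\<^sub>R h) - f x)) \<longlonglongrightarrow> f' h"
proof (rule LIMSEQ_I)
  fix e :: real assume e: "e > 0"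
  define e' where "e' = e / (norm h + 1)"
  have e': "e' > 0" "e' * norm h < e" using e by (simp_all add: e'_def field_simps add_pos_nonneg)
  from f have bl: "bounded_linear f'" by (rule has_derivative_bounded_linear)
  from f e'(1) obtain d where d: "d > 0"
    "\<And>y. norm (y - x) < d \<Longrightarrow> norm (f y - f x - f' (y - x)) \<le> e' * norm (y - x)"
    unfolding has_derivative_at_alt by blast
  have "(\<lambda>n. norm ((1 / real (Suc n)) *\<^sub>R h)) \<longlonglongrightarrow> 0"
    using LIMSEQ_inverse_real_of_nat by (intro tendsto_norm_zero tendsto_scaleR[OF _ tendsto_const, of _ 0, simplified]) (simp add: divide_inverse)
  from order_tendstoD(2)[OF this d(1)]
  obtain n0 where n0: "\<And>n. n \<ge> n0 \<Longrightarrow> norm ((1 / real (Suc n)) *\<^sub>R h) < d"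
    unfolding eventually_sequentially by blast
  show "\<exists>n0. \<forall>n\<ge>n0. norm (real (Suc n) *\<^sub>R (f (x + (1 / real (Suc n)) *\<^sub>R h) - f x) - f' h) < e"
  proof (intro exI[of _ n0] allI impI)
    fix n assume n: "n \<ge> n0"
    let ?h = "(1 / real (Suc n)) *\<^sub>R h"
    have "norm (f (x + ?h) - f x - f' ?h) \<le> e' * norm ?h"
      using d(2)[of "x + ?h"] n0[OF n] by (simp only: add_diff_cancel_left')
    then have "real (Suc n) * norm (f (x + ?h) - f x - f' ?h) \<le> real (Suc n) * (e' * norm ?h)"
      by (rule mult_left_mono) simp
    also have "\<dots> = e' * norm h" by (simp add: field_simps)
    also have "real (Suc n) * norm (f (x + ?h) - f x - f' ?h)
        = norm (real (Suc n) *\<^sub>R (f (x + ?h) - f x - f' ?h))" by simp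
    also have "real (Suc n) *\<^sub>R (f (x + ?h) - f x - f' ?h) = real (Suc n) *\<^sub>R (f (x + ?h) - f x) - f' h"
      by (simp add: linear_simps(5)[OF bl] scaleR_diff_right del: of_nat_Suc)
    finally show "norm (real (Suc n) *\<^sub>R (f (x + ?h) - f x) - f' h) < e" using e'(2) by simp
  qed
qed

lemma lipschitz_derivative_norm_le:
  fixes f :: "'a::real_normed_vector \<Rightarrow> 'b::real_normed_vector"
  assumes f: "(f has_derivative f') (at x)" and lip: "\<And>y z. norm (f y - f z) \<le> M * norm (y - z)"
  shows "norm (f' h) \<le> M * norm h"
proof (rule Lim_bounded[OF tendsto_norm[OF difference_quotient_tendsto[OF f]]])
  show "\<forall>n\<ge>0. norm (real (Suc n) *\<^sub>R (f (x + (1 / real (Suc n)) *\<^sub>R h) - f x)) \<le> M * norm h"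
  proof (intro allI impI)
    fix n
    have "norm (real (Suc n) *\<^sub>R (f (x + (1 / real (Suc n)) *\<^sub>R h) - f x))
        \<le> real (Suc n) * (M * norm ((1 / real (Suc n)) *\<^sub>R h))"
      unfolding norm_scaleR using lip[of "x + (1 / real (Suc n)) *\<^sub>R h" x]
      by (simp del: of_nat_Suc add: field_simps)
    then show "norm (real (Suc n) *\<^sub>R (f (x + (1 / real (Suc n)) *\<^sub>R h) - f x)) \<le> M * norm h"
      by simp
  qed
qed

lemma second_difference_derivative_lipschitz:
  fixes f :: "'a::real_normed_vector \<Rightarrow> 'b::real_normed_vector"
  assumes f: "(f has_derivative f') (at x)" "(f has_derivative f'') (at z)"
    and sd: "\<And>x h k. norm (f (x + h + k) - f (x + h) - f (x + k) + f x) \<le> K * norm h * norm k"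
  shows "norm (f' h - f'' h) \<le> K * norm (x - z) * norm h"
proof -
  let ?q = "\<lambda>x n. real (Suc n) *\<^sub>R (f (x + (1 / real (Suc n)) *\<^sub>R h) - f x)"
  have "(\<lambda>n. ?q x n - ?q z n) \<longlonglongrightarrow> f' h - f'' h"
    by (intro tendsto_diff difference_quotient_tendsto f)
  then show ?thesis
  proof (rule Lim_bounded[OF tendsto_norm], intro allI impI)
    fix n
    let ?h = "(1 / real (Suc n)) *\<^sub>R h"
    have "?q x n - ?q z n = real (Suc n) *\<^sub>R (f (z + (x - z) + ?h) - f (z + (x - z)) - f (z + ?h) + f z)"
      by (simp add: algebra_simps)
    also have "norm \<dots> \<le> real (Suc n) * (K * norm (x - z) * norm ?h)"
      unfolding norm_scaleR using sd[of z "x - z" ?h]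
      by (intro mult_mono) (simp_all del: of_nat_Suc)
    finally show "norm (?q x n - ?q z n) \<le> K * norm (x - z) * norm h" by (simp add: mult.assoc)
  qed
qed

section \<open>The flow and its spatial derivative\<close>

text \<open>
  Apply the mean value inequality to \<open>z \<mapsto> f (z + q) - f z\<close>, whose derivative is bounded by \<open>K |q|\<close>.
\<close>

lemma second_difference_le_of_lipschitz_derivative:
  fixes f :: "'a::real_normed_vector \<Rightarrow> 'b::real_normed_vector"
  assumes f: "\<And>x. (f has_derivative blinfun_apply (f' x)) (at x)"
    and f': "\<And>x y. norm (f' x - f' y) \<le> K * norm (x - y)"
  shows "norm (f (x + p + q) - f (x + p) - f (x + q) + f x) \<le> K * norm p * norm q"
proof -
  let ?g = "\<lambda>z. f (z + q) - f z"
  have "norm (?g (x + p) - ?g x) \<le> (K * norm q) * norm ((x + p) - x)"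
  proof (rule differentiable_bound[where S = UNIV and f' = "\<lambda>z. blinfun_apply (f' (z + q) - f' z)"])
    fix z
    have "((\<lambda>z. f (z + q)) has_derivative blinfun_apply (f' (z + q))) (at z)"
      by (rule has_derivative_compose[where f = "\<lambda>z. z + q" and f' = "\<lambda>h. h", OF _ f])
        (auto intro!: derivative_eq_intros)
    then show "(?g has_derivative blinfun_apply (f' (z + q) - f' z)) (at z within UNIV)"
      unfolding blinfun.diff_left using f[of z] by (rule has_derivative_diff)
    show "onorm (blinfun_apply (f' (z + q) - f' z)) \<le> K * norm q"
      using f'[of "z + q" z] by (simp add: norm_blinfun.rep_eq)
  qed auto
  moreover have "f (x + p + q) - f (x + p) - f (x + q) + f x = ?g (x + p) - ?g x" by simp
  ultimately show ?thesis by (simp only: add_diff_cancel_left' mult_ac)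
qed

text \<open>
  All estimates on the flow use the vector field only through its Lipschitz constant and its second
  differences.
\<close>

locale flow_with_bounds =
  fixes t0 T \<Lambda>1 \<Lambda>2 :: real and N :: "real \<Rightarrow> real^'d \<Rightarrow> real^'d"
    and \<Phi> :: "real \<Rightarrow> real \<Rightarrow> real^'d \<Rightarrow> real^'d"
  assumes \<Lambda>1: "\<Lambda>1 > 0" and \<Lambda>2: "\<Lambda>2 \<ge> 0"
    and N_lipschitz: "\<And>t x y. t \<in> {t0..T} \<Longrightarrow> norm (N t x - N t y) \<le> \<Lambda>1 * norm (x - y)"
    and N_second_difference: "\<And>t x p q. t \<in> {t0..T} \<Longrightarrow>
      norm (N t (x + p + q) - N t (x + p) - N t (x + q) + N t x) \<le> \<Lambda>2 * norm p * norm q"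
    and flow: "is_flow t0 T N \<Phi>"
begin

text \<open>
  The solution of \<open>g' = \<Lambda>1 g + \<Lambda>2 exp (2 \<Lambda>1 r)\<close> with \<open>g 0 = 0\<close>; it turns out to be a Lipschitz constant of the
  flow derivative over a time span \<open>r\<close>.
\<close>

definition growth :: "real \<Rightarrow> real" where
  "growth r = \<Lambda>2 / \<Lambda>1 * (exp (2 * \<Lambda>1 * r) - exp (\<Lambda>1 * r))"

lemma flow_initial [simp]: "s \<in> {t0..T} \<Longrightarrow> \<Phi> s s x = x"
  using flow by (simp add: is_flow_def)

lemma flow_abs_continuous: "s \<in> {t0..T} \<Longrightarrow> abs_continuous_on t0 T (\<lambda>t. \<Phi> s t x)"
  using flow by (simp add: is_flow_def solves_ae_def)

lemma flow_derivE:
  assumes "s \<in> {t0..T}"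
  obtains E where "negligible E"
    "\<And>t. t \<in> {t0<..<T} - E \<Longrightarrow> ((\<lambda>t. \<Phi> s t x) has_vector_derivative N t (\<Phi> s t x)) (at t)"
proof -
  have "AE t in lebesgue_on {t0<..<T}. ((\<lambda>t. \<Phi> s t x) has_vector_derivative N t (\<Phi> s t x)) (at t)"
    using flow assms by (simp add: is_flow_def solves_ae_def)
  then show ?thesis
    by (rule AE_lebesgue_on_negligibleE) (simp, rule that)
qed

text \<open>
  Two start times are allowed in order to obtain the Lipschitz bound (\<open>s = s'\<close>) and the cocycle law
  (uniqueness for different start times) from one application of Gronwall's inequality.
\<close>

lemma flow_diff_le:
  assumes s: "s \<in> {t0..T}" and s': "s' \<in> {t0..T}" and r: "r \<in> {t0..T}" and t: "t \<in> {t0..T}"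
  shows "norm (\<Phi> s t x - \<Phi> s' t y) \<le> exp (\<Lambda>1 * \<bar>t - r\<bar>) * norm (\<Phi> s r x - \<Phi> s' r y)"
proof -
  obtain E1 where E1: "negligible E1" "\<And>t. t \<in> {t0<..<T} - E1 \<Longrightarrow>
      ((\<lambda>t. \<Phi> s t x) has_vector_derivative N t (\<Phi> s t x)) (at t)"
    by (rule flow_derivE[OF s]) (rule that)
  obtain E2 where E2: "negligible E2" "\<And>t. t \<in> {t0<..<T} - E2 \<Longrightarrow>
      ((\<lambda>t. \<Phi> s' t y) has_vector_derivative N t (\<Phi> s' t y)) (at t)"
    by (rule flow_derivE[OF s']) (rule that)
  show ?thesis
  proof (rule gronwall_two_sided[OF _ _ _ r t, where E = "E1 \<union> E2" and M = \<Lambda>1 and \<beta> = "\<lambda>_. 0"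
        and g = "\<lambda>\<rho>. exp (\<Lambda>1 * \<rho>) * norm (\<Phi> s r x - \<Phi> s' r y)"])
    show "abs_continuous_on t0 T (\<lambda>t. \<Phi> s t x - \<Phi> s' t y)"
      by (intro abs_continuous_on_diff flow_abs_continuous s s')
    show "negligible (E1 \<union> E2)" using E1(1) E2(1) by simp
    show "0 \<le> \<Lambda>1" using \<Lambda>1 by simp
    fix t assume t: "t \<in> {t0<..<T} - (E1 \<union> E2)"
    show "\<exists>D. ((\<lambda>t. \<Phi> s t x - \<Phi> s' t y) has_vector_derivative D) (at t)
        \<and> norm D \<le> \<Lambda>1 * norm (\<Phi> s t x - \<Phi> s' t y) + 0"
    proof (intro exI conjI)
      show "((\<lambda>t. \<Phi> s t x - \<Phi> s' t y) has_vector_derivative (N t (\<Phi> s t x) - N t (\<Phi> s' t y))) (at t)"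
        using t by (intro has_vector_derivative_diff E1 E2) auto
      show "norm (N t (\<Phi> s t x) - N t (\<Phi> s' t y)) \<le> \<Lambda>1 * norm (\<Phi> s t x - \<Phi> s' t y) + 0"
        using N_lipschitz[of t] t by simp
    qed
  qed (auto intro!: derivative_eq_intros)
qed

lemma flow_lipschitz:
  assumes "s \<in> {t0..T}" "t \<in> {t0..T}"
  shows "norm (\<Phi> s t x - \<Phi> s t y) \<le> exp (\<Lambda>1 * \<bar>t - s\<bar>) * norm (x - y)"
  using flow_diff_le[OF assms(1) assms(1) assms(1) assms(2), of x y] assms by simp

lemma flow_cocycle:
  assumes "s \<in> {t0..T}" "r \<in> {t0..T}" "t \<in> {t0..T}"
  shows "\<Phi> s t x = \<Phi> r t (\<Phi> s r x)"
  using flow_diff_le[OF assms(1,2,2,3), of x "\<Phi> s r x"] assms by simp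

text \<open>
  The second difference \<open>d\<close> of four flow lines satisfies \<open>|d'| \<le> \<Lambda>1 |d| + \<Lambda>2 |b - e| |c - e|\<close>, where \<open>b - e\<close> and
  \<open>c - e\<close> are first differences, already bounded by \<open>exp (\<Lambda>1 r) |h|\<close> and \<open>exp (\<Lambda>1 r) |k|\<close>.
\<close>

lemma flow_second_difference:
  assumes s: "s \<in> {t0..T}" and t: "t \<in> {t0..T}"
  shows "norm (\<Phi> s t (x + h + k) - \<Phi> s t (x + h) - \<Phi> s t (x + k) + \<Phi> s t x)
      \<le> growth \<bar>t - s\<bar> * norm h * norm k"
proof -
  define d where "d t = \<Phi> s t (x + h + k) - \<Phi> s t (x + h) - (\<Phi> s t (x + k) - \<Phi> s t x)" for t
  have ex: "\<exists>E. negligible E \<and> (\<forall>t\<in>{t0<..<T} - E.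
      ((\<lambda>t. \<Phi> s t z) has_vector_derivative N t (\<Phi> s t z)) (at t))" for z
    by (rule flow_derivE[OF s, of z], intro exI conjI ballI)
  define E where "E z = (SOME E. negligible E \<and> (\<forall>t\<in>{t0<..<T} - E.
      ((\<lambda>t. \<Phi> s t z) has_vector_derivative N t (\<Phi> s t z)) (at t)))" for z
  have E: "negligible (E z)" "t \<in> {t0<..<T} - E z \<Longrightarrow>
      ((\<lambda>t. \<Phi> s t z) has_vector_derivative N t (\<Phi> s t z)) (at t)" for z t
    using someI_ex[OF ex[of z]] unfolding E_def by simp_all
  define E' where "E' = E (x + h + k) \<union> E (x + h) \<union> E (x + k) \<union> E x"
  have "norm (d t) \<le> growth \<bar>t - s\<bar> * norm h * norm k"
  proof (rule gronwall_two_sided[OF _ _ _ s t, where E = E' and M = \<Lambda>1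
        and \<beta> = "\<lambda>r. \<Lambda>2 * norm h * norm k * exp (2 * \<Lambda>1 * r)" and g = "\<lambda>r. growth r * norm h * norm k"])
    show "abs_continuous_on t0 T d"
      unfolding d_def by (intro abs_continuous_on_diff flow_abs_continuous s)
    show "negligible E'" unfolding E'_def using E(1) by simp
    show "0 \<le> \<Lambda>1" using \<Lambda>1 by simp
    show "continuous_on {0..} (\<lambda>r. \<Lambda>2 * norm h * norm k * exp (2 * \<Lambda>1 * r))"
      by (intro continuous_intros)
    show "0 \<le> \<Lambda>2 * norm h * norm k * exp (2 * \<Lambda>1 * r)" for r using \<Lambda>2 by simp
    show "norm (d s) \<le> growth 0 * norm h * norm k" using s by (simp add: d_def growth_def)
    show "((\<lambda>r. growth r * norm h * norm k) has_real_derivative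
        \<Lambda>1 * (growth r * norm h * norm k) + \<Lambda>2 * norm h * norm k * exp (2 * \<Lambda>1 * r)) (at r)" for r
      unfolding growth_def using \<Lambda>1 by (auto intro!: derivative_eq_intros simp: field_simps)
  next
    fix r assume r': "r \<in> {t0<..<T} - E'"
    then have r: "r \<in> {t0..T}" by auto
    let ?a = "\<Phi> s r (x + h + k)" and ?b = "\<Phi> s r (x + h)" and ?c = "\<Phi> s r (x + k)" and ?e = "\<Phi> s r x"
    let ?D = "N r ?a - N r ?b - (N r ?c - N r ?e)"
    show "\<exists>D. (d has_vector_derivative D) (at r)
        \<and> norm D \<le> \<Lambda>1 * norm (d r) + \<Lambda>2 * norm h * norm k * exp (2 * \<Lambda>1 * \<bar>r - s\<bar>)"
    proof (intro exI[of _ ?D] conjI)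
      show "(d has_vector_derivative ?D) (at r)"
        unfolding d_def using r' by (intro has_vector_derivative_diff E(2)) (auto simp: E'_def)
      have be: "norm (?b - ?e) \<le> exp (\<Lambda>1 * \<bar>r - s\<bar>) * norm h"
        and ce: "norm (?c - ?e) \<le> exp (\<Lambda>1 * \<bar>r - s\<bar>) * norm k"
        using flow_lipschitz[OF s r, of "x + h" x] flow_lipschitz[OF s r, of "x + k" x] by simp_all
      have pts: "?e + (?b - ?e) = ?b" "?e + (?c - ?e) = ?c" by simp_all
      have split: "A - B - (C - D) = (A - V) + (V - B - C + D)" for A B C D V :: "real^'d"
        by simp
      have D_eq: "?D = (N r ?a - N r (?b + (?c - ?e)))
          + (N r (?e + (?b - ?e) + (?c - ?e)) - N r (?e + (?b - ?e)) - N r (?e + (?c - ?e)) + N r ?e)"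
        unfolding pts by (rule split)
      have le0: "norm ?D \<le> \<Lambda>1 * norm (?a - (?b + (?c - ?e))) + \<Lambda>2 * norm (?b - ?e) * norm (?c - ?e)"
        by (subst D_eq, rule order_trans[OF norm_triangle_ineq add_mono[OF N_lipschitz[OF r] N_second_difference[OF r]]])
      have d_eq: "?a - (?b + (?c - ?e)) = d r" by (simp add: d_def)
      have le: "norm ?D \<le> \<Lambda>1 * norm (d r) + \<Lambda>2 * norm (?b - ?e) * norm (?c - ?e)"
        using le0 unfolding d_eq .
      have "\<Lambda>2 * norm (?b - ?e) * norm (?c - ?e)
          \<le> \<Lambda>2 * (exp (\<Lambda>1 * \<bar>r - s\<bar>) * norm h) * (exp (\<Lambda>1 * \<bar>r - s\<bar>) * norm k)"
        using \<Lambda>2 by (intro mult_mono be ce) simp_all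
      also have "\<dots> = \<Lambda>2 * norm h * norm k * (exp (\<Lambda>1 * \<bar>r - s\<bar>) * exp (\<Lambda>1 * \<bar>r - s\<bar>))"
        by simp
      also have "exp (\<Lambda>1 * \<bar>r - s\<bar>) * exp (\<Lambda>1 * \<bar>r - s\<bar>) = exp (2 * \<Lambda>1 * \<bar>r - s\<bar>)"
        unfolding mult_exp_exp by simp
      finally show "norm ?D \<le> \<Lambda>1 * norm (d r) + \<Lambda>2 * norm h * norm k * exp (2 * \<Lambda>1 * \<bar>r - s\<bar>)"
        using le by linarith
    qed
  qed
  then show ?thesis by (simp add: d_def algebra_simps)
qed

lemma flow_has_derivative:
  assumes "s \<in> {t0..T}" "t \<in> {t0..T}"
  shows "(\<Phi> s t has_derivative (\<lambda>h. jacobian (\<Phi> s t) (at x) *v h)) (at x)"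
proof -
  have "\<Phi> s t differentiable (at x)"
    by (rule differentiable_of_second_difference_bound[OF flow_lipschitz[OF assms] flow_second_difference[OF assms]])
  then show ?thesis by (simp add: jacobian_works)
qed

lemma flow_jacobian_le:
  assumes "s \<in> {t0..T}" "t \<in> {t0..T}"
  shows "norm (jacobian (\<Phi> s t) (at x) *v h) \<le> exp (\<Lambda>1 * \<bar>t - s\<bar>) * norm h"
  by (rule lipschitz_derivative_norm_le[OF flow_has_derivative[OF assms] flow_lipschitz[OF assms]])

lemma flow_jacobian_diff_le:
  assumes "s \<in> {t0..T}" "t \<in> {t0..T}"
  shows "norm (jacobian (\<Phi> s t) (at x) *v h - jacobian (\<Phi> s t) (at y) *v h)
      \<le> growth \<bar>t - s\<bar> * norm (x - y) * norm h"
  by (rule second_difference_derivative_lipschitz[OF flow_has_derivative[OF assms]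
        flow_has_derivative[OF assms] flow_second_difference[OF assms]])

lemma growth_nonneg: "0 \<le> r \<Longrightarrow> 0 \<le> growth r"
  using \<Lambda>1 \<Lambda>2 by (simp add: growth_def)

text \<open>
  Continuity in the start time comes from the cocycle law: \<open>\<Phi> s t (z s)\<close> is \<open>\<Phi> r t\<close> applied to \<open>\<Phi> s r (z s)\<close>, which
  tends to \<open>z s\<close> as \<open>r\<close> tends to \<open>s\<close>.
\<close>

lemma flow_start_continuous:
  assumes z: "continuous_on {t0..T} z" and t: "t \<in> {t0..T}"
  shows "continuous_on {t0..T} (\<lambda>s. \<Phi> s t (z s))"
  unfolding continuous_on_def
proof
  fix s assume s: "s \<in> {t0..T}"
  define K where "K = exp (\<Lambda>1 * (T - t0))"
  have bound: "norm (\<Phi> r t (z r) - \<Phi> s t (z s)) \<le> K * norm (z r - \<Phi> s r (z s))" if r: "r \<in> {t0..T}" for r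
  proof -
    have "\<Phi> s t (z s) = \<Phi> r t (\<Phi> s r (z s))" by (rule flow_cocycle[OF s r t])
    then have "norm (\<Phi> r t (z r) - \<Phi> s t (z s)) \<le> exp (\<Lambda>1 * \<bar>t - r\<bar>) * norm (z r - \<Phi> s r (z s))"
      using flow_lipschitz[OF r t] by simp
    also have "\<dots> \<le> K * norm (z r - \<Phi> s r (z s))"
      unfolding K_def using r t \<Lambda>1 by (intro mult_right_mono) auto
    finally show ?thesis .
  qed
  have "continuous_on {t0..T} (\<lambda>r. K * norm (z r - \<Phi> s r (z s)))"
    by (intro continuous_intros z abs_continuous_on_imp_continuous_on[OF flow_abs_continuous[OF s]])
  then have "((\<lambda>r. K * norm (z r - \<Phi> s r (z s))) \<longlongrightarrow> K * norm (z s - \<Phi> s s (z s))) (at s within {t0..T})"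
    using s unfolding continuous_on_def by blast
  then have lim0: "((\<lambda>r. K * norm (z r - \<Phi> s r (z s))) \<longlongrightarrow> 0) (at s within {t0..T})"
    using s by simp
  have "((\<lambda>r. \<Phi> r t (z r) - \<Phi> s t (z s)) \<longlongrightarrow> 0) (at s within {t0..T})"
    by (rule Lim_null_comparison[OF _ lim0]) (simp add: eventually_at_filter bound)
  then show "((\<lambda>r. \<Phi> r t (z r)) \<longlongrightarrow> \<Phi> s t (z s)) (at s within {t0..T})"
    by (simp add: Lim_null[symmetric])
qed

end

section \<open>Spectral norms and symmetric matrices\<close>

lemma norm_matrix_vector_mult_le:
  fixes A :: "real^'n^'m"
  shows "norm (A *v x) \<le> norm A * norm x"
proof -
  have "norm (A *v x) = L2_set (\<lambda>i. \<bar>(A $ i) \<bullet> x\<bar>) UNIV"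
    by (simp add: norm_vec_def matrix_vector_mul_component)
  also have "\<dots> \<le> L2_set (\<lambda>i. norm (A $ i) * norm x) UNIV"
    by (intro L2_set_mono Cauchy_Schwarz_ineq2) simp
  also have "\<dots> = L2_set (\<lambda>i. norm (A $ i)) UNIV * norm x"
    by (rule L2_set_left_distrib[symmetric]) simp
  also have "\<dots> = norm A * norm x" by (simp add: norm_vec_def)
  finally show ?thesis .
qed

lemma norm_mult_le_spectral_norm: "norm (A *v x) \<le> spectral_norm A * norm x"
  unfolding spectral_norm_def by (rule onorm) simp

lemma spectral_norm_nonneg: "0 \<le> spectral_norm A"
  unfolding spectral_norm_def by (rule onorm_pos_le) simp

lemma spectral_norm_le_norm: "spectral_norm A \<le> norm A"
  unfolding spectral_norm_def by (rule onorm_le) (rule norm_matrix_vector_mult_le)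

lemma spectral_norm_diff_le: "spectral_norm A - spectral_norm A' \<le> norm (A - A')"
proof -
  have "spectral_norm A = onorm (\<lambda>v. (A - A') *v v + A' *v v)"
    by (simp add: spectral_norm_def matrix_vector_mult_diff_rdistrib)
  also have "\<dots> \<le> spectral_norm (A - A') + spectral_norm A'"
    unfolding spectral_norm_def by (intro onorm_triangle) simp_all
  finally show ?thesis using spectral_norm_le_norm[of "A - A'"] by simp
qed

lemma continuous_spectral_norm: "continuous_on UNIV (spectral_norm :: real^'n^'m \<Rightarrow> real)"
proof (rule lipschitz_on_continuous_on[of 1], rule lipschitz_onI)
  fix A A' :: "real^'n^'m"
  show "dist (spectral_norm A) (spectral_norm A') \<le> 1 * dist A A'"
    using spectral_norm_diff_le[of A A'] spectral_norm_diff_le[of A' A]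
    by (auto simp: dist_norm norm_minus_commute)
qed simp

text \<open>
  The supremum that defines \<open>spectral_opnorm\<close> is taken over a bounded set because the spectral norm is at
  most the Frobenius norm.
\<close>

lemma norm_apply_le_spectral_opnorm:
  "norm (blinfun_apply D h *v x) \<le> spectral_opnorm D * norm h * norm x"
proof -
  have "spectral_norm (blinfun_apply D h) \<le> spectral_opnorm D * norm h"
  proof (cases "h = 0")
    case True
    then show ?thesis by (simp add: spectral_norm_def onorm_zero blinfun.zero_right)
  next
    case False
    have "bdd_above (range (\<lambda>h. spectral_norm (blinfun_apply D h) / norm h))"
    proof (rule bdd_aboveI2)
      fix h
      have "spectral_norm (blinfun_apply D h) \<le> norm D * norm h"
        using spectral_norm_le_norm norm_blinfun by (rule order_trans)
      then show "spectral_norm (blinfun_apply D h) / norm h \<le> norm D"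
        by (cases "h = 0") (simp_all add: divide_le_eq)
    qed
    then have "spectral_norm (blinfun_apply D h) / norm h \<le> spectral_opnorm D"
      unfolding spectral_opnorm_def by (rule cSUP_upper[OF UNIV_I])
    then show ?thesis using False by (simp add: divide_le_eq)
  qed
  then show ?thesis
    using norm_mult_le_spectral_norm[of "blinfun_apply D h" x]
    by (meson mult_right_mono norm_ge_zero order_trans)
qed

lemma inner_transpose: "(transpose A *v x) \<bullet> y = x \<bullet> (A *v y)" for A :: "real^'n^'m"
  using dot_lmul_matrix[of x A y] by (simp add: transpose_matrix_vector)

text \<open>
  Operator bounds are kept in the form \<open>norm (A *v w) \<le> c * norm w\<close>; they pass to the transpose by evaluating
  \<open>v \<bullet> (A *v w)\<close> at \<open>w = transpose A *v v\<close>.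
\<close>

lemma norm_transpose_mult_le:
  fixes A :: "real^'n^'m"
  assumes A: "\<And>w. norm (A *v w) \<le> c * norm w"
  shows "norm (transpose A *v v) \<le> c * norm v"
proof (cases "transpose A *v v = 0")
  case True
  have "0 \<le> c"
    using order_trans[OF norm_ge_zero A[of "axis undefined 1"]] by simp
  then show ?thesis using True by simp
next
  case False
  let ?w = "transpose A *v v"
  have "norm ?w * norm ?w = v \<bullet> (A *v ?w)"
    by (simp add: inner_transpose[symmetric] power2_norm_eq_inner[symmetric] power2_eq_square)
  also have "\<dots> \<le> norm v * norm (A *v ?w)" by (rule norm_cauchy_schwarz)
  also have "\<dots> \<le> norm v * (c * norm ?w)" by (intro mult_left_mono A) simp
  finally have "norm ?w * norm ?w \<le> (c * norm v) * norm ?w" by (simp add: mult_ac)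
  then show ?thesis using False by simp
qed

text \<open>
  First variation: moving a minimiser of \<open>w \<bullet> A w - l (w \<bullet> w)\<close> against the residual \<open>r = A v - l v\<close> by a small
  step would make the nonnegative form negative unless \<open>r = 0\<close>.
\<close>

lemma rayleigh_minimizer_is_eigenvector:
  fixes A :: "real^'n^'n"
  assumes sym: "\<And>v w. (A *v v) \<bullet> w = v \<bullet> (A *v w)"
    and min: "\<And>w. l * (w \<bullet> w) \<le> w \<bullet> (A *v w)" and v: "v \<bullet> (A *v v) = l * (v \<bullet> v)"
  shows "A *v v = l *\<^sub>R v"
proof (rule ccontr)
  define r where "r = A *v v - l *\<^sub>R v"
  define q where "q = r \<bullet> (A *v r) - l * (r \<bullet> r)"
  assume "A *v v \<noteq> l *\<^sub>R v"
  then have r: "r \<bullet> r > 0" by (simp add: r_def)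
  have q: "q \<ge> 0" using min[of r] by (simp add: q_def)
  have expand: "0 \<le> s * s * q - 2 * s * (r \<bullet> r)" for s
  proof -
    let ?w = "v - s *\<^sub>R r"
    have vr: "v \<bullet> (A *v r) = (A *v v) \<bullet> r" by (rule sym[symmetric])
    have rv: "r \<bullet> (A *v v) = (A *v v) \<bullet> r" "r \<bullet> v = v \<bullet> r" by (rule inner_commute)+
    have "?w \<bullet> (A *v ?w) = v \<bullet> (A *v v) - 2 * s * ((A *v v) \<bullet> r) + s * s * (r \<bullet> (A *v r))"
      unfolding matrix_vector_mult_diff_distrib matrix_vector_mult_scaleR inner_diff_left inner_diff_right
        inner_scaleR_left inner_scaleR_right vr rv by algebra
    moreover have "?w \<bullet> ?w = v \<bullet> v - 2 * s * (v \<bullet> r) + s * s * (r \<bullet> r)"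
      unfolding inner_diff_left inner_diff_right inner_scaleR_left inner_scaleR_right rv by algebra
    ultimately have "?w \<bullet> (A *v ?w) - l * (?w \<bullet> ?w) = s * s * q - 2 * s * ((A *v v - l *\<^sub>R v) \<bullet> r)"
      unfolding q_def v inner_diff_left inner_scaleR_left by algebra
    then show ?thesis using min[of ?w] by (simp add: r_def)
  qed
  \<comment> \<open>The step \<open>s = r \<bullet> r / (q + 1)\<close> is short enough for the linear term to dominate.\<close>
  have e1: "0 \<le> (r \<bullet> r / (q + 1)) * ((r \<bullet> r / (q + 1)) * q - 2 * (r \<bullet> r))"
    using expand[of "r \<bullet> r / (q + 1)"] by (simp only: algebra_simps)
  have "(r \<bullet> r / (q + 1)) * q \<le> r \<bullet> r"
    using q r by (simp add: divide_le_eq algebra_simps)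
  then have e2: "(r \<bullet> r / (q + 1)) * q - 2 * (r \<bullet> r) < 0" using r by linarith
  have e3: "r \<bullet> r / (q + 1) > 0" using q r by simp
  show False using e1 mult_pos_neg[OF e3 e2] by linarith
qed

text \<open>
  Eigenvectors of distinct eigenvalues are orthogonal, hence linearly independent.
\<close>

lemma finite_eigenvalues_symmetric:
  fixes A :: "real^'n^'n"
  assumes sym: "\<And>v w. (A *v v) \<bullet> w = v \<bullet> (A *v w)"
  shows "finite (eigenvalues A)"
proof -
  define e where "e l = (SOME v. v \<noteq> 0 \<and> A *v v = l *\<^sub>R v)" for l
  have e: "e l \<noteq> 0" "A *v e l = l *\<^sub>R e l" if "l \<in> eigenvalues A" for l
    using someI_ex[of "\<lambda>v. v \<noteq> 0 \<and> A *v v = l *\<^sub>R v"] that by (auto simp: eigenvalues_def e_def)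
  have orth: "e l \<bullet> e m = 0" if "l \<in> eigenvalues A" "m \<in> eigenvalues A" "l \<noteq> m" for l m
    using sym[of "e l" "e m"] e[OF that(1)] e[OF that(2)] that(3) by simp
  have inj: "inj_on e (eigenvalues A)"
  proof (rule inj_onI, rule ccontr)
    fix l m assume "l \<in> eigenvalues A" "m \<in> eigenvalues A" "e l = e m" "l \<noteq> m"
    then show False using orth[of l m] e(1)[of m] by simp
  qed
  have "independent (e ` eigenvalues A)"
  proof (rule pairwise_orthogonal_independent)
    show "pairwise orthogonal (e ` eigenvalues A)"
      using orth by (auto simp: pairwise_def orthogonal_def)
    show "0 \<notin> e ` eigenvalues A" using e(1) by force
  qed
  then have "finite (e ` eigenvalues A)" by (rule independent_imp_finite)
  then show ?thesis using inj by (rule finite_imageD)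
qed

text \<open>
  Compactness of the unit sphere provides a minimiser of the quadratic form; its value is an eigenvalue and
  is at most any other eigenvalue.
\<close>

lemma lambda_min_rayleigh:
  fixes A :: "real^'n^'n"
  assumes sym: "\<And>v w. (A *v v) \<bullet> w = v \<bullet> (A *v w)"
  shows "lambda_min A * (w \<bullet> w) \<le> w \<bullet> (A *v w)"
    and "\<exists>v. norm v = 1 \<and> v \<bullet> (A *v v) = lambda_min A"
proof -
  have "continuous_on (sphere 0 1) (\<lambda>v. v \<bullet> (A *v v))"
    by (intro continuous_intros linear_continuous_on) simp
  moreover have "sphere (0 :: real^'n) 1 \<noteq> {}" by simp
  ultimately obtain v where v: "norm v = 1" and vmin: "\<And>w. norm w = 1 \<Longrightarrow> v \<bullet> (A *v v) \<le> w \<bullet> (A *v w)"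
    using continuous_attains_inf[OF compact_sphere, of 0 1 "\<lambda>v. v \<bullet> (A *v v)"] by auto
  let ?l = "v \<bullet> (A *v v)"
  have min: "?l * (w \<bullet> w) \<le> w \<bullet> (A *v w)" for w
  proof (cases "w = 0")
    case False
    then have w: "w = norm w *\<^sub>R sgn w" by (simp add: sgn_div_norm)
    have "w \<bullet> (A *v w) = norm w * norm w * (sgn w \<bullet> (A *v sgn w))"
      by (subst w, subst (2) w) (simp add: matrix_vector_mult_scaleR)
    moreover have "?l \<le> sgn w \<bullet> (A *v sgn w)" using False by (intro vmin) (simp add: norm_sgn)
    ultimately show ?thesis
      by (simp add: power2_norm_eq_inner[symmetric] power2_eq_square mult.commute mult_left_mono)
  qed simp
  have vv: "v \<bullet> v = 1" using v by (simp add: norm_eq_1)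
  then have "A *v v = ?l *\<^sub>R v"
    by (intro rayleigh_minimizer_is_eigenvector[OF sym min]) simp
  then have l: "?l \<in> eigenvalues A" using vv by (auto simp: eigenvalues_def intro!: exI[of _ v])
  have "?l \<le> m" if m: "m \<in> eigenvalues A" for m
  proof -
    obtain z where z: "z \<noteq> 0" "A *v z = m *\<^sub>R z" using m by (auto simp: eigenvalues_def)
    then show ?thesis using min[of z] by simp
  qed
  then have "lambda_min A = ?l"
    unfolding lambda_min_def using l finite_eigenvalues_symmetric[OF sym] by (intro Min_eqI) auto
  then show "lambda_min A * (w \<bullet> w) \<le> w \<bullet> (A *v w)"
    and "\<exists>v. norm v = 1 \<and> v \<bullet> (A *v v) = lambda_min A"
    using min v by auto
qed

text \<open>
  Test the quadratic form of \<open>A\<close> with a unit minimiser for \<open>A'\<close>.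
\<close>

lemma lambda_min_perturbation:
  fixes A A' :: "real^'n^'n"
  assumes "\<And>v w. (A *v v) \<bullet> w = v \<bullet> (A *v w)" "\<And>v w. (A' *v v) \<bullet> w = v \<bullet> (A' *v w)"
    and le: "\<And>v. norm v = 1 \<Longrightarrow> v \<bullet> (A *v v) - v \<bullet> (A' *v v) \<le> K"
  shows "lambda_min A - K \<le> lambda_min A'"
proof -
  obtain v where v: "norm v = 1" "v \<bullet> (A' *v v) = lambda_min A'"
    using lambda_min_rayleigh(2)[OF assms(2)] by blast
  have "v \<bullet> v = 1" using v(1) by (simp add: norm_eq_1)
  then show ?thesis using lambda_min_rayleigh(1)[OF assms(1), of v] le[OF v(1)] v(2) by simp
qed

lemma lambda_min_pos_iff_invertible:
  fixes A :: "real^'n^'n"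
  assumes sym: "\<And>v w. (A *v v) \<bullet> w = v \<bullet> (A *v w)" and psd: "\<And>w. 0 \<le> w \<bullet> (A *v w)"
  shows "0 < lambda_min A \<longleftrightarrow> invertible A"
proof
  assume pos: "0 < lambda_min A"
  have "w = 0" if "A *v w = 0" for w
  proof (rule ccontr)
    assume "w \<noteq> 0"
    then have "0 < lambda_min A * (w \<bullet> w)" using pos by simp
    then show False using lambda_min_rayleigh(1)[OF sym, of w] that by simp
  qed
  then show "invertible A" by (auto simp: invertible_left_inverse matrix_left_invertible_ker)
next
  assume inv: "invertible A"
  obtain v where v: "norm v = 1" "v \<bullet> (A *v v) = lambda_min A"
    using lambda_min_rayleigh(2)[OF sym] by blast
  have vv: "v \<bullet> v = 1" using v(1) by (simp add: norm_eq_1)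
  have ge: "0 \<le> lambda_min A" using v(2) psd[of v] by simp
  have "lambda_min A \<noteq> 0"
  proof
    assume 0: "lambda_min A = 0"
    have "A *v v = lambda_min A *\<^sub>R v"
      by (rule rayleigh_minimizer_is_eigenvector[OF sym lambda_min_rayleigh(1)[OF sym]]) (simp add: v vv)
    then have "A *v v = 0" using 0 by simp
    then have "v = 0" using inv by (auto simp: invertible_left_inverse matrix_left_invertible_ker)
    then show False using v(1) by simp
  qed
  then show "0 < lambda_min A" using ge by simp
qed

lemma pinv_right_inverse:
  fixes A :: "real^'n^'n"
  assumes "invertible A"
  shows "A ** pinv A = mat 1"
proof -
  obtain X where X: "A ** X = mat 1" "X ** A = mat 1" using assms unfolding invertible_def by blast
  have "is_pinv A X" by (simp add: is_pinv_def X transpose_mat)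
  moreover have "Y = X" if "is_pinv A Y" for Y
  proof -
    have "A ** Y ** A = A" using that by (simp add: is_pinv_def)
    then have "X ** (A ** Y ** A) ** X = X ** A ** X" by simp
    moreover have "X ** (A ** Y ** A) ** X = (X ** A) ** Y ** (A ** X)" by (simp only: matrix_mul_assoc)
    ultimately show "Y = X" by (simp add: X)
  qed
  ultimately have "pinv A = X" unfolding pinv_def by (rule the_equality)
  then show ?thesis using X by simp
qed

text \<open>
  With \<open>z = pinv A *v y\<close>, Rayleigh's principle gives \<open>|z|^2 / C \<le> z \<bullet> A z = z \<bullet> y\<close>.
\<close>

lemma norm_pinv_mult_le:
  fixes A :: "real^'n^'n"
  assumes sym: "\<And>v w. (A *v v) \<bullet> w = v \<bullet> (A *v w)" and psd: "\<And>w. 0 \<le> w \<bullet> (A *v w)"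
    and C: "C > 0" "inverse C \<le> lambda_min A"
  shows "norm (pinv A *v y) \<le> C * norm y"
proof -
  define z where "z = pinv A *v y"
  have "0 < inverse C" using C(1) by simp
  then have "0 < lambda_min A" using C(2) by linarith
  then have "invertible A" using lambda_min_pos_iff_invertible[OF sym psd] by simp
  then have Az: "A *v z = y" by (simp add: z_def matrix_vector_mul_assoc pinv_right_inverse)
  have "inverse C * (z \<bullet> z) \<le> lambda_min A * (z \<bullet> z)" using C by (intro mult_right_mono) auto
  also have "\<dots> \<le> z \<bullet> y" using lambda_min_rayleigh(1)[OF sym, of z] by (simp add: Az)
  also have "\<dots> \<le> norm z * norm y" by (rule norm_cauchy_schwarz)
  finally have "norm z * norm z \<le> norm z * (C * norm y)"
    using C(1) by (simp add: power2_norm_eq_inner[symmetric] power2_eq_square field_simps)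
  then have "norm z \<le> C * norm y"
    by (cases "norm z = 0") (use C in auto)
  then show ?thesis by (simp add: z_def)
qed

lemma borel_measurable_vecI:
  fixes f :: "'a \<Rightarrow> ('b::euclidean_space)^'n"
  assumes "\<And>i. (\<lambda>t. f t $ i) \<in> borel_measurable M"
  shows "f \<in> borel_measurable M"
proof (subst borel_measurable_euclidean_space, intro ballI)
  fix b :: "'b^'n" assume "b \<in> Basis"
  then obtain i u where b: "b = axis i u" by (auto simp: Basis_vec_def)
  show "(\<lambda>t. f t \<bullet> b) \<in> borel_measurable M"
    unfolding b inner_axis by (intro borel_measurable_inner assms borel_measurable_const)
qed

lemma borel_measurable_matrixI:
  fixes A :: "'a \<Rightarrow> real^'n^'m"
  assumes A: "\<And>v. (\<lambda>t. A t *v v) \<in> borel_measurable M"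
  shows "A \<in> borel_measurable M"
proof -
  have "(\<lambda>t. A t $ i $ j) \<in> borel_measurable M" for i j
  proof -
    have "(\<lambda>t. (A t *v axis j 1) \<bullet> axis i 1) \<in> borel_measurable M"
      by (intro borel_measurable_inner A borel_measurable_const)
    then show ?thesis by (simp add: inner_axis matrix_vector_mult_basis column_def)
  qed
  then show ?thesis by (intro borel_measurable_vecI)
qed

section \<open>Essential suprema and measurability\<close>

lemma AE_le_ess_sup:
  assumes g: "g \<in> borel_measurable M" and bd: "AE x in M. g x \<le> c"
  shows "AE x in M. g x \<le> ess_sup M g"
proof -
  let ?s = "esssup M (\<lambda>x. ereal (g x))"
  have ae: "AE x in M. ereal (g x) \<le> ?s" by (rule esssup_AE)
  have le: "?s \<le> ereal c" using g bd by (intro esssup_I) simp_all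
  show ?thesis
  proof (cases ?s)
    case (real r)
    then show ?thesis using ae by (simp add: ess_sup_def)
  qed (use ae le in auto)
qed

lemma ess_sup_nonneg:
  assumes g: "\<And>x. 0 \<le> g x"
  shows "0 \<le> ess_sup M g"
proof (cases "(\<lambda>x. ereal (g x)) \<in> borel_measurable M")
  case True
  let ?s = "esssup M (\<lambda>x. ereal (g x))"
  show ?thesis
  proof (cases ?s)
    case (real r)
    have "0 \<le> r"
    proof (rule ccontr)
      assume r: "\<not> 0 \<le> r"
      have "AE x in M. ereal (g x) \<le> ereal r" using esssup_AE[of "\<lambda>x. ereal (g x)" M] real by simp
      then have "AE x in M. ereal (g x) \<le> ereal (r - 1)"
      proof (rule AE_mp, intro AE_I2 impI)
        fix x assume "ereal (g x) \<le> ereal r"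
        then show "ereal (g x) \<le> ereal (r - 1)" using g[of x] r by simp
      qed
      then have "?s \<le> ereal (r - 1)" by (rule esssup_I[OF True])
      then show False using real by simp
    qed
    then show ?thesis using real by (simp add: ess_sup_def)
  qed (simp_all add: ess_sup_def)
next
  case False
  then show ?thesis by (simp add: ess_sup_def esssup_non_measurable top_ereal_def)
qed

text \<open>
  Fubini for null sets, in both orders of the variables. The second order is obtained on the complement of a
  Borel null set, where exchanging the quantifiers is a statement about a measurable set.
\<close>

lemma AE_lebesgue_on_slices:
  fixes S :: "real set" and P :: "real \<times> 'a::euclidean_space \<Rightarrow> bool"
  assumes S: "open S" and P: "AE z in lebesgue_on (S \<times> UNIV). P z"
  shows "AE t in lborel. AE x in lborel. t \<in> S \<longrightarrow> P (t, x)"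
    and "AE x in lborel. AE t in lborel. t \<in> S \<longrightarrow> P (t, x)"
proof -
  have "S \<times> (UNIV :: 'a set) \<in> sets lebesgue" using S by (simp add: open_Times)
  then have "AE z in lebesgue. z \<in> S \<times> UNIV \<longrightarrow> P z"
    using P by (simp add: AE_restrict_space_iff)
  then have "AE z in lborel. z \<in> S \<times> UNIV \<longrightarrow> P z" by (simp add: AE_completion_iff)
  then have "AE z in lborel \<Otimes>\<^sub>M lborel. z \<in> S \<times> UNIV \<longrightarrow> P z" unfolding lborel_prod .
  then obtain N where N: "N \<in> null_sets (lborel \<Otimes>\<^sub>M lborel)"
    "{z \<in> space (lborel \<Otimes>\<^sub>M lborel). \<not> (z \<in> S \<times> UNIV \<longrightarrow> P z)} \<subseteq> N"
    unfolding eventually_ae_filter by blast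
  have PN: "t \<in> S \<longrightarrow> P (t, x)" if "(t, x) \<notin> N" for t x
    using N(2) that by (auto simp: space_pair_measure)
  have "AE z in lborel \<Otimes>\<^sub>M lborel. z \<notin> N" using N(1) by (rule AE_not_in)
  then have 1: "AE t in lborel. AE x in lborel. (t, x) \<notin> N" by (rule lborel_pair.AE_pair)
  have meas: "{z \<in> space (lborel \<Otimes>\<^sub>M lborel). (fst z, snd z) \<notin> N} \<in> sets (lborel \<Otimes>\<^sub>M lborel)"
  proof -
    have "{z \<in> space (lborel \<Otimes>\<^sub>M lborel). (fst z, snd z) \<notin> N} = space (lborel \<Otimes>\<^sub>M lborel) - N" by auto
    then show ?thesis using sets.compl_sets[OF null_setsD2[OF N(1)]] by (simp only:)
  qed
  have 2: "AE x in lborel. AE t in lborel. (t, x) \<notin> N"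
    using 1 lborel_pair.AE_commute[OF meas] by simp
  from 1 show "AE t in lborel. AE x in lborel. t \<in> S \<longrightarrow> P (t, x)"
    by (elim eventually_mono) (use PN in blast)
  from 2 show "AE x in lborel. AE t in lborel. t \<in> S \<longrightarrow> P (t, x)"
    by (elim eventually_mono) (use PN in blast)
qed

text \<open>
  For almost every point \<open>y\<close> the slice \<open>t \<mapsto> b (t, y)\<close> agrees almost everywhere with a Borel function, so
  measurable slices exist for a dense set of points. Choose a countable dense set \<open>Q\<close> among them and
  replace \<open>x t\<close> by the first point of \<open>Q\<close> within distance \<open>1 / (n + 1)\<close>: this gives measurable functions that converge
  to \<open>t \<mapsto> b (t, x t)\<close> by continuity in the second variable.
\<close>

lemma caratheodory_measurable:
  fixes b :: "real \<times> 'a::euclidean_space \<Rightarrow> real" and x :: "real \<Rightarrow> 'a"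
  assumes S: "open S" and b: "b \<in> borel_measurable (lebesgue_on (S \<times> UNIV))"
    and cont: "\<And>t. t \<in> S \<Longrightarrow> continuous_on UNIV (\<lambda>x. b (t, x))"
    and x: "x \<in> borel_measurable (lebesgue_on S)"
  shows "(\<lambda>t. b (t, x t)) \<in> borel_measurable (lebesgue_on S)"
proof -
  have SU: "S \<times> (UNIV :: 'a set) \<in> sets lebesgue" using S by (simp add: open_Times)
  have SL: "S \<in> sets lebesgue" using S by simp
  have "(\<lambda>z. if z \<in> S \<times> UNIV then b z else 0) \<in> borel_measurable (completion lborel)"
    using b borel_measurable_if[OF SU, of b] by simp
  from completion_ex_borel_measurable_real[OF this]
  obtain g where g: "g \<in> borel_measurable lborel"
    and gb: "AE z in lborel. (if z \<in> S \<times> UNIV then b z else 0) = g z" by blast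
  have "AE z in lebesgue. (if z \<in> S \<times> UNIV then b z else 0) = g z"
    using gb by (rule AE_completion)
  then have "AE z in lebesgue_on (S \<times> UNIV). b z = g z"
    using SU by (auto simp: AE_restrict_space_iff elim: eventually_mono)
  from AE_lebesgue_on_slices(2)[OF S this]
  have good: "AE y in lborel. AE t in lborel. t \<in> S \<longrightarrow> b (t, y) = g (t, y)" .
  define D where "D = {y. AE t in lborel. t \<in> S \<longrightarrow> b (t, y) = g (t, y)}"
  have D_meas: "(\<lambda>t. b (t, y)) \<in> borel_measurable (lebesgue_on S)" if "y \<in> D" for y
  proof -
    have "(\<lambda>t. g (t, y)) \<in> borel_measurable borel"
      using g by (intro measurable_compose[of "\<lambda>t. (t, y)" borel borel g borel]) (simp_all add: borel_prod[symmetric])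
    then have "(\<lambda>t. g (t, y)) \<in> borel_measurable lebesgue"
      by (intro measurable_completion) simp
    then have 1: "(\<lambda>t. if t \<in> S then g (t, y) else 0) \<in> borel_measurable lebesgue"
      by (intro borel_measurable_if_I SL measurable_restrict_space1)
    have "AE t in lebesgue. t \<in> S \<longrightarrow> b (t, y) = g (t, y)"
      using that unfolding D_def by (intro AE_completion) simp
    then have "AE t in lebesgue. (if t \<in> S then g (t, y) else 0) = (if t \<in> S then b (t, y) else 0)"
      by (elim eventually_mono) simp
    from borel_measurable_AE[OF 1 this] show ?thesis
      using borel_measurable_if[OF SL, of "\<lambda>t. b (t, y)"] by simp
  qed
  have "AE y in lebesgue. y \<in> closure D"
    using good by (intro AE_completion) (auto simp: D_def elim!: eventually_mono intro: subsetD[OF closure_subset])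
  then have D_dense: "y \<in> closure D" for y by (intro mem_closed_if_AE_lebesgue) auto
  obtain Q where Q: "countable Q" "Q \<subseteq> D" "D \<subseteq> closure Q" by (rule separable)
  have "closure D \<subseteq> closure Q" using Q(3) by (simp add: closure_minimal)
  then have Q_dense: "y \<in> closure Q" for y using D_dense by blast
  then have "Q \<noteq> {}" by auto
  define q where "q = from_nat_into Q"
  have q: "q m \<in> D" for m using Q(2) from_nat_into[OF \<open>Q \<noteq> {}\<close>] by (auto simp: q_def)
  have close: "\<exists>m. dist (q m) y < e" if e: "e > 0" for y e
  proof -
    obtain z where "z \<in> Q" "dist z y < e" using Q_dense[of y] e by (auto simp: closure_approachable)
    then show ?thesis using from_nat_into_surj[OF Q(1)] by (auto simp: q_def)
  qed
  define k where "k n t = (LEAST m. dist (q m) (x t) < 1 / real (Suc n))" for n t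
  have k: "dist (q (k n t)) (x t) < 1 / real (Suc n)" for n t
    unfolding k_def by (rule LeastI_ex) (rule close, simp)
  have k_meas: "k n \<in> measurable (lebesgue_on S) (count_space UNIV)" for n
    unfolding k_def
  proof (rule measurable_Least)
    fix m
    have "(\<lambda>t. dist (q m) (x t)) \<in> borel_measurable (lebesgue_on S)"
      using x by (intro borel_measurable_dist) simp_all
    then show "Measurable.pred (lebesgue_on S) (\<lambda>t. dist (q m) (x t) < 1 / real (Suc n))"
      by measurable
  qed
  show ?thesis
  proof (rule borel_measurable_LIMSEQ_metric)
    fix n
    show "(\<lambda>t. b (t, q (k n t))) \<in> borel_measurable (lebesgue_on S)"
      by (rule measurable_compose_countable[OF D_meas[OF q] k_meas])
  next
    fix t assume "t \<in> space (lebesgue_on S)"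
    then have t: "t \<in> S" by simp
    have "(\<lambda>n. dist (q (k n t)) (x t)) \<longlonglongrightarrow> 0"
    proof (rule tendsto_sandwich[OF _ _ tendsto_const])
      show "\<forall>\<^sub>F n in sequentially. 0 \<le> dist (q (k n t)) (x t)" by simp
      show "\<forall>\<^sub>F n in sequentially. dist (q (k n t)) (x t) \<le> inverse (real (Suc n))"
        using k by (intro always_eventually allI) (simp add: inverse_eq_divide less_imp_le)
      show "(\<lambda>n. inverse (real (Suc n))) \<longlonglongrightarrow> 0" by (rule LIMSEQ_inverse_real_of_nat)
    qed
    then have lim: "(\<lambda>n. q (k n t)) \<longlonglongrightarrow> x t" by (rule iffD2[OF tendsto_dist_iff])
    show "(\<lambda>n. b (t, q (k n t))) \<longlonglongrightarrow> b (t, x t)"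
      by (rule continuous_on_tendsto_compose[OF cont[OF t] lim]) simp_all
  qed
qed

lemma borel_measurable_vec_component:
  fixes f :: "'a \<Rightarrow> ('b::real_normed_vector)^'n"
  assumes "f \<in> borel_measurable M"
  shows "(\<lambda>t. f t $ i) \<in> borel_measurable M"
  by (rule measurable_compose[OF assms]) (intro borel_measurable_continuous_onI continuous_intros)

lemma borel_measurable_matrix_mult:
  fixes A :: "'a \<Rightarrow> real^'n^'m" and A' :: "'a \<Rightarrow> real^'p^'n"
  assumes "A \<in> borel_measurable M" "A' \<in> borel_measurable M"
  shows "(\<lambda>t. A t ** A' t) \<in> borel_measurable M"
proof (intro borel_measurable_vecI)
  fix i j
  have "(\<lambda>t. \<Sum>k\<in>UNIV. A t $ i $ k * A' t $ k $ j) \<in> borel_measurable M"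
    using assms by (intro borel_measurable_sum borel_measurable_times borel_measurable_vec_component)
  then show "(\<lambda>t. (A t ** A' t) $ i $ j) \<in> borel_measurable M" by (simp add: matrix_matrix_mult_def)
qed

lemma borel_measurable_transpose:
  fixes A :: "'a \<Rightarrow> real^'n^'m"
  assumes "A \<in> borel_measurable M"
  shows "(\<lambda>t. transpose (A t)) \<in> borel_measurable M"
proof (intro borel_measurable_vecI)
  fix i j
  show "(\<lambda>t. transpose (A t) $ i $ j) \<in> borel_measurable M"
    using assms by (simp add: transpose_def borel_measurable_vec_component)
qed

lemma bounded_linear_matrix_vector_mult_left:
  "bounded_linear (\<lambda>A :: real^'n^'m. A *v v)"
proof (rule bounded_linear_intro[where K = "norm v"])
  show "(r *\<^sub>R A) *v v = r *\<^sub>R (A *v v)" for r and A :: "real^'n^'m"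
    by (simp add: matrix_vector_mult_def vec_eq_iff sum_distrib_left mult.assoc)
qed (simp_all add: matrix_vector_mult_add_rdistrib norm_matrix_vector_mult_le)

lemma borel_measurable_matrix_vector_mult:
  fixes A :: "'a \<Rightarrow> real^'n^'m"
  assumes "A \<in> borel_measurable M"
  shows "(\<lambda>t. A t *v v) \<in> borel_measurable M"
  by (rule measurable_compose[OF assms])
    (intro borel_measurable_continuous_onI linear_continuous_on bounded_linear_matrix_vector_mult_left)

section \<open>The explicit Lipschitz constants\<close>

lemma exp_quot_mult_diff: "(a - b) * exp_quot \<Delta> a b = exp (a * \<Delta>) - exp (b * \<Delta>)"
  by (simp add: exp_quot_def)

lemma exp_quot_shift: "exp (c * \<Delta>) * exp_quot \<Delta> a b = exp_quot \<Delta> (a + c) (b + c)"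
  by (simp add: exp_quot_def right_diff_distrib exp_add[symmetric] algebra_simps)

lemma exp_mult_quotient:
  assumes "c = a - b" "c \<noteq> 0" "a' = a + d" "b' = b + d"
  shows "exp (d * \<Delta>) * ((exp (a * \<Delta>) - exp (b * \<Delta>)) / c) = exp_quot \<Delta> a' b'"
  using assms exp_quot_shift[of d \<Delta> a b] by (auto simp: exp_quot_def)

lemma exp_quot_commute: "exp_quot \<Delta> a b = exp_quot \<Delta> b a"
  by (auto simp: exp_quot_def divide_simps) (simp add: algebra_simps)

text \<open>
  Every quotient in the explicit constants is an integral of this kind, which also covers the degenerate
  quotients without a case distinction later on.
\<close>

lemma exp_quot_has_integral:
  assumes "t0 \<le> T"
  shows "((\<lambda>t. exp (a * (T - t) + b * (t - t0))) has_integral exp_quot (T - t0) a b) {t0..T}"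
proof (cases "a = b")
  case True
  have "((\<lambda>t. exp (a * (T - t0))) has_integral ((T - t0) * exp (a * (T - t0)))) {t0..T}"
    using has_integral_const_real[of "exp (a * (T - t0))" t0 T] assms by simp
  moreover have "a * (T - t) + b * (t - t0) = a * (T - t0)" for t using True by (simp add: algebra_simps)
  ultimately show ?thesis using True by (simp add: exp_quot_def)
next
  case False
  define c where "c = 1 / (b - a)"
  define F where "F t = exp (a * (T - t) + b * (t - t0)) * c" for t
  have c: "(b - a) * c = 1" using False by (simp add: c_def)
  have "((\<lambda>t. exp (a * (T - t) + b * (t - t0))) has_integral (F T - F t0)) {t0..T}"
  proof (rule fundamental_theorem_of_calculus[OF assms])
    fix t
    have "(F has_real_derivative exp (a * (T - t) + b * (t - t0)) * ((b - a) * c)) (at t within {t0..T})"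
      unfolding F_def by (auto intro!: derivative_eq_intros simp: algebra_simps)
    then show "(F has_vector_derivative exp (a * (T - t) + b * (t - t0))) (at t within {t0..T})"
      by (simp add: c has_real_derivative_iff_has_vector_derivative)
  qed
  moreover have "F T - F t0 = exp_quot (T - t0) a b"
    using False by (simp add: F_def c_def exp_quot_def divide_simps) (simp add: algebra_simps)
  ultimately show ?thesis by simp
qed

lemma exp_quot_nonneg:
  assumes "0 \<le> \<Delta>"
  shows "0 \<le> exp_quot \<Delta> a b"
  using has_integral_nonneg[OF exp_quot_has_integral[of 0 \<Delta> a b]] assms by simp

text \<open>
  The time integral of the pointwise Lipschitz rate of the Gramian integrand, for target time \<open>t0\<close>, and below
  for target time \<open>T\<close>; here \<open>\<mu> = \<Lambda>1 + LB * \<zeta>\<close> is the growth rate of trajectory differences.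
\<close>

definition lip_integral1 :: "real \<Rightarrow> real \<Rightarrow> real \<Rightarrow> real \<Rightarrow> real \<Rightarrow> real \<Rightarrow> real" where
  "lip_integral1 \<Lambda>1 \<Lambda>2 LB \<beta> \<Delta> \<mu> =
     2 * LB * \<beta>^2 / \<mu> * (exp_quot \<Delta> (2 * \<Lambda>1 + \<mu>) 0 - exp_quot \<Delta> (2 * \<Lambda>1) 0)
   + 2 * \<beta>^3 * \<Lambda>2 / (\<Lambda>1 * \<mu>) * (exp_quot \<Delta> (3 * \<Lambda>1 + \<mu>) 0 - exp_quot \<Delta> (2 * \<Lambda>1 + \<mu>) 0
       + exp_quot \<Delta> (2 * \<Lambda>1) 0 - exp_quot \<Delta> (3 * \<Lambda>1) 0)"

definition lip_integral2 :: "real \<Rightarrow> real \<Rightarrow> real \<Rightarrow> real \<Rightarrow> real \<Rightarrow> real \<Rightarrow> real" where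
  "lip_integral2 \<Lambda>1 \<Lambda>2 LB \<beta> \<Delta> \<mu> =
     2 * LB * \<beta>^2 / \<mu> * (exp_quot \<Delta> (2 * \<Lambda>1) \<mu> - exp_quot \<Delta> (2 * \<Lambda>1) 0)
   + 2 * \<beta>^3 * \<Lambda>2 / (\<Lambda>1 * \<mu>) * (exp_quot \<Delta> (3 * \<Lambda>1) \<mu> - exp_quot \<Delta> (2 * \<Lambda>1) \<mu>
       + exp_quot \<Delta> (2 * \<Lambda>1) 0 - exp_quot \<Delta> (3 * \<Lambda>1) 0)"

text \<open>
  After absorbing the prefactor \<open>exp (\<Lambda>1 * \<Delta>)\<close>, the brackets multiplied by \<open>\<Lambda>2\<close> agree. The two terms with \<open>LB\<close> differ
  by \<open>2 * LB * \<beta>^2 * P / \<Lambda>1\<close> with \<open>P = exp_quot \<Delta> (2 * \<Lambda>1 + \<mu>) 0 \<ge> 0\<close>.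
\<close>

lemma lip_integral1_le_lip1:
  assumes \<Lambda>1: "\<Lambda>1 > 0" and LB: "LB \<ge> 0" and \<zeta>: "\<zeta> \<ge> 0" and \<Delta>: "\<Delta> \<ge> 0" and \<mu>: "\<mu> = \<Lambda>1 + LB * \<zeta>"
  shows "lip_integral1 \<Lambda>1 \<Lambda>2 LB \<beta> \<Delta> \<mu> \<le> lip1 \<Lambda>1 \<Lambda>2 LB \<beta> \<Delta> \<zeta>"
proof -
  have LZ: "0 \<le> LB * \<zeta>" using LB \<zeta> by simp
  then have \<mu>0: "\<mu> > 0" using \<Lambda>1 \<mu> by simp
  have LZ\<mu>: "LB * \<zeta> = \<mu> - \<Lambda>1" using \<mu> by simp
  have e1: "exp (\<Lambda>1 * \<Delta>) * ((exp ((2 * \<Lambda>1 + LB * \<zeta>) * \<Delta>) - exp (\<Lambda>1 * \<Delta>)) / (\<Lambda>1 + LB * \<zeta>)) = exp_quot \<Delta> (2 * \<Lambda>1 + \<mu>) (2 * \<Lambda>1)"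
    by (rule exp_mult_quotient) (use \<Lambda>1 LZ \<mu> in auto)
  have e2: "exp (\<Lambda>1 * \<Delta>) * ((exp ((2 * \<Lambda>1 + LB * \<zeta>) * \<Delta>) - exp (- \<Lambda>1 * \<Delta>)) / (LB * \<zeta> + 3 * \<Lambda>1)) = exp_quot \<Delta> (2 * \<Lambda>1 + \<mu>) 0"
    by (rule exp_mult_quotient) (use \<Lambda>1 LZ \<mu> in auto)
  have e3: "exp (\<Lambda>1 * \<Delta>) * ((exp ((3 * \<Lambda>1 + LB * \<zeta>) * \<Delta>) - exp (- \<Lambda>1 * \<Delta>)) / (4 * \<Lambda>1 + LB * \<zeta>)) = exp_quot \<Delta> (3 * \<Lambda>1 + \<mu>) 0"
    by (rule exp_mult_quotient) (use \<Lambda>1 LZ \<mu> in auto)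
  have e4: "exp (\<Lambda>1 * \<Delta>) * ((exp ((2 * \<Lambda>1 + LB * \<zeta>) * \<Delta>) - exp (- \<Lambda>1 * \<Delta>)) / (3 * \<Lambda>1 + LB * \<zeta>)) = exp_quot \<Delta> (2 * \<Lambda>1 + \<mu>) 0"
    by (rule exp_mult_quotient) (use \<Lambda>1 LZ \<mu> in auto)
  have e5: "exp (\<Lambda>1 * \<Delta>) * ((exp (\<Lambda>1 * \<Delta>) - exp (- \<Lambda>1 * \<Delta>)) / (2 * \<Lambda>1)) = exp_quot \<Delta> (2 * \<Lambda>1) 0"
    by (rule exp_mult_quotient) (use \<Lambda>1 LZ \<mu> in auto)
  have e6: "exp (\<Lambda>1 * \<Delta>) * ((exp (2 * \<Lambda>1 * \<Delta>) - exp (- \<Lambda>1 * \<Delta>)) / (3 * \<Lambda>1)) = exp_quot \<Delta> (3 * \<Lambda>1) 0"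
    by (rule exp_mult_quotient) (use \<Lambda>1 LZ \<mu> in auto)
  define P where "P = exp_quot \<Delta> (2 * \<Lambda>1 + \<mu>) 0"
  define Q where "Q = exp_quot \<Delta> (2 * \<Lambda>1) 0"
  define R where "R = exp_quot \<Delta> (2 * \<Lambda>1 + \<mu>) (2 * \<Lambda>1)"
  have P: "P \<ge> 0" unfolding P_def by (rule exp_quot_nonneg[OF \<Delta>])
  have "\<mu> * R = (2 * \<Lambda>1 + \<mu>) * P - 2 * \<Lambda>1 * Q"
    using exp_quot_mult_diff[of "2 * \<Lambda>1 + \<mu>" 0 \<Delta>] exp_quot_mult_diff[of "2 * \<Lambda>1" 0 \<Delta>]
      exp_quot_mult_diff[of "2 * \<Lambda>1 + \<mu>" "2 * \<Lambda>1" \<Delta>] by (simp add: P_def Q_def R_def)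
  then have R: "R = ((2 * \<Lambda>1 + \<mu>) * P - 2 * \<Lambda>1 * Q) / \<mu>" using \<mu>0 by (simp add: field_simps)
  have "(R + P) / \<Lambda>1 - 2 / \<mu> * (P - Q) = 2 * P / \<Lambda>1"
    unfolding R using \<mu>0 \<Lambda>1 by (simp add: field_simps)
  moreover have "0 \<le> 2 * P / \<Lambda>1" using P \<Lambda>1 by simp
  ultimately have key: "2 / \<mu> * (P - Q) \<le> (R + P) / \<Lambda>1" by linarith
  have "lip1 \<Lambda>1 \<Lambda>2 LB \<beta> \<Delta> \<zeta> = LB * \<beta>^2 * ((R + P) / \<Lambda>1)
      + 2 * \<beta>^3 * \<Lambda>2 / (\<Lambda>1 * \<mu>) * (exp_quot \<Delta> (3 * \<Lambda>1 + \<mu>) 0 - P + Q - exp_quot \<Delta> (3 * \<Lambda>1) 0)"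
  proof -
    define E where "E = exp (\<Lambda>1 * \<Delta>)"
    have "lip1 \<Lambda>1 \<Lambda>2 LB \<beta> \<Delta> \<zeta> = LB * \<beta>^2 / \<Lambda>1 *
       (E * ((exp ((2 * \<Lambda>1 + LB * \<zeta>) * \<Delta>) - exp (\<Lambda>1 * \<Delta>)) / (\<Lambda>1 + LB * \<zeta>))
        + E * ((exp ((2 * \<Lambda>1 + LB * \<zeta>) * \<Delta>) - exp (- \<Lambda>1 * \<Delta>)) / (LB * \<zeta> + 3 * \<Lambda>1)))
      + 2 * \<beta>^3 * \<Lambda>2 / (\<Lambda>1 * (\<Lambda>1 + LB * \<zeta>)) *
       (E * ((exp ((3 * \<Lambda>1 + LB * \<zeta>) * \<Delta>) - exp (- \<Lambda>1 * \<Delta>)) / (4 * \<Lambda>1 + LB * \<zeta>))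
        - E * ((exp ((2 * \<Lambda>1 + LB * \<zeta>) * \<Delta>) - exp (- \<Lambda>1 * \<Delta>)) / (3 * \<Lambda>1 + LB * \<zeta>))
        + E * ((exp (\<Lambda>1 * \<Delta>) - exp (- \<Lambda>1 * \<Delta>)) / (2 * \<Lambda>1))
        - E * ((exp (2 * \<Lambda>1 * \<Delta>) - exp (- \<Lambda>1 * \<Delta>)) / (3 * \<Lambda>1)))"
      unfolding lip1_def E_def right_diff_distrib[symmetric] distrib_left[symmetric] by simp
    then show ?thesis unfolding E_def e1 e2 e3 e4 e5 e6 by (simp add: \<mu> P_def Q_def R_def)
  qed
  moreover have "LB * \<beta>^2 * (2 / \<mu> * (P - Q)) \<le> LB * \<beta>^2 * ((R + P) / \<Lambda>1)"
    using LB by (intro mult_left_mono key) simp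
  moreover have "lip_integral1 \<Lambda>1 \<Lambda>2 LB \<beta> \<Delta> \<mu> = LB * \<beta>^2 * (2 / \<mu> * (P - Q))
      + 2 * \<beta>^3 * \<Lambda>2 / (\<Lambda>1 * \<mu>) * (exp_quot \<Delta> (3 * \<Lambda>1 + \<mu>) 0 - P + Q - exp_quot \<Delta> (3 * \<Lambda>1) 0)"
    unfolding lip_integral1_def P_def Q_def by simp
  ultimately show ?thesis by linarith
qed

text \<open>
  Here the terms with \<open>LB\<close> agree, which is integration by parts in the guise of \<open>exp_quot_mult_diff\<close>. The brackets
  with \<open>\<Lambda>2\<close> differ by \<open>2 * P\<close> with \<open>P = exp_quot \<Delta> (2 * \<Lambda>1) \<mu> \<ge> 0\<close>, a term that enters them with opposite signs.
\<close>

lemma lip_integral2_le_lip2: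
  assumes \<Lambda>1: "\<Lambda>1 > 0" and \<Lambda>2: "\<Lambda>2 \<ge> 0" and \<beta>: "\<beta> \<ge> 0" and LB: "LB \<ge> 0" and \<zeta>: "\<zeta> \<ge> 0"
    and \<Delta>: "\<Delta> \<ge> 0" and \<mu>: "\<mu> = \<Lambda>1 + LB * \<zeta>"
  shows "lip_integral2 \<Lambda>1 \<Lambda>2 LB \<beta> \<Delta> \<mu> \<le> lip2 \<Lambda>1 \<Lambda>2 LB \<beta> \<Delta> \<zeta>"
proof -
  have LZ: "0 \<le> LB * \<zeta>" using LB \<zeta> by simp
  then have \<mu>0: "\<mu> > 0" using \<Lambda>1 \<mu> by simp
  define P where "P = exp_quot \<Delta> (2 * \<Lambda>1) \<mu>"
  define Q where "Q = exp_quot \<Delta> (2 * \<Lambda>1) 0"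
  define R where "R = exp_quot \<Delta> \<mu> 0"
  define S where "S = exp_quot \<Delta> (3 * \<Lambda>1) \<mu>"
  define U where "U = exp_quot \<Delta> (3 * \<Lambda>1) 0"
  have e1: "exp (\<Lambda>1 * \<Delta>) * exp_quot \<Delta> \<Lambda>1 (LB * \<zeta>) = P"
    unfolding exp_quot_shift P_def by (simp add: \<mu> add.commute)
  have e2: "exp (\<Lambda>1 * \<Delta>) * ((exp (LB * \<zeta> * \<Delta>) - exp (- \<Lambda>1 * \<Delta>)) / (LB * \<zeta> + \<Lambda>1)) = R"
    unfolding R_def by (rule exp_mult_quotient) (use \<Lambda>1 LZ \<mu> in auto)
  have e3: "exp (\<Lambda>1 * \<Delta>) * exp_quot \<Delta> (2 * \<Lambda>1) (LB * \<zeta>) = S"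
    unfolding exp_quot_shift S_def by (simp add: \<mu> add.commute)
  have e5: "exp (\<Lambda>1 * \<Delta>) * ((exp (\<Lambda>1 * \<Delta>) - exp (- \<Lambda>1 * \<Delta>)) / (2 * \<Lambda>1)) = Q"
    unfolding Q_def by (rule exp_mult_quotient) (use \<Lambda>1 LZ \<mu> in auto)
  have e6: "exp (\<Lambda>1 * \<Delta>) * ((exp (2 * \<Lambda>1 * \<Delta>) - exp (- \<Lambda>1 * \<Delta>)) / (3 * \<Lambda>1)) = U"
    unfolding U_def by (rule exp_mult_quotient) (use \<Lambda>1 LZ \<mu> in auto)
  have P: "P \<ge> 0" unfolding P_def by (rule exp_quot_nonneg[OF \<Delta>])
  have "2 * \<Lambda>1 * (P - Q) = \<mu> * (P - R)"
    using exp_quot_mult_diff[of "2 * \<Lambda>1" \<mu> \<Delta>] exp_quot_mult_diff[of "2 * \<Lambda>1" 0 \<Delta>]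
      exp_quot_mult_diff[of \<mu> 0 \<Delta>] unfolding P_def Q_def R_def by (simp add: algebra_simps)
  then have key: "2 / \<mu> * (P - Q) = (P - R) / \<Lambda>1"
    using \<mu>0 \<Lambda>1 by (simp add: field_simps)
  have "lip2 \<Lambda>1 \<Lambda>2 LB \<beta> \<Delta> \<zeta> = LB * \<beta>^2 * ((P - R) / \<Lambda>1)
      + 2 * \<beta>^3 * \<Lambda>2 / (\<Lambda>1 * \<mu>) * (S + P + Q - U)"
  proof -
    define E where "E = exp (\<Lambda>1 * \<Delta>)"
    have "lip2 \<Lambda>1 \<Lambda>2 LB \<beta> \<Delta> \<zeta> = LB * \<beta>^2 / \<Lambda>1 *
       (E * exp_quot \<Delta> \<Lambda>1 (LB * \<zeta>) - E * ((exp (LB * \<zeta> * \<Delta>) - exp (- \<Lambda>1 * \<Delta>)) / (LB * \<zeta> + \<Lambda>1)))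
      + 2 * \<beta>^3 * \<Lambda>2 / (\<Lambda>1 * (\<Lambda>1 + LB * \<zeta>)) *
       (E * exp_quot \<Delta> (2 * \<Lambda>1) (LB * \<zeta>) + E * exp_quot \<Delta> \<Lambda>1 (LB * \<zeta>)
        + E * ((exp (\<Lambda>1 * \<Delta>) - exp (- \<Lambda>1 * \<Delta>)) / (2 * \<Lambda>1))
        - E * ((exp (2 * \<Lambda>1 * \<Delta>) - exp (- \<Lambda>1 * \<Delta>)) / (3 * \<Lambda>1)))"
      unfolding lip2_def E_def right_diff_distrib[symmetric] distrib_left[symmetric] by simp
    then show ?thesis unfolding E_def e1 e2 e3 e5 e6 \<mu> by simp
  qed
  moreover have "0 \<le> 2 * \<beta>^3 * \<Lambda>2 / (\<Lambda>1 * \<mu>) * (2 * P)"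
    using \<beta> \<Lambda>2 \<Lambda>1 \<mu>0 P by simp
  moreover have "lip_integral2 \<Lambda>1 \<Lambda>2 LB \<beta> \<Delta> \<mu> = LB * \<beta>^2 * (2 / \<mu> * (P - Q))
      + 2 * \<beta>^3 * \<Lambda>2 / (\<Lambda>1 * \<mu>) * (S - P + Q - U)"
    unfolding lip_integral2_def P_def Q_def S_def U_def by simp
  moreover have "2 * \<beta>^3 * \<Lambda>2 / (\<Lambda>1 * \<mu>) * (S + P + Q - U)
      = 2 * \<beta>^3 * \<Lambda>2 / (\<Lambda>1 * \<mu>) * (S - P + Q - U) + 2 * \<beta>^3 * \<Lambda>2 / (\<Lambda>1 * \<mu>) * (2 * P)"
    unfolding distrib_left[symmetric] by simp
  ultimately show ?thesis unfolding key by linarith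
qed

section \<open>The controllability Gramian along trajectories\<close>

lemma norm_matrix_le:
  fixes A :: "real^'n^'m"
  assumes A: "\<And>w. norm (A *v w) \<le> c * norm w"
  shows "norm A \<le> real CARD('m) * (real CARD('n) * c)"
proof -
  have entry: "\<bar>A $ i $ j\<bar> \<le> c" for i j
  proof -
    have "\<bar>A $ i $ j\<bar> = \<bar>(A *v axis j 1) $ i\<bar>" by (simp add: matrix_vector_mult_basis column_def)
    also have "\<dots> \<le> norm (A *v axis j 1)" by (rule component_le_norm_cart)
    also have "\<dots> \<le> c" using A[of "axis j 1"] by simp
    finally show ?thesis .
  qed
  have "norm A \<le> (\<Sum>i\<in>UNIV. norm (A $ i))"
    unfolding norm_vec_def by (rule L2_set_le_sum) simp
  also have "\<dots> \<le> (\<Sum>i\<in>UNIV. \<Sum>j\<in>UNIV. \<bar>A $ i $ j\<bar>)"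
    by (intro sum_mono norm_le_l1_cart)
  also have "\<dots> \<le> (\<Sum>i\<in>(UNIV :: 'm set). \<Sum>j\<in>(UNIV :: 'n set). c)"
    by (intro sum_mono entry)
  finally show ?thesis by simp
qed

text \<open>
  The control matrix enters through a Lipschitz constant in space and a bound that holds for almost every time
  and, by continuity, for all points at once.
\<close>

locale controlled_flow = flow_with_bounds t0 T \<Lambda>1 \<Lambda>2 N \<Phi>
  for t0 T \<Lambda>1 \<Lambda>2 and N :: "real \<Rightarrow> real^'d \<Rightarrow> real^'d" and \<Phi> +
  fixes B :: "real \<Rightarrow> real^'d \<Rightarrow> real^'k^'d" and LB \<beta> :: real
  assumes time: "t0 < T" and LB: "LB \<ge> 0" and \<beta>: "\<beta> \<ge> 0"
    and B_measurable: "(\<lambda>(t, x). B t x) \<in> borel_measurable (lebesgue_on ({t0<..<T} \<times> UNIV))"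
    and B_continuous: "\<And>t. t \<in> {t0<..<T} \<Longrightarrow> continuous_on UNIV (B t)"
    and B_lipschitz: "\<And>t x y w. t \<in> {t0<..<T} \<Longrightarrow>
      norm (B t x *v w - B t y *v w) \<le> LB * norm (x - y) * norm w"
    and B_bound: "AE t in lebesgue_on {t0<..<T}. \<forall>x w. norm (B t x *v w) \<le> \<beta> * norm w"
begin

text \<open>
  The Lipschitz rate of the Gramian integrand at a time that lies \<open>s\<close> after \<open>t0\<close> and has distance \<open>r\<close> to the target
  time: twice the bound on the factor \<open>ctrl\<close>, times its Lipschitz constant in the state, times the growth of the
  state difference per unit of control difference.
\<close>

definition rate :: "real \<Rightarrow> real \<Rightarrow> real \<Rightarrow> real" where
  "rate \<mu> s r = 2 * (exp (\<Lambda>1 * r) * \<beta>) * ((growth r * \<beta> + exp (\<Lambda>1 * r) * LB) * (\<beta> * (exp (\<mu> * s) - 1) / \<mu>))"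

lemma rate_expand:
  assumes "\<mu> > 0"
  shows "rate \<mu> s r = 2 * LB * \<beta>^2 / \<mu> * (exp (2 * \<Lambda>1 * r + \<mu> * s) - exp (2 * \<Lambda>1 * r))
     + 2 * \<beta>^3 * \<Lambda>2 / (\<Lambda>1 * \<mu>) * (exp (3 * \<Lambda>1 * r + \<mu> * s) - exp (2 * \<Lambda>1 * r + \<mu> * s)
       + exp (2 * \<Lambda>1 * r) - exp (3 * \<Lambda>1 * r))"
proof -
  define E where "E = exp (\<Lambda>1 * r)"
  define M where "M = exp (\<mu> * s)"
  have E2: "exp (2 * \<Lambda>1 * r) = E ^ 2" and E3: "exp (3 * \<Lambda>1 * r) = E ^ 3"
    unfolding E_def by (simp_all add: exp_of_nat_mult[symmetric] mult_ac)
  have "rate \<mu> s r = 2 * (E * \<beta>) * ((\<Lambda>2 / \<Lambda>1 * (E^2 - E) * \<beta> + E * LB) * (\<beta> * (M - 1) / \<mu>))"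
    unfolding rate_def growth_def E2 E_def[symmetric] M_def[symmetric] ..
  also have "\<dots> = 2 * LB * \<beta>^2 / \<mu> * (E^2 * M - E^2)
     + 2 * \<beta>^3 * \<Lambda>2 / (\<Lambda>1 * \<mu>) * (E^3 * M - E^2 * M + E^2 - E^3)"
    using assms \<Lambda>1 by (simp add: divide_simps) (simp add: algebra_simps power2_eq_square power3_eq_cube)
  finally show ?thesis unfolding exp_add E2 E3 M_def .
qed

lemma rate_integral_initial:
  assumes \<mu>: "\<mu> > 0"
  shows "((\<lambda>t. rate \<mu> (t - t0) \<bar>t0 - t\<bar>) has_integral lip_integral1 \<Lambda>1 \<Lambda>2 LB \<beta> (T - t0) \<mu>) {t0..T}"
proof -
  have e: "((\<lambda>t. exp (c * (t - t0))) has_integral exp_quot (T - t0) c 0) {t0..T}" for c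
    using exp_quot_has_integral[of t0 T 0 c] time by (simp add: exp_quot_commute)
  have "((\<lambda>t. 2 * LB * \<beta>^2 / \<mu> * (exp ((2 * \<Lambda>1 + \<mu>) * (t - t0)) - exp (2 * \<Lambda>1 * (t - t0)))
     + 2 * \<beta>^3 * \<Lambda>2 / (\<Lambda>1 * \<mu>) * (exp ((3 * \<Lambda>1 + \<mu>) * (t - t0)) - exp ((2 * \<Lambda>1 + \<mu>) * (t - t0))
       + exp (2 * \<Lambda>1 * (t - t0)) - exp (3 * \<Lambda>1 * (t - t0))))
     has_integral lip_integral1 \<Lambda>1 \<Lambda>2 LB \<beta> (T - t0) \<mu>) {t0..T}"
    unfolding lip_integral1_def
    by (intro has_integral_add has_integral_diff has_integral_mult_right e)
  then show ?thesis
    by (rule has_integral_eq[rotated]) (simp add: rate_expand[OF \<mu>] distrib_right)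
qed

lemma rate_integral_final:
  assumes \<mu>: "\<mu> > 0"
  shows "((\<lambda>t. rate \<mu> (t - t0) \<bar>T - t\<bar>) has_integral lip_integral2 \<Lambda>1 \<Lambda>2 LB \<beta> (T - t0) \<mu>) {t0..T}"
proof -
  have e: "((\<lambda>t. exp (a * (T - t) + c * (t - t0))) has_integral exp_quot (T - t0) a c) {t0..T}" for a c
    using time by (intro exp_quot_has_integral) simp
  have e0: "((\<lambda>t. exp (a * (T - t))) has_integral exp_quot (T - t0) a 0) {t0..T}" for a
    using e[of a 0] by simp
  have "((\<lambda>t. 2 * LB * \<beta>^2 / \<mu> * (exp (2 * \<Lambda>1 * (T - t) + \<mu> * (t - t0)) - exp (2 * \<Lambda>1 * (T - t)))
     + 2 * \<beta>^3 * \<Lambda>2 / (\<Lambda>1 * \<mu>) * (exp (3 * \<Lambda>1 * (T - t) + \<mu> * (t - t0)) - exp (2 * \<Lambda>1 * (T - t) + \<mu> * (t - t0))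
       + exp (2 * \<Lambda>1 * (T - t)) - exp (3 * \<Lambda>1 * (T - t))))
     has_integral lip_integral2 \<Lambda>1 \<Lambda>2 LB \<beta> (T - t0) \<mu>) {t0..T}"
    unfolding lip_integral2_def
    by (intro has_integral_add has_integral_diff has_integral_mult_right e e0)
  then show ?thesis
    by (rule has_integral_eq[rotated]) (simp add: rate_expand[OF \<mu>])
qed

lemma trajectory_abs_continuous:
  "is_trajectory t0 T N B x0 u x \<Longrightarrow> abs_continuous_on t0 T x"
  by (simp add: is_trajectory_def solves_ae_def)

text \<open>
  Gronwall's inequality for the splitting
  \<open>(N z - N x) + (B z - B x) v + B x (v - u)\<close> of the difference of the right-hand sides; it uses the size of \<open>v\<close> only.
\<close>

lemma trajectory_diff_le:
  assumes x: "is_trajectory t0 T N B x0 u x" and z: "is_trajectory t0 T N B x0 v z"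
    and v: "AE t in lebesgue_on {t0<..<T}. norm (v t) \<le> \<zeta>"
    and vu: "AE t in lebesgue_on {t0<..<T}. norm (v t - u t) \<le> \<delta>"
    and \<zeta>: "0 \<le> \<zeta>" and \<delta>: "0 \<le> \<delta>" and \<mu>: "\<mu> = \<Lambda>1 + LB * \<zeta>" and t: "t \<in> {t0..T}"
  shows "norm (z t - x t) \<le> \<beta> * (exp (\<mu> * (t - t0)) - 1) / \<mu> * \<delta>"
proof -
  have \<mu>0: "\<mu> > 0" using \<mu> \<Lambda>1 LB \<zeta> by (simp add: add_pos_nonneg)
  have "AE t in lebesgue_on {t0<..<T}.
      (x has_vector_derivative (N t (x t) + B t (x t) *v u t)) (at t)
    \<and> (z has_vector_derivative (N t (z t) + B t (z t) *v v t)) (at t)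
    \<and> norm (v t) \<le> \<zeta> \<and> norm (v t - u t) \<le> \<delta> \<and> (\<forall>y w. norm (B t y *v w) \<le> \<beta> * norm w)"
    using x z v vu B_bound by (simp add: is_trajectory_def solves_ae_def)
  then obtain E where E: "negligible E" and good: "\<And>t. t \<in> {t0<..<T} - E \<Longrightarrow>
      (x has_vector_derivative (N t (x t) + B t (x t) *v u t)) (at t)
    \<and> (z has_vector_derivative (N t (z t) + B t (z t) *v v t)) (at t)
    \<and> norm (v t) \<le> \<zeta> \<and> norm (v t - u t) \<le> \<delta> \<and> (\<forall>y w. norm (B t y *v w) \<le> \<beta> * norm w)"
    by (rule AE_lebesgue_on_negligibleE) (simp, rule that)
  have "norm (z t - x t) \<le> (\<lambda>r. \<beta> * (exp (\<mu> * r) - 1) / \<mu> * \<delta>) \<bar>t - t0\<bar>"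
  proof (rule gronwall_two_sided[OF _ E _ _ t, where M = \<mu> and \<beta> = "\<lambda>_. \<beta> * \<delta>"])
    show "abs_continuous_on t0 T (\<lambda>t. z t - x t)"
      by (intro abs_continuous_on_diff trajectory_abs_continuous[OF x] trajectory_abs_continuous[OF z])
    show "0 \<le> \<mu>" using \<mu>0 by simp
    show "t0 \<in> {t0..T}" using time by simp
    show "0 \<le> \<beta> * \<delta>" using \<beta> \<delta> by simp
    show "norm (z t0 - x t0) \<le> \<beta> * (exp (\<mu> * 0) - 1) / \<mu> * \<delta>"
      using x z by (simp add: is_trajectory_def)
    show "((\<lambda>r. \<beta> * (exp (\<mu> * r) - 1) / \<mu> * \<delta>) has_real_derivative
        \<mu> * (\<beta> * (exp (\<mu> * r) - 1) / \<mu> * \<delta>) + \<beta> * \<delta>) (at r)" for r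
      using \<mu>0 by (auto intro!: derivative_eq_intros simp: field_simps)
  next
    fix r assume r: "r \<in> {t0<..<T} - E"
    then have r': "r \<in> {t0<..<T}" and r'': "r \<in> {t0..T}" by auto
    note g = good[OF r]
    let ?D = "N r (z r) + B r (z r) *v v r - (N r (x r) + B r (x r) *v u r)"
    show "\<exists>D. ((\<lambda>t. z t - x t) has_vector_derivative D) (at r) \<and> norm D \<le> \<mu> * norm (z r - x r) + \<beta> * \<delta>"
    proof (intro exI[of _ ?D] conjI)
      show "((\<lambda>t. z t - x t) has_vector_derivative ?D) (at r)"
        using g by (intro has_vector_derivative_diff) blast+
      have D: "?D = (N r (z r) - N r (x r)) + ((B r (z r) *v v r - B r (x r) *v v r) + B r (x r) *v (v r - u r))"
        by (simp add: matrix_vector_mult_diff_distrib)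
      have n1: "norm (N r (z r) - N r (x r)) \<le> \<Lambda>1 * norm (z r - x r)" by (rule N_lipschitz[OF r''])
      have "norm (B r (z r) *v v r - B r (x r) *v v r) \<le> LB * norm (z r - x r) * norm (v r)"
        by (rule B_lipschitz[OF r'])
      also have "\<dots> \<le> LB * norm (z r - x r) * \<zeta>" using g LB by (intro mult_left_mono) simp_all
      finally have n2: "norm (B r (z r) *v v r - B r (x r) *v v r) \<le> LB * norm (z r - x r) * \<zeta>" .
      have "norm (B r (x r) *v (v r - u r)) \<le> \<beta> * norm (v r - u r)" using g by blast
      also have "\<dots> \<le> \<beta> * \<delta>" using g \<beta> by (intro mult_left_mono) simp_all
      finally have n3: "norm (B r (x r) *v (v r - u r)) \<le> \<beta> * \<delta>" .
      have "norm ?D \<le> \<Lambda>1 * norm (z r - x r) + (LB * norm (z r - x r) * \<zeta> + \<beta> * \<delta>)"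
        by (subst D, rule order_trans[OF norm_triangle_ineq add_mono[OF n1 order_trans[OF norm_triangle_ineq add_mono[OF n2 n3]]]])
      then show "norm ?D \<le> \<mu> * norm (z r - x r) + \<beta> * \<delta>" by (simp add: \<mu> algebra_simps)
    qed
  qed simp
  then show ?thesis using t by simp
qed

text \<open>
  The first-order effect of the control at time \<open>t\<close> on the state transported to time \<open>\<tau>\<close> by the uncontrolled flow.
\<close>

definition ctrl :: "real \<Rightarrow> (real \<Rightarrow> real^'d) \<Rightarrow> real \<Rightarrow> real^'k^'d" where
  "ctrl \<tau> z t = jacobian (\<Phi> t \<tau>) (at (z t)) ** B t (z t)"

definition gramian :: "real \<Rightarrow> (real \<Rightarrow> real^'d) \<Rightarrow> real^'d^'d" where
  "gramian \<tau> z = (LINT t|lebesgue_on {t0<..<T}. ctrl \<tau> z t ** transpose (ctrl \<tau> z t))"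

lemma gram_eq: "gram t0 T \<Phi> B X \<tau> u = gramian \<tau> (X u)"
  unfolding gram_def gramian_def ctrl_def by (simp add: matrix_transpose_mul matrix_mul_assoc)

lemma ctrl_le:
  assumes "\<tau> \<in> {t0..T}" "t \<in> {t0<..<T}" and Bt: "\<And>x w. norm (B t x *v w) \<le> \<beta> * norm w"
  shows "norm (ctrl \<tau> z t *v w) \<le> exp (\<Lambda>1 * \<bar>\<tau> - t\<bar>) * \<beta> * norm w"
proof -
  have t: "t \<in> {t0..T}" using assms by auto
  have "norm (ctrl \<tau> z t *v w) \<le> exp (\<Lambda>1 * \<bar>\<tau> - t\<bar>) * norm (B t (z t) *v w)"
    unfolding ctrl_def matrix_vector_mul_assoc[symmetric] by (rule flow_jacobian_le[OF t assms(1)])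
  also have "\<dots> \<le> exp (\<Lambda>1 * \<bar>\<tau> - t\<bar>) * (\<beta> * norm w)" by (intro mult_left_mono Bt) simp
  finally show ?thesis by (simp add: mult.assoc)
qed

lemma ctrl_diff_le:
  assumes \<tau>: "\<tau> \<in> {t0..T}" and t: "t \<in> {t0<..<T}" and Bt: "\<And>x w. norm (B t x *v w) \<le> \<beta> * norm w"
  shows "norm ((ctrl \<tau> z t - ctrl \<tau> x t) *v w)
      \<le> (growth \<bar>\<tau> - t\<bar> * \<beta> + exp (\<Lambda>1 * \<bar>\<tau> - t\<bar>) * LB) * norm (z t - x t) * norm w"
proof -
  have t': "t \<in> {t0..T}" using t by auto
  let ?J = "\<lambda>z. jacobian (\<Phi> t \<tau>) (at (z t))" and ?B = "\<lambda>z. B t (z t)"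
  have split: "(ctrl \<tau> z t - ctrl \<tau> x t) *v w = (?J z *v (?B z *v w) - ?J x *v (?B z *v w)) + ?J x *v (?B z *v w - ?B x *v w)"
    by (simp add: ctrl_def matrix_vector_mult_diff_rdistrib matrix_vector_mult_diff_distrib matrix_vector_mul_assoc)
  have "norm (?J z *v (?B z *v w) - ?J x *v (?B z *v w)) \<le> growth \<bar>\<tau> - t\<bar> * norm (z t - x t) * norm (?B z *v w)"
    by (rule flow_jacobian_diff_le[OF t' \<tau>])
  also have "\<dots> \<le> growth \<bar>\<tau> - t\<bar> * norm (z t - x t) * (\<beta> * norm w)"
    by (intro mult_left_mono Bt mult_nonneg_nonneg growth_nonneg) simp_all
  finally have n1: "norm (?J z *v (?B z *v w) - ?J x *v (?B z *v w)) \<le> growth \<bar>\<tau> - t\<bar> * norm (z t - x t) * (\<beta> * norm w)" .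
  have "norm (?J x *v (?B z *v w - ?B x *v w)) \<le> exp (\<Lambda>1 * \<bar>\<tau> - t\<bar>) * norm (?B z *v w - ?B x *v w)"
    by (rule flow_jacobian_le[OF t' \<tau>])
  also have "\<dots> \<le> exp (\<Lambda>1 * \<bar>\<tau> - t\<bar>) * (LB * norm (z t - x t) * norm w)"
    by (intro mult_left_mono B_lipschitz[OF t]) simp
  finally have n2: "norm (?J x *v (?B z *v w - ?B x *v w)) \<le> exp (\<Lambda>1 * \<bar>\<tau> - t\<bar>) * (LB * norm (z t - x t) * norm w)" .
  show ?thesis
    unfolding split by (rule order_trans[OF norm_triangle_ineq order_trans[OF add_mono[OF n1 n2]]]) (simp add: algebra_simps)
qed

lemma B_along_measurable:
  assumes z: "continuous_on {t0..T} z"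
  shows "(\<lambda>t. B t (z t)) \<in> borel_measurable (lebesgue_on {t0<..<T})"
proof (intro borel_measurable_vecI)
  fix i j
  have "(\<lambda>p. (\<lambda>(t, x). B t x) p $ i $ j) \<in> borel_measurable (lebesgue_on ({t0<..<T} \<times> UNIV))"
    by (intro borel_measurable_vec_component B_measurable)
  moreover have "z \<in> borel_measurable (lebesgue_on {t0<..<T})"
    by (rule continuous_imp_measurable_on_sets_lebesgue[OF continuous_on_subset[OF z]]) auto
  moreover have "continuous_on UNIV (\<lambda>x. (\<lambda>(t, x). B t x) (t, x) $ i $ j)" if "t \<in> {t0<..<T}" for t
    using B_continuous[OF that] by (auto intro!: continuous_intros)
  ultimately show "(\<lambda>t. B t (z t) $ i $ j) \<in> borel_measurable (lebesgue_on {t0<..<T})"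
    using caratheodory_measurable[of "{t0<..<T}" "\<lambda>p. (\<lambda>(t, x). B t x) p $ i $ j" z] by simp
qed

text \<open>
  The flow derivative applied to a vector is a limit of difference quotients, each of which is continuous in time by
  \<open>flow_start_continuous\<close>.
\<close>

lemma jacobian_along_measurable:
  assumes z: "continuous_on {t0..T} z" and \<tau>: "\<tau> \<in> {t0..T}"
  shows "(\<lambda>t. jacobian (\<Phi> t \<tau>) (at (z t))) \<in> borel_measurable (lebesgue_on {t0<..<T})"
proof (rule borel_measurable_matrixI, rule borel_measurable_LIMSEQ_metric)
  fix v n
  let ?q = "\<lambda>n t. real (Suc n) *\<^sub>R (\<Phi> t \<tau> (z t + (1 / real (Suc n)) *\<^sub>R v) - \<Phi> t \<tau> (z t))"
  have "continuous_on {t0..T} (?q n)"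
    by (intro continuous_intros flow_start_continuous z \<tau>)
  then show "?q n \<in> borel_measurable (lebesgue_on {t0<..<T})"
    by (rule continuous_imp_measurable_on_sets_lebesgue[OF continuous_on_subset]) auto
next
  fix v t assume "t \<in> space (lebesgue_on {t0<..<T})"
  then have "t \<in> {t0..T}" by simp
  then show "(\<lambda>n. real (Suc n) *\<^sub>R (\<Phi> t \<tau> (z t + (1 / real (Suc n)) *\<^sub>R v) - \<Phi> t \<tau> (z t)))
      \<longlonglongrightarrow> jacobian (\<Phi> t \<tau>) (at (z t)) *v v"
    by (intro difference_quotient_tendsto flow_has_derivative \<tau>)
qed

lemma ctrl_measurable:
  assumes "continuous_on {t0..T} z" "\<tau> \<in> {t0..T}"
  shows "ctrl \<tau> z \<in> borel_measurable (lebesgue_on {t0<..<T})"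
  unfolding ctrl_def
  by (intro borel_measurable_matrix_mult jacobian_along_measurable B_along_measurable assms)

lemma ctrl_uniform_bound:
  assumes "\<tau> \<in> {t0..T}"
  shows "AE t in lebesgue_on {t0<..<T}. \<forall>w. norm (ctrl \<tau> z t *v w) \<le> exp (\<Lambda>1 * (T - t0)) * \<beta> * norm w"
  using B_bound
proof (rule AE_mp, intro AE_I2 impI allI)
  fix t w assume t: "t \<in> space (lebesgue_on {t0<..<T})" and Bt: "\<forall>x w. norm (B t x *v w) \<le> \<beta> * norm w"
  have "norm (ctrl \<tau> z t *v w) \<le> exp (\<Lambda>1 * \<bar>\<tau> - t\<bar>) * \<beta> * norm w"
    using t Bt by (intro ctrl_le assms) simp_all
  also have "\<dots> \<le> exp (\<Lambda>1 * (T - t0)) * \<beta> * norm w"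
    using t assms \<Lambda>1 \<beta> by (intro mult_right_mono) auto
  finally show "norm (ctrl \<tau> z t *v w) \<le> exp (\<Lambda>1 * (T - t0)) * \<beta> * norm w" .
qed

lemma finite_measure_time: "finite_measure (lebesgue_on {t0<..<T})"
  by (rule finite_measure_lebesgue_on) simp

lemma gramian_integrable:
  assumes z: "continuous_on {t0..T} z" and \<tau>: "\<tau> \<in> {t0..T}"
  shows "integrable (lebesgue_on {t0<..<T}) (\<lambda>t. ctrl \<tau> z t ** transpose (ctrl \<tau> z t))"
proof -
  interpret finite_measure "lebesgue_on {t0<..<T}" by (rule finite_measure_time)
  define c where "c = exp (\<Lambda>1 * (T - t0)) * \<beta>"
  have c: "c \<ge> 0" using \<beta> by (simp add: c_def)
  show ?thesis
  proof (rule integrable_const_bound)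
    show "(\<lambda>t. ctrl \<tau> z t ** transpose (ctrl \<tau> z t)) \<in> borel_measurable (lebesgue_on {t0<..<T})"
      by (intro borel_measurable_matrix_mult borel_measurable_transpose ctrl_measurable assms)
    show "AE t in lebesgue_on {t0<..<T}. norm (ctrl \<tau> z t ** transpose (ctrl \<tau> z t))
        \<le> real CARD('d) * (real CARD('d) * (c * c))"
      using ctrl_uniform_bound[OF \<tau>, of z, folded c_def]
    proof (rule AE_mp, intro AE_I2 impI)
      fix t assume b: "\<forall>w. norm (ctrl \<tau> z t *v w) \<le> c * norm w"
      show "norm (ctrl \<tau> z t ** transpose (ctrl \<tau> z t)) \<le> real CARD('d) * (real CARD('d) * (c * c))"
      proof (rule norm_matrix_le)
        fix w
        have "norm (ctrl \<tau> z t *v (transpose (ctrl \<tau> z t) *v w)) \<le> c * norm (transpose (ctrl \<tau> z t) *v w)"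
          using b by blast
        also have "\<dots> \<le> c * (c * norm w)"
          using b c by (intro mult_left_mono norm_transpose_mult_le) simp_all
        finally show "norm ((ctrl \<tau> z t ** transpose (ctrl \<tau> z t)) *v w) \<le> c * c * norm w"
          by (simp only: matrix_vector_mul_assoc mult.assoc)
      qed
    qed
  qed
qed

text \<open>
  The quadratic form of a matrix is a bounded linear functional of the matrix, so that spectral
  estimates of the Gramian reduce to scalar integrals.
\<close>

lemma gramian_form:
  assumes z: "continuous_on {t0..T} z" and \<tau>: "\<tau> \<in> {t0..T}"
  shows "integrable (lebesgue_on {t0<..<T}) (\<lambda>t. (transpose (ctrl \<tau> z t) *v v) \<bullet> (transpose (ctrl \<tau> z t) *v w))"
    and "v \<bullet> (gramian \<tau> z *v w) = (LINT t|lebesgue_on {t0<..<T}. (transpose (ctrl \<tau> z t) *v v) \<bullet> (transpose (ctrl \<tau> z t) *v w))"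
proof -
  have bl: "bounded_linear (\<lambda>G :: real^'d^'d. v \<bullet> (G *v w))"
    by (rule bounded_linear_compose[OF bounded_linear_inner_right bounded_linear_matrix_vector_mult_left])
  have eq: "v \<bullet> ((ctrl \<tau> z t ** transpose (ctrl \<tau> z t)) *v w) = (transpose (ctrl \<tau> z t) *v v) \<bullet> (transpose (ctrl \<tau> z t) *v w)" for t
    unfolding matrix_vector_mul_assoc[symmetric] by (rule inner_transpose[symmetric])
  note int = gramian_integrable[OF z \<tau>]
  show "integrable (lebesgue_on {t0<..<T}) (\<lambda>t. (transpose (ctrl \<tau> z t) *v v) \<bullet> (transpose (ctrl \<tau> z t) *v w))"
    using integrable_bounded_linear[OF bl int] unfolding eq .
  show "v \<bullet> (gramian \<tau> z *v w) = (LINT t|lebesgue_on {t0<..<T}. (transpose (ctrl \<tau> z t) *v v) \<bullet> (transpose (ctrl \<tau> z t) *v w))"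
    using integral_bounded_linear[OF bl int] unfolding eq gramian_def by simp
qed

lemma gramian_symmetric:
  assumes "continuous_on {t0..T} z" "\<tau> \<in> {t0..T}"
  shows "(gramian \<tau> z *v v) \<bullet> w = v \<bullet> (gramian \<tau> z *v w)"
  unfolding inner_commute[of "gramian \<tau> z *v v" w] gramian_form(2)[OF assms] by (simp add: inner_commute)

lemma gramian_nonneg:
  assumes "continuous_on {t0..T} z" "\<tau> \<in> {t0..T}"
  shows "0 \<le> v \<bullet> (gramian \<tau> z *v v)"
  unfolding gramian_form(2)[OF assms] by (rule Bochner_Integration.integral_nonneg) simp

text \<open>
  With \<open>a\<close> and \<open>b\<close> the transposed factors applied to \<open>w\<close>, the integrands differ by
  \<open>|a|^2 - |b|^2 = (a + b) \<bullet> (a - b)\<close>; the first factor is bounded by twice the size of \<open>ctrl\<close>, the second by its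
  Lipschitz constant times the distance of the trajectories.
\<close>

lemma gramian_perturbation:
  assumes x: "is_trajectory t0 T N B x0 u x" and z: "is_trajectory t0 T N B x0 v z"
    and v: "AE t in lebesgue_on {t0<..<T}. norm (v t) \<le> \<zeta>"
    and vu: "AE t in lebesgue_on {t0<..<T}. norm (v t - u t) \<le> \<delta>"
    and \<zeta>: "0 \<le> \<zeta>" and \<delta>: "0 \<le> \<delta>" and \<mu>: "\<mu> = \<Lambda>1 + LB * \<zeta>" and \<tau>: "\<tau> \<in> {t0..T}"
    and K: "((\<lambda>t. rate \<mu> (t - t0) \<bar>\<tau> - t\<bar>) has_integral K) {t0..T}"
    and w: "norm w = 1"
  shows "w \<bullet> (gramian \<tau> x *v w) - w \<bullet> (gramian \<tau> z *v w) \<le> K * \<delta>"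
proof -
  have xc: "continuous_on {t0..T} x" and zc: "continuous_on {t0..T} z"
    using trajectory_abs_continuous[OF x] trajectory_abs_continuous[OF z]
    by (simp_all add: abs_continuous_on_imp_continuous_on)
  have \<mu>0: "\<mu> > 0" using \<mu> \<Lambda>1 LB \<zeta> by (simp add: add_pos_nonneg)
  let ?M = "lebesgue_on {t0<..<T}" and ?a = "\<lambda>t. transpose (ctrl \<tau> x t) *v w" and ?b = "\<lambda>t. transpose (ctrl \<tau> z t) *v w"
  let ?k = "\<lambda>t. rate \<mu> (t - t0) \<bar>\<tau> - t\<bar> * \<delta>"
  have kcont: "continuous_on {t0..T} ?k"
    unfolding rate_def growth_def using \<mu>0 by (intro continuous_intros) simp_all
  then have "bounded (?k ` {t0..T})" by (intro compact_imp_bounded compact_continuous_image) simp_all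
  then obtain c where "\<forall>y\<in>?k ` {t0..T}. norm y \<le> c" unfolding bounded_iff by blast
  then have c: "norm (?k t) \<le> c" if "t \<in> {t0..T}" for t using that by (intro bspec[of _ _ "?k t"]) auto
  interpret finite_measure ?M by (rule finite_measure_time)
  have kint: "integrable ?M ?k"
  proof (rule integrable_const_bound)
    show "AE t in ?M. norm (?k t) \<le> c" using c by (intro AE_I2) simp
    show "?k \<in> borel_measurable ?M"
      by (rule continuous_imp_measurable_on_sets_lebesgue[OF continuous_on_subset[OF kcont]]) auto
  qed
  have kval: "(LINT t|?M. ?k t) = K * \<delta>"
  proof -
    have "(LINT t|?M. ?k t) = integral {t0<..<T} ?k"
      by (rule lebesgue_integral_eq_integral[OF kint]) simp
    also have "\<dots> = integral {t0..T} ?k" by (rule integral_open_interval_real[symmetric])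
    also have "\<dots> = K * \<delta>" using has_integral_mult_left[OF K, of \<delta>] by (rule integral_unique)
    finally show ?thesis .
  qed
  have le: "AE t in ?M. ?a t \<bullet> ?a t - ?b t \<bullet> ?b t \<le> ?k t"
    using B_bound
  proof (rule AE_mp, intro AE_I2 impI)
    fix t assume "t \<in> space ?M" and Bt: "\<forall>x w. norm (B t x *v w) \<le> \<beta> * norm w"
    then have t: "t \<in> {t0<..<T}" and t': "t \<in> {t0..T}" by auto
    let ?c = "exp (\<Lambda>1 * \<bar>\<tau> - t\<bar>) * \<beta>" and ?d = "growth \<bar>\<tau> - t\<bar> * \<beta> + exp (\<Lambda>1 * \<bar>\<tau> - t\<bar>) * LB"
    have d0: "0 \<le> ?d" using \<beta> LB growth_nonneg[of "\<bar>\<tau> - t\<bar>"] by simp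
    have na: "norm (?a t) \<le> ?c" and nb: "norm (?b t) \<le> ?c"
      using norm_transpose_mult_le[OF ctrl_le[OF \<tau> t], of x w] norm_transpose_mult_le[OF ctrl_le[OF \<tau> t], of z w] Bt w
      by simp_all
    have "norm (transpose (ctrl \<tau> z t - ctrl \<tau> x t) *v w) \<le> ?d * norm (z t - x t) * norm w"
      using Bt by (intro norm_transpose_mult_le ctrl_diff_le \<tau> t) simp
    moreover have "transpose (ctrl \<tau> z t - ctrl \<tau> x t) *v w = ?b t - ?a t"
    proof -
      have "transpose (ctrl \<tau> z t - ctrl \<tau> x t) = transpose (ctrl \<tau> z t) - transpose (ctrl \<tau> x t)"
        by (simp add: transpose_def vec_eq_iff)
      then show ?thesis by (simp add: matrix_vector_mult_diff_rdistrib)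
    qed
    ultimately have "norm (?a t - ?b t) \<le> ?d * norm (z t - x t)" using w by (simp add: norm_minus_commute)
    also have "\<dots> \<le> ?d * (\<beta> * (exp (\<mu> * (t - t0)) - 1) / \<mu> * \<delta>)"
      by (rule mult_left_mono[OF trajectory_diff_le[OF x z v vu \<zeta> \<delta> \<mu> t'] d0])
    finally have nd: "norm (?a t - ?b t) \<le> ?d * (\<beta> * (exp (\<mu> * (t - t0)) - 1) / \<mu> * \<delta>)" .
    have "p \<bullet> p - q \<bullet> q = (p + q) \<bullet> (p - q)" for p q :: "real^'k"
      by (simp only: inner_add_left inner_diff_right inner_commute[of q p])
    then have "?a t \<bullet> ?a t - ?b t \<bullet> ?b t = (?a t + ?b t) \<bullet> (?a t - ?b t)" by blast
    also have "\<dots> \<le> norm (?a t + ?b t) * norm (?a t - ?b t)" by (rule norm_cauchy_schwarz)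
    also have "\<dots> \<le> (?c + ?c) * (?d * (\<beta> * (exp (\<mu> * (t - t0)) - 1) / \<mu> * \<delta>))"
      using \<beta> by (intro mult_mono nd order_trans[OF norm_triangle_ineq add_mono[OF na nb]]) simp_all
    also have "\<dots> = ?k t" by (simp add: rate_def)
    finally show "?a t \<bullet> ?a t - ?b t \<bullet> ?b t \<le> ?k t" .
  qed
  have ia: "integrable ?M (\<lambda>t. ?a t \<bullet> ?a t)" and ib: "integrable ?M (\<lambda>t. ?b t \<bullet> ?b t)"
    by (rule gramian_form(1)[OF xc \<tau>], rule gramian_form(1)[OF zc \<tau>])
  have "w \<bullet> (gramian \<tau> x *v w) - w \<bullet> (gramian \<tau> z *v w) = (LINT t|?M. ?a t \<bullet> ?a t - ?b t \<bullet> ?b t)"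
    unfolding gramian_form(2)[OF xc \<tau>] gramian_form(2)[OF zc \<tau>]
    by (rule Bochner_Integration.integral_diff[OF ia ib, symmetric])
  also have "\<dots> \<le> (LINT t|?M. ?k t)"
    by (rule integral_mono_AE[OF Bochner_Integration.integrable_diff[OF ia ib] kint le])
  finally show ?thesis unfolding kval .
qed

end

section \<open>Synthesised controls\<close>

context controlled_flow
begin

lemma synthesis_eq:
  "synthesis t0 T \<Phi> B X \<tau> y u t
     = transpose (ctrl \<tau> (X u) t) *v (pinv (gramian \<tau> (X u)) *v y)"
  unfolding synthesis_def gram_eq ctrl_def matrix_transpose_mul by (simp only: matrix_vector_mul_assoc matrix_mul_assoc)

lemma synthesis_bound:
  assumes z: "continuous_on {t0..T} (X u)" and \<tau>: "\<tau> \<in> {t0..T}"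
    and C: "C > 0" "inverse C \<le> lambda_min (gramian \<tau> (X u))"
  shows "AE t in lebesgue_on {t0<..<T}.
    norm (synthesis t0 T \<Phi> B X \<tau> y u t) \<le> C * \<beta> * exp (\<Lambda>1 * (T - t0)) * norm y"
  using ctrl_uniform_bound[OF \<tau>, of "X u"]
proof (rule AE_mp, intro AE_I2 impI)
  fix t assume b: "\<forall>w. norm (ctrl \<tau> (X u) t *v w) \<le> exp (\<Lambda>1 * (T - t0)) * \<beta> * norm w"
  let ?p = "pinv (gramian \<tau> (X u)) *v y"
  have "norm (synthesis t0 T \<Phi> B X \<tau> y u t) \<le> exp (\<Lambda>1 * (T - t0)) * \<beta> * norm ?p"
    unfolding synthesis_eq using b by (intro norm_transpose_mult_le) blast
  also have "norm ?p \<le> C * norm y"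
    by (rule norm_pinv_mult_le[OF gramian_symmetric[OF z \<tau>] gramian_nonneg[OF z \<tau>] C])
  then have "exp (\<Lambda>1 * (T - t0)) * \<beta> * norm ?p \<le> exp (\<Lambda>1 * (T - t0)) * \<beta> * (C * norm y)"
    using \<beta> by (intro mult_left_mono) simp_all
  finally show "norm (synthesis t0 T \<Phi> B X \<tau> y u t) \<le> C * \<beta> * exp (\<Lambda>1 * (T - t0)) * norm y"
    by (simp only: mult_ac)
qed

lemma synthesis_measurable:
  assumes "continuous_on {t0..T} (X u)" "\<tau> \<in> {t0..T}"
  shows "synthesis t0 T \<Phi> B X \<tau> y u \<in> borel_measurable (lebesgue_on {t0<..<T})"
proof -
  have eq: "synthesis t0 T \<Phi> B X \<tau> y u
      = (\<lambda>t. transpose (ctrl \<tau> (X u) t) *v (pinv (gramian \<tau> (X u)) *v y))"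
    by (rule ext) (rule synthesis_eq)
  show ?thesis
    unfolding eq by (intro borel_measurable_matrix_vector_mult borel_measurable_transpose ctrl_measurable assms)
qed

end

text \<open>
  An essential bound over space and time holds, for almost every time, at almost every point, and then at every
  point since the inequality defines a closed set.
\<close>

lemma AE_B_le_B_norm:
  fixes B :: "real \<Rightarrow> real^'d \<Rightarrow> real^'k^'d"
  assumes B: "(\<lambda>(t, x). B t x) \<in> Linf (lebesgue_on ({t0<..<T} \<times> UNIV))"
    and cont: "\<And>t. t \<in> {t0<..<T} \<Longrightarrow> continuous_on UNIV (B t)"
  shows "AE t in lebesgue_on {t0<..<T}. \<forall>x w. norm (B t x *v w) \<le> B_norm t0 T B * norm w"
proof -
  let ?M = "lebesgue_on ({t0<..<T} \<times> (UNIV :: (real^'d) set))" and ?\<beta> = "B_norm t0 T B"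
  let ?g = "\<lambda>(t, x). spectral_norm (B t x)"
  have meas: "(\<lambda>(t, x). B t x) \<in> borel_measurable ?M" using B by (simp add: Linf_def)
  obtain c where c: "AE z in ?M. norm ((\<lambda>(t, x). B t x) z) \<le> c" using B by (auto simp: Linf_def)
  have g: "?g \<in> borel_measurable ?M"
    using measurable_compose[OF meas borel_measurable_continuous_onI[OF continuous_spectral_norm]]
    by (simp add: case_prod_unfold)
  have "AE z in ?M. ?g z \<le> c"
    using c by (rule AE_mp) (auto intro!: AE_I2 order_trans[OF spectral_norm_le_norm])
  from AE_le_ess_sup[OF g this] have "AE z in ?M. ?g z \<le> ?\<beta>" by (simp add: B_norm_def)
  from AE_lebesgue_on_slices(1)[OF _ this]
  have "AE t in lborel. AE x in lborel. t \<in> {t0<..<T} \<longrightarrow> spectral_norm (B t x) \<le> ?\<beta>" by simp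
  then have "AE t in lborel. t \<in> {t0<..<T} \<longrightarrow> (\<forall>x w. norm (B t x *v w) \<le> ?\<beta> * norm w)"
  proof (rule AE_mp, intro AE_I2 impI allI)
    fix t :: real and x :: "real^'d" and w :: "real^'k" assume ae: "AE x in lborel. t \<in> {t0<..<T} \<longrightarrow> spectral_norm (B t x) \<le> ?\<beta>" and t: "t \<in> {t0<..<T}"
    have "AE x in lebesgue. x \<in> {x. spectral_norm (B t x) \<le> ?\<beta>}"
      using ae t by (intro AE_completion) simp
    moreover have "closed {x. spectral_norm (B t x) \<le> ?\<beta>}"
      by (intro closed_Collect_le continuous_on_compose2[OF continuous_spectral_norm cont[OF t]] continuous_on_const) simp
    ultimately have "x \<in> {x. spectral_norm (B t x) \<le> ?\<beta>}" by (intro mem_closed_if_AE_lebesgue)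
    then have "spectral_norm (B t x) * norm w \<le> ?\<beta> * norm w" by (intro mult_right_mono) simp_all
    then show "norm (B t x *v w) \<le> ?\<beta> * norm w"
      by (rule order_trans[OF norm_mult_le_spectral_norm])
  qed
  then have "AE t in lebesgue. t \<in> {t0<..<T} \<longrightarrow> (\<forall>x w. norm (B t x *v w) \<le> ?\<beta> * norm w)"
    by (rule AE_completion)
  then show ?thesis by (simp add: AE_restrict_space_iff)
qed

lemma B_norm_nonneg: "0 \<le> B_norm t0 T B"
  unfolding B_norm_def by (rule ess_sup_nonneg) (simp add: case_prod_unfold spectral_norm_nonneg)

lemma control_norm_nonneg: "0 \<le> control_norm t0 T u"
  unfolding control_norm_def by (rule ess_sup_nonneg) simp

lemma AE_le_control_norm:
  assumes "u \<in> controls t0 T"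
  shows "AE t in lebesgue_on {t0<..<T}. norm (u t) \<le> control_norm t0 T u"
proof -
  obtain c where c: "AE t in lebesgue_on {t0<..<T}. norm (u t) \<le> c"
    using assms by (auto simp: controls_def Linf_def)
  have "u \<in> borel_measurable (lebesgue_on {t0<..<T})"
    using assms by (simp add: controls_def Linf_def)
  then have "(\<lambda>t. norm (u t)) \<in> borel_measurable (lebesgue_on {t0<..<T})"
    by (rule measurable_compose[OF _ borel_measurable_norm])
  then show ?thesis unfolding control_norm_def using c by (rule AE_le_ess_sup)
qed

lemma lipschitz_mult_vec:
  fixes B :: "'a::real_normed_vector \<Rightarrow> real^'n^'m"
  assumes B: "\<And>x. (B has_derivative B' x) (at x)"
    and B': "\<And>x h. norm (B' x h *v w) \<le> L * norm h * norm w" and L: "L \<ge> 0"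
  shows "norm (B x *v w - B y *v w) \<le> L * norm (x - y) * norm w"
proof -
  have "norm (B x *v w - B y *v w) \<le> (L * norm w) * norm (x - y)"
  proof (rule differentiable_bound[where S = UNIV and f' = "\<lambda>x h. B' x h *v w"])
    fix x
    show "((\<lambda>x. B x *v w) has_derivative (\<lambda>h. B' x h *v w)) (at x within UNIV)"
      using bounded_linear.has_derivative[OF bounded_linear_matrix_vector_mult_left B] by simp
    show "onorm (\<lambda>h. B' x h *v w) \<le> L * norm w"
      by (rule onorm_bound) (use B'[of x] L in \<open>simp_all add: mult_ac\<close>)
  qed auto
  then show ?thesis by (simp only: mult_ac)
qed

theorem theorem3p20:
  fixes t0 T \<Lambda>1 \<Lambda>2 LB \<theta> C \<zeta> L :: real
    and i :: nat
    and N :: "real \<Rightarrow> real^'d \<Rightarrow> real^'d"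
    and DN :: "real \<Rightarrow> real^'d \<Rightarrow> ((real^'d) \<Rightarrow>\<^sub>L (real^'d))"
    and D2N :: "real \<Rightarrow> real^'d \<Rightarrow> ((real^'d) \<Rightarrow>\<^sub>L ((real^'d) \<Rightarrow>\<^sub>L (real^'d)))"
    and B :: "real \<Rightarrow> real^'d \<Rightarrow> real^'k^'d"
    and DB :: "real \<Rightarrow> real^'d \<Rightarrow> ((real^'d) \<Rightarrow>\<^sub>L (real^'k^'d))"
    and \<Phi> :: "real \<Rightarrow> real \<Rightarrow> real^'d \<Rightarrow> real^'d"
    and X :: "(real \<Rightarrow> real^'k) \<Rightarrow> real \<Rightarrow> real^'d"
    and x0 y :: "real^'d"
    and ub :: "real \<Rightarrow> real^'k"
  assumes time: "t0 < T"
    and N_meas: "\<And>x. (\<lambda>t. N t x) \<in> Linf (lebesgue_on {t0<..<T})"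
    and \<Lambda>_pos: "\<Lambda>1 > 0" "\<Lambda>2 > 0"
    and N_deriv: "\<And>t x. t \<in> {t0..T} \<Longrightarrow> (N t has_derivative blinfun_apply (DN t x)) (at x)"
    and N_deriv2: "\<And>t x. t \<in> {t0..T} \<Longrightarrow> (DN t has_derivative blinfun_apply (D2N t x)) (at x)"
    and N_C2: "\<And>t. t \<in> {t0..T} \<Longrightarrow> continuous_on UNIV (D2N t)"
    and DN_bound: "\<And>t x. t \<in> {t0..T} \<Longrightarrow> norm (DN t x) \<le> \<Lambda>1"
    and D2N_bound: "\<And>t x. t \<in> {t0..T} \<Longrightarrow> norm (D2N t x) \<le> \<Lambda>2"
    and flow: "is_flow t0 T N \<Phi>"
    and B_Linf: "(\<lambda>(t, x). B t x) \<in> Linf (lebesgue_on ({t0<..<T} \<times> UNIV))"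
    and B_deriv: "\<And>t x. t \<in> {t0<..<T} \<Longrightarrow> (B t has_derivative blinfun_apply (DB t x)) (at x)"
    and B_C1: "\<And>t. t \<in> {t0<..<T} \<Longrightarrow> continuous_on UNIV (DB t)"
    and LB_nonneg: "LB \<ge> 0"
    and DB_bound: "\<And>t x. t \<in> {t0<..<T} \<Longrightarrow> spectral_opnorm (DB t x) \<le> LB"
    and traj: "\<And>u. u \<in> controls t0 T \<Longrightarrow> is_trajectory t0 T N B x0 u (X u)"
    and i: "i \<in> {1, 2}"
    and ub: "ub \<in> controls t0 T"
    and ub_inv: "invertible (gram t0 T \<Phi> B X (tau t0 T i) ub)"
    and \<theta>: "0 < \<theta>" "\<theta> \<le> 1"
    and C: "C = (1 + \<theta>) / lambda_min (gram t0 T \<Phi> B X (tau t0 T i) ub)"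
    and \<zeta>: "\<zeta> = C * B_norm t0 T B * exp (\<Lambda>1 * (T - t0)) * norm y"
    and L: "L = lip_const i \<Lambda>1 \<Lambda>2 LB (B_norm t0 T B) (T - t0) \<zeta>" "L > 0"
    and ub_small: "control_norm t0 T ub
        < \<theta> * lambda_min (gram t0 T \<Phi> B X (tau t0 T i) ub) / ((1 + \<theta>) * L)"
  shows "feasible t0 T \<Phi> B X (tau t0 T i) C \<noteq> {} \<and>
    (norm y \<le> lambda_min (gram t0 T \<Phi> B X (tau t0 T i) ub)
                / ((1 + \<theta>) * B_norm t0 T B * exp (\<Lambda>1 * (T - t0)))
              * (\<theta> * lambda_min (gram t0 T \<Phi> B X (tau t0 T i) ub) / ((1 + \<theta>) * L)
                   - control_norm t0 T ub)
     \<longrightarrow> synthesis t0 T \<Phi> B X (tau t0 T i) y ` feasible t0 T \<Phi> B X (tau t0 T i) C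
           \<subseteq> feasible t0 T \<Phi> B X (tau t0 T i) C)"
proof -
  let ?\<beta> = "B_norm t0 T B" and ?\<tau> = "tau t0 T i" and ?cn = "control_norm t0 T ub"
  have N_lip: "norm (N t x - N t y) \<le> \<Lambda>1 * norm (x - y)" if t: "t \<in> {t0..T}" for t x y
  proof (rule differentiable_bound[where S = UNIV and f' = "\<lambda>x. blinfun_apply (DN t x)"])
    fix x
    show "(N t has_derivative blinfun_apply (DN t x)) (at x within UNIV)" using N_deriv[OF t] by simp
    show "onorm (blinfun_apply (DN t x)) \<le> \<Lambda>1" using DN_bound[OF t] by (simp add: norm_blinfun.rep_eq)
  qed auto
  have DN_lip: "norm (DN t x - DN t y) \<le> \<Lambda>2 * norm (x - y)" if t: "t \<in> {t0..T}" for t x y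
  proof (rule differentiable_bound[where S = UNIV and f' = "\<lambda>x. blinfun_apply (D2N t x)"])
    fix x
    show "(DN t has_derivative blinfun_apply (D2N t x)) (at x within UNIV)" using N_deriv2[OF t] by simp
    show "onorm (blinfun_apply (D2N t x)) \<le> \<Lambda>2" using D2N_bound[OF t] by (simp add: norm_blinfun.rep_eq)
  qed auto
  have B_cont: "continuous_on UNIV (B t)" if t: "t \<in> {t0<..<T}" for t
    using has_derivative_continuous[OF B_deriv[OF t]] by (simp add: continuous_on_eq_continuous_at)
  have B_lip: "norm (B t x *v w - B t y *v w) \<le> LB * norm (x - y) * norm w" if t: "t \<in> {t0<..<T}" for t x y w
  proof (rule lipschitz_mult_vec[OF B_deriv[OF t]])
    fix x h
    have "norm (blinfun_apply (DB t x) h *v w) \<le> spectral_opnorm (DB t x) * norm h * norm w"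
      by (rule norm_apply_le_spectral_opnorm)
    also have "\<dots> \<le> LB * norm h * norm w" by (intro mult_right_mono DB_bound[OF t]) simp_all
    finally show "norm (blinfun_apply (DB t x) h *v w) \<le> LB * norm h * norm w" .
  qed (rule LB_nonneg)
  interpret controlled_flow t0 T \<Lambda>1 \<Lambda>2 N \<Phi> B LB ?\<beta>
  proof
    show "\<Lambda>1 > 0" "\<Lambda>2 \<ge> 0" using \<Lambda>_pos by simp_all
    show "norm (N t (x + p + q) - N t (x + p) - N t (x + q) + N t x) \<le> \<Lambda>2 * norm p * norm q"
      if t: "t \<in> {t0..T}" for t x p q
      by (rule second_difference_le_of_lipschitz_derivative[OF N_deriv[OF t] DN_lip[OF t]])
    show "(\<lambda>(t, x). B t x) \<in> borel_measurable (lebesgue_on ({t0<..<T} \<times> UNIV))"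
      using B_Linf by (simp add: Linf_def)
    show "AE t in lebesgue_on {t0<..<T}. \<forall>x w. norm (B t x *v w) \<le> ?\<beta> * norm w"
      by (rule AE_B_le_B_norm[OF B_Linf B_cont])
  qed (use N_lip flow time LB_nonneg B_norm_nonneg B_cont B_lip in blast)+
  have \<tau>: "?\<tau> \<in> {t0..T}" using time by (simp add: tau_def)
  have cont: "continuous_on {t0..T} (X u)" if "u \<in> controls t0 T" for u
    by (rule abs_continuous_on_imp_continuous_on[OF trajectory_abs_continuous[OF traj[OF that]]])
  define lmin where "lmin = lambda_min (gramian ?\<tau> (X ub))"
  have lmin_pos: "lmin > 0"
    using lambda_min_pos_iff_invertible[OF gramian_symmetric[OF cont[OF ub] \<tau>] gramian_nonneg[OF cont[OF ub] \<tau>]] ub_inv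
    by (simp add: lmin_def gram_eq)
  have C': "C = (1 + \<theta>) / lmin" using C by (simp add: lmin_def gram_eq)
  have C0: "C > 0" using C' lmin_pos \<theta> by simp
  have invC: "inverse C = lmin / (1 + \<theta>)" using C' by simp
  have "inverse C \<le> lmin" using lmin_pos \<theta> by (simp add: invC divide_le_eq)
  then have ub_feasible: "ub \<in> feasible t0 T \<Phi> B X ?\<tau> C"
    using ub by (simp add: feasible_def gram_eq lmin_def)
  have "synthesis t0 T \<Phi> B X ?\<tau> y u \<in> feasible t0 T \<Phi> B X ?\<tau> C"
    if small: "norm y \<le> lmin / ((1 + \<theta>) * ?\<beta> * exp (\<Lambda>1 * (T - t0))) * (\<theta> * lmin / ((1 + \<theta>) * L) - ?cn)"
      and u: "u \<in> feasible t0 T \<Phi> B X ?\<tau> C" for u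
  proof -
    define v where "v = synthesis t0 T \<Phi> B X ?\<tau> y u"
    have u': "u \<in> controls t0 T" "inverse C \<le> lambda_min (gramian ?\<tau> (X u))"
      using u by (simp_all add: feasible_def gram_eq)
    have v_le: "AE t in lebesgue_on {t0<..<T}. norm (v t) \<le> \<zeta>"
      using synthesis_bound[where X = X and u = u and y = y, OF cont[OF u'(1)] \<tau> C0 u'(2)] by (simp only: v_def \<zeta>)
    have "v \<in> borel_measurable (lebesgue_on {t0<..<T})"
      unfolding v_def by (rule synthesis_measurable[where X = X and u = u, OF cont[OF u'(1)] \<tau>])
    then have v_ctrl: "v \<in> controls t0 T" using v_le by (auto simp: controls_def Linf_def)
    have \<zeta>0: "\<zeta> \<ge> 0" using \<zeta> C0 \<beta> by simp
    define R where "R = \<theta> * lmin / ((1 + \<theta>) * L) - ?cn"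
    have R0: "0 < R" using ub_small by (simp add: R_def lmin_def gram_eq)
    \<comment> \<open>If \<open>B\<close> vanishes, the bound on \<open>y\<close> has denominator \<open>0\<close>, but then \<open>\<zeta> = 0\<close>.\<close>
    have \<zeta>R: "\<zeta> \<le> R"
    proof (cases "?\<beta> = 0")
      case True
      then show ?thesis using \<zeta> R0 by simp
    next
      case False
      define P where "P = (1 + \<theta>) * ?\<beta> * exp (\<Lambda>1 * (T - t0))"
      have P0: "P > 0" using False \<beta> \<theta> by (simp add: P_def)
      have "\<zeta> = P / lmin * norm y" by (simp add: \<zeta> C' P_def)
      also have "\<dots> \<le> P / lmin * (lmin / P * R)"
        using small P0 lmin_pos by (intro mult_left_mono) (simp_all add: P_def R_def)
      also have "\<dots> = R" using P0 lmin_pos by simp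
      finally show ?thesis .
    qed
    define \<delta> where "\<delta> = \<zeta> + ?cn"
    have \<delta>0: "0 \<le> \<delta>" using \<zeta>0 control_norm_nonneg[of t0 T ub] by (simp add: \<delta>_def)
    have "AE t in lebesgue_on {t0<..<T}. norm (v t) \<le> \<zeta> \<and> norm (ub t) \<le> ?cn"
      using v_le AE_le_control_norm[OF ub] by simp
    then have v_ub: "AE t in lebesgue_on {t0<..<T}. norm (v t - ub t) \<le> \<delta>"
    proof (rule AE_mp, intro AE_I2 impI)
      fix t assume "norm (v t) \<le> \<zeta> \<and> norm (ub t) \<le> ?cn"
      then show "norm (v t - ub t) \<le> \<delta>"
        using norm_triangle_ineq4[of "v t" "ub t"] by (simp add: \<delta>_def)
    qed
    define \<mu> where "\<mu> = \<Lambda>1 + LB * \<zeta>"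
    have \<mu>0: "\<mu> > 0" using \<Lambda>1 LB \<zeta>0 by (simp add: \<mu>_def add_pos_nonneg)
    have \<Delta>0: "0 \<le> T - t0" using time by simp
    obtain K where K: "((\<lambda>t. rate \<mu> (t - t0) \<bar>?\<tau> - t\<bar>) has_integral K) {t0..T}" and KL: "K \<le> L"
    proof (cases "i = 1")
      case True
      then have eqs: "?\<tau> = t0" "L = lip1 \<Lambda>1 \<Lambda>2 LB ?\<beta> (T - t0) \<zeta>" using L by (simp_all add: tau_def lip_const_def)
      show ?thesis
        by (rule that, unfold eqs, rule rate_integral_initial[OF \<mu>0],
            rule lip_integral1_le_lip1[OF \<Lambda>1 LB \<zeta>0 \<Delta>0 \<mu>_def])
    next
      case False
      then have eqs: "?\<tau> = T" "L = lip2 \<Lambda>1 \<Lambda>2 LB ?\<beta> (T - t0) \<zeta>" using L by (simp_all add: tau_def lip_const_def)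
      show ?thesis
        by (rule that, unfold eqs, rule rate_integral_final[OF \<mu>0],
            rule lip_integral2_le_lip2[OF \<Lambda>1 \<Lambda>2 \<beta> LB \<zeta>0 \<Delta>0 \<mu>_def])
    qed
    \<comment> \<open>The loss of smallest eigenvalue is at most \<open>L * (\<zeta> + ?cn) \<le> lmin - lmin / (1 + \<theta>)\<close>.\<close>
    have "lmin - K * \<delta> \<le> lambda_min (gramian ?\<tau> (X v))"
      unfolding lmin_def
      by (rule lambda_min_perturbation[OF gramian_symmetric[OF cont[OF ub] \<tau>] gramian_symmetric[OF cont[OF v_ctrl] \<tau>]
            gramian_perturbation[OF traj[OF ub] traj[OF v_ctrl] v_le v_ub \<zeta>0 \<delta>0 \<mu>_def \<tau> K]])
    moreover have "K * \<delta> \<le> L * \<delta>" using KL \<delta>0 by (rule mult_right_mono)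
    moreover have "L * \<delta> \<le> L * (\<theta> * lmin / ((1 + \<theta>) * L))"
      using \<zeta>R L(2) by (intro mult_left_mono) (simp_all add: \<delta>_def R_def)
    moreover have "L * (\<theta> * lmin / ((1 + \<theta>) * L)) = lmin - lmin / (1 + \<theta>)"
    proof -
      have "L * (\<theta> * lmin / ((1 + \<theta>) * L)) = \<theta> * lmin / (1 + \<theta>)" using L(2) by simp
      also have "\<dots> = lmin - lmin / (1 + \<theta>)" using \<theta> by (simp add: field_simps)
      finally show ?thesis .
    qed
    ultimately have "inverse C \<le> lambda_min (gramian ?\<tau> (X v))" unfolding invC by linarith
    then have "v \<in> feasible t0 T \<Phi> B X ?\<tau> C" using v_ctrl by (simp add: feasible_def gram_eq)
    then show ?thesis by (simp only: v_def)
  qed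
  then show ?thesis using ub_feasible by (auto simp: lmin_def gram_eq)
qed

end
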